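(* Let $K$ be any constant and let $f\in\mathcal{S}_K$ be a gate as defined in the context. Then there exists a span program $P$ over $\mathbb{C}$ with $f_P=f$ whose witness size, computed with all input complexities $U_i=1$, satisfies $\mathrm{wsize}(P)=\mathrm{ADV}(f)$.
   Context: Gate set. $\mathcal{S}'_K$ consists of all Boolean functions on $1$, $2$ or $3$ bits and $\mathrm{EQUAL}_k$ for $2\le k\le K$, where $\mathrm{EQUAL}_k(y)=1$ iff all $y_r$ are equal. $\mathcal{S}_K$ consists of all functions $g\circ(h_1,\dots,h_\ell)$, where $g$ is a read-once formula of size at most $K$ over AND, OR, NOT, PARITY, and each $h_r$ is a single variable or a gate from $\mathcal{S}'_K$, the $h_r$ acting on pairwise disjoint variable sets. Span programs. A span program $P$ on $n$ variables consists of a target vector $t=(1,0,\dots,0)\in\mathbb{C}^m$ and vectors $v_j\in\mathbb{C}^m$ ($j\in J$), each labeled by a set $X_j$ of literals from $\{x_1,\overline{x_1},\dots,x_n,\overline{x_n}\}$. Grouped input $j$ is true on $x$ iff all literals of $X_j$ are true on $x$. We set $f_P(x)=1$ iff $t$ is a linear combination of the $v_j$ with $j$ true. Witness size. Let $I_j$ index the literals of $X_j$, and assign an input complexity $U_i>0$ to each $i\in I_j$. For input $x$, define the grouped input complexity $$\tilde U_j=\max\{\textstyle\sum_{i\in I_j}U_i,\,1\}\ \text{if $j$ is true},\qquad \tilde U_j=\Big(\sum_{i\in I_j,\ \text{literal $i$ false}}U_i^{-1}\Big)^{-1}\ \text{otherwise}.$$ Let $\tilde U=\sum_j\tilde U_j|j\rangle\langle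 j|$, let $\Pi=\sum_{j\text{ true}}|j\rangle\langle j|$, and let $A=\sum_j|v_j\rangle\langle j|$. - If $f_P(x)=1$: $\mathrm{wsize}(P,x)=\min\{\|\tilde U^{1/2}w\|^2: w\in\mathbb{C}^J,\ A\Pi w=t\}$. - If $f_P(x)=0$: $\mathrm{wsize}(P,x)=\min\{\|\tilde U^{1/2}A^\dagger w'\|^2: w'\in\mathbb{C}^m,\ \langle t|w'\rangle=1,\ \Pi A^\dagger w'=0\}$. Finally $\mathrm{wsize}(P)=\max_x\mathrm{wsize}(P,x)$. Adversary bound. For $f:\{0,1\}^k\to\{0,1\}$, $\mathrm{ADV}(f)=\max_\Gamma\|\Gamma\|/\max_i\|\Gamma\circ D_i\|$. The maximum is over nonzero symmetric nonnegative $2^k\times2^k$ matrices $\Gamma$ with $\Gamma[x,y]=0$ when $f(x)=f(y)$, and $D_i[x,y]=1$ iff $x_i\ne y_i$ (else $0$).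
   Formalization: The formal theorem assumes that f is not constant; for a constant gate no nonzero adversary matrix Γ exists, so the maximum defining ADV(f) is over the empty set and is undefined. *)

theory Defs
  imports "HOL-Analysis.Analysis"
begin

text \<open>An input on n bits is a function x :: nat => bool with x i = False for i >= n
  (bit x_i of the paper, 1-indexed, is x (i-1) here).\<close>
definition cube :: "nat \<Rightarrow> (nat \<Rightarrow> bool) set" where
  "cube n = {x. \<forall>i\<ge>n. \<not> x i}"

definition EQUAL_fn :: "bool list \<Rightarrow> bool" where
  "EQUAL_fn ys = (\<forall>a\<in>set ys. \<forall>b\<in>set ys. a = b)"

text \<open>A gate of S'_K applied to the (distinct) variables vs: phi is evaluated on
  the list of values of those variables.  Either an arbitrary Boolean function on
  1, 2 or 3 bits, or EQUAL_k with 2 <= k <= K.  (A single variable is the 1-bit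
  identity function.)\<close>
definition SK'_gate :: "nat \<Rightarrow> (bool list \<Rightarrow> bool) \<Rightarrow> nat list \<Rightarrow> bool" where
  "SK'_gate K phi vs \<longleftrightarrow> distinct vs \<and>
     (length vs \<in> {1,2,3} \<or>
      (2 \<le> length vs \<and> length vs \<le> K \<and>
       (\<forall>ys. length ys = length vs \<longrightarrow> phi ys = EQUAL_fn ys)))"

datatype rof = RLeaf nat | RAnd "rof list" | ROr "rof list" | RNot rof | RPar "rof list"

fun rof_eval :: "rof \<Rightarrow> (nat \<Rightarrow> bool) \<Rightarrow> bool" where
  "rof_eval (RLeaf r) y = y r"
| "rof_eval (RAnd gs) y = list_all (\<lambda>g. rof_eval g y) gs"
| "rof_eval (ROr gs) y = list_ex (\<lambda>g. rof_eval g y) gs"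
| "rof_eval (RNot g) y = (\<not> rof_eval g y)"
| "rof_eval (RPar gs) y = odd (length (filter (\<lambda>g. rof_eval g y) gs))"

fun rof_leaves :: "rof \<Rightarrow> nat list" where
  "rof_leaves (RLeaf r) = [r]"
| "rof_leaves (RAnd gs) = concat (map rof_leaves gs)"
| "rof_leaves (ROr gs) = concat (map rof_leaves gs)"
| "rof_leaves (RNot g) = rof_leaves g"
| "rof_leaves (RPar gs) = concat (map rof_leaves gs)"

fun rof_wf :: "rof \<Rightarrow> bool" where
  "rof_wf (RLeaf r) = True"
| "rof_wf (RAnd gs) = (gs \<noteq> [] \<and> list_all rof_wf gs)"
| "rof_wf (ROr gs) = (gs \<noteq> [] \<and> list_all rof_wf gs)"
| "rof_wf (RNot g) = rof_wf g"
| "rof_wf (RPar gs) = (gs \<noteq> [] \<and> list_all rof_wf gs)"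

text \<open>f (on n bits) is in S_K: f = g o (h_0,...,h_{l-1}) where g is a read-once
  formula of size (= number of leaves) l <= K on inputs 0..l-1, and h_r is the
  S'_K gate phi r applied to variables vs r, the variable sets being pairwise disjoint.\<close>
definition in_SK :: "nat \<Rightarrow> nat \<Rightarrow> ((nat \<Rightarrow> bool) \<Rightarrow> bool) \<Rightarrow> bool" where
  "in_SK K n f \<longleftrightarrow> (\<exists>g l phi vs.
     rof_wf g \<and> distinct (rof_leaves g) \<and> set (rof_leaves g) = {..<l} \<and> l \<le> K \<and>
     (\<forall>r<l. SK'_gate K (phi r) (vs r) \<and> set (vs r) \<subseteq> {..<n}) \<and>
     (\<forall>r<l. \<forall>r'<l. r \<noteq> r' \<longrightarrow> set (vs r) \<inter> set (vs r') = {}) \<and>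
     (\<forall>x\<in>cube n. f x = rof_eval g (\<lambda>r. phi r (map x (vs r)))))"

definition opnorm :: "'a set \<Rightarrow> ('a \<Rightarrow> 'a \<Rightarrow> real) \<Rightarrow> real" where
  "opnorm S M = Sup {sqrt (\<Sum>x\<in>S. (\<Sum>y\<in>S. M x y * u y)\<^sup>2) | u. (\<Sum>y\<in>S. (u y)\<^sup>2) \<le> 1}"

definition adv_matrix :: "nat \<Rightarrow> ((nat \<Rightarrow> bool) \<Rightarrow> bool) \<Rightarrow> ((nat \<Rightarrow> bool) \<Rightarrow> (nat \<Rightarrow> bool) \<Rightarrow> real) \<Rightarrow> bool" where
  "adv_matrix n f G \<longleftrightarrow>
     (\<forall>x\<in>cube n. \<forall>y\<in>cube n. G x y = G y x \<and> 0 \<le> G x y \<and> (f x = f y \<longrightarrow> G x y = 0)) \<and>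
     (\<exists>x\<in>cube n. \<exists>y\<in>cube n. G x y \<noteq> 0)"

definition ADV :: "nat \<Rightarrow> ((nat \<Rightarrow> bool) \<Rightarrow> bool) \<Rightarrow> real" where
  "ADV n f = Sup {opnorm (cube n) G /
        Max ((\<lambda>i. opnorm (cube n) (\<lambda>x y. G x y * (if x i \<noteq> y i then 1 else 0))) ` {..<n})
      | G. adv_matrix n f G}"

text \<open>Span program: dimension m, index set J = {0..<N}, vectors v j (coordinates
  0..<m), label sets X j of literals; literal (i, b) means "x_i = b".
  The target is t = (1,0,...,0).\<close>
record spanprog =
  sp_m :: nat
  sp_N :: nat
  sp_v :: "nat \<Rightarrow> nat \<Rightarrow> complex"
  sp_X :: "nat \<Rightarrow> (nat \<times> bool) set"

definition sp_target :: "nat \<Rightarrow> complex" where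
  "sp_target k = (if k = 0 then 1 else 0)"

definition sp_valid :: "nat \<Rightarrow> spanprog \<Rightarrow> bool" where
  "sp_valid n P \<longleftrightarrow> 1 \<le> sp_m P \<and> (\<forall>j<sp_N P. sp_X P j \<subseteq> {..<n} \<times> UNIV)"

definition sp_true :: "spanprog \<Rightarrow> (nat \<Rightarrow> bool) \<Rightarrow> nat \<Rightarrow> bool" where
  "sp_true P x j \<longleftrightarrow> (\<forall>(i, b)\<in>sp_X P j. x i = b)"

definition sp_eval :: "spanprog \<Rightarrow> (nat \<Rightarrow> bool) \<Rightarrow> bool" where
  "sp_eval P x \<longleftrightarrow> (\<exists>w :: nat \<Rightarrow> complex. \<forall>k<sp_m P.
      (\<Sum>j<sp_N P. (if sp_true P x j then w j else 0) * sp_v P j k) = sp_target k)"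

text \<open>Grouped input complexity with all input complexities U_i = 1.\<close>
definition sp_U :: "spanprog \<Rightarrow> (nat \<Rightarrow> bool) \<Rightarrow> nat \<Rightarrow> real" where
  "sp_U P x j = (if sp_true P x j then max (\<Sum>l\<in>sp_X P j. 1) 1
                 else inverse (\<Sum>l\<in>{l\<in>sp_X P j. x (fst l) \<noteq> snd l}. inverse 1))"

definition wsize_at :: "spanprog \<Rightarrow> (nat \<Rightarrow> bool) \<Rightarrow> real" where
  "wsize_at P x =
    (if sp_eval P x then
       Inf {(\<Sum>j<sp_N P. sp_U P x j * (cmod (w j))\<^sup>2) | w :: nat \<Rightarrow> complex.
              \<forall>k<sp_m P. (\<Sum>j<sp_N P. (if sp_true P x j then w j else 0) * sp_v P j k) = sp_target k}
     else
       Inf {(\<Sum>j<sp_N P. sp_U P x j * (cmod (\<Sum>k<sp_m P. cnj (sp_v P j k) * w' k))\<^sup>2) | w' :: nat \<Rightarrow> complex.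
              (\<Sum>k<sp_m P. cnj (sp_target k) * w' k) = 1 \<and>
              (\<forall>j<sp_N P. sp_true P x j \<longrightarrow> (\<Sum>k<sp_m P. cnj (sp_v P j k) * w' k) = 0)})"

definition wsize :: "nat \<Rightarrow> spanprog \<Rightarrow> real" where
  "wsize n P = Max (wsize_at P ` cube n)"

end

theory Submission
  imports Defs
begin

text \<open>
  The witness size of a span program and the adversary bound are dual optimisation problems. A
  \<^emph>\<open>dual solution\<close> of cost c assigns to every input x and variable i a real vector u(x,i) with
  squared norms summing to at most c over i, such that the inner products of u(x,i) and u(y,i)
  over the variables i on which x and y differ sum to 1 whenever f x and f y differ. It turns into
  a span program of witness size at most c (one row per zero of f), and conversely near-optimal
  witnesses of that program form a dual solution. Weak duality bounds the ratio of every adversary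
  matrix by the cost of every dual solution, so it suffices to exhibit a dual solution and a
  nonnegative adversary matrix with the same value c.

  Such matching pairs compose: on disjoint variables, values a and b give sqrt(a^2 + b^2) for AND
  and OR and a + b for PARITY, with adversary matrix the part of G (x) I + I (x) H connecting
  inputs with different function values. It remains to give pairs for EQUAL (value n / sqrt(n-1))
  and for the four classes of three-bit functions, up to permuting and negating variables and
  negating the output, that are neither read-once nor EQUAL.
\<close>

section \<open>Dual solutions and adversary matrices\<close>

text \<open>The pairing in \<open>dual_sol\<close> must equal 1, not just be at least 1: the vectors
  become rows of a span program whose positive witnesses have to hit the target exactly. With
  equality the dual problem belongs to the adversary bound with signed matrices, which can exceed
  the bound with nonnegative ones. Hence duality alone does not give the result, and every basic
  gate needs its own nonnegative matrix that meets the stronger dual bound. Explicit certificates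
  also settle attainment: \<open>has_primal\<close> carries two vectors at which the form takes the
  value c, so no spectral theorem, strong duality or compactness enters. The infima in the witness
  size are only approached up to a positive error. The supports in \<open>has_primal\<close> (p on
  zeros, q on ones) make p and q orthogonal, which kills the cross terms in compositions. On the
  dual side only products of a vector of a zero with a vector of a one are constrained, so the two
  families may be rescaled inversely. Costs c0 on zeros and c1 on ones thus become the geometric
  mean sqrt (c0 c1), the form in which the values of EQUAL and of the three-bit functions
  arise.\<close>

text \<open>Inputs are subsets x of a finite set A of variables; variable i is true iff i is in x.\<close>

definition differs :: "nat \<Rightarrow> nat set \<Rightarrow> nat set \<Rightarrow> bool" where
  "differs i x y \<longleftrightarrow> (i \<in> x) \<noteq> (i \<in> y)"

definition bil :: "'a set \<Rightarrow> ('a \<Rightarrow> 'a \<Rightarrow> real) \<Rightarrow> ('a \<Rightarrow> real) \<Rightarrow> ('a \<Rightarrow> real) \<Rightarrow> real" where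
  "bil S G p q = (\<Sum>x\<in>S. \<Sum>y\<in>S. p x * G x y * q y)"

definition dual_sol :: "nat set \<Rightarrow> (nat set \<Rightarrow> bool) \<Rightarrow> nat \<Rightarrow> (nat set \<Rightarrow> nat \<Rightarrow> nat \<Rightarrow> real) \<Rightarrow> bool" where
  "dual_sol A f k u \<longleftrightarrow> (\<forall>x\<in>Pow A. \<forall>y\<in>Pow A. f x \<noteq> f y \<longrightarrow>
     (\<Sum>i\<in>A. if differs i x y then \<Sum>l<k. u x i l * u y i l else 0) = 1)"

definition dual_cost :: "nat set \<Rightarrow> nat \<Rightarrow> (nat set \<Rightarrow> nat \<Rightarrow> nat \<Rightarrow> real) \<Rightarrow> nat set \<Rightarrow> real" where
  "dual_cost A k u x = (\<Sum>i\<in>A. \<Sum>l<k. (u x i l)\<^sup>2)"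

definition has_dual :: "nat set \<Rightarrow> (nat set \<Rightarrow> bool) \<Rightarrow> real \<Rightarrow> bool" where
  "has_dual A f c \<longleftrightarrow> (\<exists>k u. dual_sol A f k u \<and> (\<forall>x\<in>Pow A. dual_cost A k u x \<le> c))"

text \<open>Normalised so that the matrix restricted to pairs differing in any one variable has norm
  at most 1. Scaling \<open>a\<close> and \<open>b\<close> inversely shows that the bound by the
  arithmetic mean is equivalent to the bound by the product of the norms; it avoids square roots and
  suprema.\<close>

definition adv_sol :: "nat set \<Rightarrow> (nat set \<Rightarrow> bool) \<Rightarrow> (nat set \<Rightarrow> nat set \<Rightarrow> real) \<Rightarrow> bool" where
  "adv_sol A f G \<longleftrightarrow>
     (\<forall>x\<in>Pow A. \<forall>y\<in>Pow A. G x y = G y x \<and> 0 \<le> G x y \<and> (f x = f y \<longrightarrow> G x y = 0)) \<and>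
     (\<forall>i\<in>A. \<forall>a b. bil (Pow A) (\<lambda>x y. if differs i x y then G x y else 0) a b
        \<le> ((\<Sum>x\<in>Pow A. (a x)\<^sup>2) + (\<Sum>x\<in>Pow A. (b x)\<^sup>2)) / 2)"

definition has_primal :: "nat set \<Rightarrow> (nat set \<Rightarrow> bool) \<Rightarrow> real \<Rightarrow> bool" where
  "has_primal A f c \<longleftrightarrow> (\<exists>G p q. adv_sol A f G \<and>
     (\<forall>x\<in>Pow A. (f x \<longrightarrow> p x = 0) \<and> (\<not> f x \<longrightarrow> q x = 0)) \<and>
     (\<Sum>x\<in>Pow A. (p x)\<^sup>2) = 1 \<and> (\<Sum>x\<in>Pow A. (q x)\<^sup>2) = 1 \<and> bil (Pow A) G p q = c)"

definition tight :: "nat set \<Rightarrow> (nat set \<Rightarrow> bool) \<Rightarrow> bool" where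
  "tight A f \<longleftrightarrow> (\<exists>c>0. has_dual A f c \<and> has_primal A f c)"

text \<open>Constant functions have no such pair, but occur as subformulas of nonconstant ones.\<close>

definition opt :: "nat set \<Rightarrow> (nat set \<Rightarrow> bool) \<Rightarrow> bool" where
  "opt A f \<longleftrightarrow> tight A f \<or> (\<forall>x\<in>Pow A. f x) \<or> (\<forall>x\<in>Pow A. \<not> f x)"

lemma differs_commute: "differs i x y = differs i y x"
  by (auto simp: differs_def)

lemma bil_cong:
  assumes "\<And>x y. x \<in> S \<Longrightarrow> y \<in> S \<Longrightarrow> p x * G x y * q y = p' x * G' x y * q' y"
  shows "bil S G p q = bil S G' p' q'"
  unfolding bil_def by (intro sum.cong refl assms)

lemma bil_add_left: "bil S G (\<lambda>x. p x + p' x) q = bil S G p q + bil S G p' q"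
  by (simp add: bil_def algebra_simps sum.distrib)

lemma bil_add_right: "bil S G p (\<lambda>x. q x + q' x) = bil S G p q + bil S G p q'"
  by (simp add: bil_def algebra_simps sum.distrib)

lemma bil_add_mat: "bil S (\<lambda>x y. G x y + G' x y) p q = bil S G p q + bil S G' p q"
  by (simp add: bil_def algebra_simps sum.distrib)

lemma bil_scale_left: "bil S G (\<lambda>x. c * p x) q = c * bil S G p q"
  by (simp add: bil_def sum_distrib_left mult.assoc)

lemma bil_scale_right: "bil S G p (\<lambda>x. c * q x) = c * bil S G p q"
  by (simp add: bil_def sum_distrib_left mult_ac)

lemma bil_commute:
  assumes "\<And>x y. x \<in> S \<Longrightarrow> y \<in> S \<Longrightarrow> G x y = G y x"
  shows "bil S G p q = bil S G q p"
proof -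
  have "bil S G p q = (\<Sum>y\<in>S. \<Sum>x\<in>S. p x * G x y * q y)"
    unfolding bil_def by (rule sum.swap)
  also have "\<dots> = bil S G q p"
    unfolding bil_def using assms by (intro sum.cong refl) (simp add: mult_ac)
  finally show ?thesis .
qed

section \<open>Composition on disjoint variables\<close>

lemma sum_Pow_Un:
  fixes F :: "'a set \<Rightarrow> 'b::comm_monoid_add"
  assumes "A \<inter> B = {}"
  shows "(\<Sum>x\<in>Pow (A \<union> B). F x) = (\<Sum>a\<in>Pow A. \<Sum>b\<in>Pow B. F (a \<union> b))"
proof -
  have "(\<Sum>x\<in>Pow (A \<union> B). F x) = (\<Sum>(a, b)\<in>Pow A \<times> Pow B. F (a \<union> b))"
    using assms
    by (intro sum.reindex_bij_witness[where i = "\<lambda>(a, b). a \<union> b" and j = "\<lambda>x. (x \<inter> A, x \<inter> B)"])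
       (auto simp: Int_Un_distrib[symmetric] Int_absorb2 intro!: arg_cong[where f = F])
  then show ?thesis by (simp add: sum.cartesian_product)
qed

lemma Un_Int_parts:
  assumes "A \<inter> B = {}" "a \<in> Pow A" "b \<in> Pow B"
  shows "(a \<union> b) \<inter> A = a" "(a \<union> b) \<inter> B = b"
  using assms by auto

lemma sum_Pow_Un_prod:
  fixes F G :: "'a set \<Rightarrow> real"
  assumes "A \<inter> B = {}"
  shows "(\<Sum>x\<in>Pow (A \<union> B). F (x \<inter> A) * G (x \<inter> B)) = (\<Sum>a\<in>Pow A. F a) * (\<Sum>b\<in>Pow B. G b)"
  unfolding sum_Pow_Un[OF assms] sum_product
  by (intro sum.cong refl) (simp add: Un_Int_parts[OF assms])

text \<open>The Kronecker product of \<open>G\<close> with the identity matrix on the subsets of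
  \<open>B\<close>.\<close>

definition tensorI :: "nat set \<Rightarrow> nat set \<Rightarrow> (nat set \<Rightarrow> nat set \<Rightarrow> real) \<Rightarrow> nat set \<Rightarrow> nat set \<Rightarrow> real" where
  "tensorI A B G x y = (if x \<inter> B = y \<inter> B then G (x \<inter> A) (y \<inter> A) else 0)"

text \<open>The matrix is block diagonal, with one copy of \<open>G\<close> for each fixed
  \<open>B\<close>-part of the input.\<close>

lemma bil_tensorI:
  assumes "finite B" "A \<inter> B = {}"
  shows "bil (Pow (A \<union> B)) (tensorI A B G) p q =
    (\<Sum>b\<in>Pow B. bil (Pow A) G (\<lambda>a. p (a \<union> b)) (\<lambda>a. q (a \<union> b)))"
proof -
  have "bil (Pow (A \<union> B)) (tensorI A B G) p q =
     (\<Sum>a\<in>Pow A. \<Sum>b\<in>Pow B. \<Sum>a'\<in>Pow A. \<Sum>b'\<in>Pow B.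
        if b = b' then p (a \<union> b) * G a a' * q (a' \<union> b') else 0)"
    unfolding bil_def sum_Pow_Un[OF assms(2)]
    by (intro sum.cong refl) (simp add: tensorI_def Un_Int_parts[OF assms(2)])
  also have "\<dots> = (\<Sum>a\<in>Pow A. \<Sum>b\<in>Pow B. \<Sum>a'\<in>Pow A. p (a \<union> b) * G a a' * q (a' \<union> b))"
    by (intro sum.cong refl) (simp add: assms(1) sum.delta)
  also have "\<dots> = (\<Sum>b\<in>Pow B. bil (Pow A) G (\<lambda>a. p (a \<union> b)) (\<lambda>a. q (a \<union> b)))"
    unfolding bil_def by (rule sum.swap)
  finally show ?thesis .
qed

lemma bil_tensorI_prod:
  assumes "finite B" "A \<inter> B = {}"
  shows "bil (Pow (A \<union> B)) (tensorI A B G) (\<lambda>x. p (x \<inter> A) * p' (x \<inter> B)) (\<lambda>x. q (x \<inter> A) * q' (x \<inter> B))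
    = bil (Pow A) G p q * (\<Sum>b\<in>Pow B. p' b * q' b)"
proof -
  have "bil (Pow A) G (\<lambda>a. p ((a \<union> b) \<inter> A) * p' ((a \<union> b) \<inter> B)) (\<lambda>a. q ((a \<union> b) \<inter> A) * q' ((a \<union> b) \<inter> B))
     = bil (Pow A) G p q * (p' b * q' b)" if "b \<in> Pow B" for b
  proof -
    have "bil (Pow A) G (\<lambda>a. p ((a \<union> b) \<inter> A) * p' ((a \<union> b) \<inter> B)) (\<lambda>a. q ((a \<union> b) \<inter> A) * q' ((a \<union> b) \<inter> B))
      = bil (Pow A) G (\<lambda>a. p' b * p a) (\<lambda>a. q' b * q a)"
      using that by (intro bil_cong) (simp add: Un_Int_parts[OF assms(2)])
    then show ?thesis by (simp add: bil_scale_left bil_scale_right)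
  qed
  then show ?thesis
    unfolding bil_tensorI[OF assms] sum_distrib_left by (intro sum.cong refl)
qed

definition comb :: "nat set \<Rightarrow> nat set \<Rightarrow> (nat set \<Rightarrow> nat set \<Rightarrow> real) \<Rightarrow> (nat set \<Rightarrow> nat set \<Rightarrow> real)
    \<Rightarrow> nat set \<Rightarrow> nat set \<Rightarrow> real" where
  "comb A B G H x y = tensorI A B G x y + tensorI B A H x y"

lemma bil_comb_prod:
  assumes "finite A" "finite B" "A \<inter> B = {}"
  shows "bil (Pow (A \<union> B)) (comb A B G H) (\<lambda>x. p (x \<inter> A) * p' (x \<inter> B)) (\<lambda>x. q (x \<inter> A) * q' (x \<inter> B))
    = bil (Pow A) G p q * (\<Sum>b\<in>Pow B. p' b * q' b) + (\<Sum>a\<in>Pow A. p a * q a) * bil (Pow B) H p' q'"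
proof -
  have "bil (Pow (A \<union> B)) (tensorI B A H) (\<lambda>x. p (x \<inter> A) * p' (x \<inter> B)) (\<lambda>x. q (x \<inter> A) * q' (x \<inter> B))
    = bil (Pow (B \<union> A)) (tensorI B A H) (\<lambda>x. p' (x \<inter> B) * p (x \<inter> A)) (\<lambda>x. q' (x \<inter> B) * q (x \<inter> A))"
    by (simp add: Un_commute mult.commute)
  also have "\<dots> = bil (Pow B) H p' q' * (\<Sum>a\<in>Pow A. p a * q a)"
    by (rule bil_tensorI_prod) (use assms in auto)
  finally show ?thesis
    using assms by (simp add: comb_def[abs_def] bil_add_mat bil_tensorI_prod)
qed

text \<open>
  For a variable i of f, the second summand of the combined matrix vanishes where i differs, and
  the restriction to pairs with h x \<noteq> h y depends, on the support of G, only on the B-part.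
\<close>

lemma comb_differs_bound:
  assumes fin: "finite A" "finite B" and disj: "A \<inter> B = {}"
    and G: "adv_sol A f G" and i: "i \<in> A"
    and h: "\<And>x. x \<in> Pow (A \<union> B) \<Longrightarrow> h x = F (f (x \<inter> A)) (g (x \<inter> B))"
  shows "bil (Pow (A \<union> B)) (\<lambda>x y. if differs i x y then if h x \<noteq> h y then comb A B G H x y else 0 else 0) a b
     \<le> ((\<Sum>x\<in>Pow (A \<union> B). (a x)\<^sup>2) + (\<Sum>x\<in>Pow (A \<union> B). (b x)\<^sup>2)) / 2"
proof -
  \<comment> \<open>\<open>m\<close> says that, for the given value of g, the value of h depends on
    that of f. The restriction to \<open>h x \<noteq> h y\<close> thus becomes the restriction
    \<open>a'\<close> of the vector \<open>a\<close> to the blocks with \<open>m\<close>, and the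
    bound for \<open>G\<close> applies in each block.\<close>
  define m where "m y \<longleftrightarrow> F True (g y) \<noteq> F False (g y)" for y
  define a' where "a' x = (if m (x \<inter> B) then a x else 0)" for x
  define D where "D x y = (if differs i x y then G x y else 0)" for x y
  have "bil (Pow (A \<union> B)) (\<lambda>x y. if differs i x y then if h x \<noteq> h y then comb A B G H x y else 0 else 0) a b
    = bil (Pow (A \<union> B)) (tensorI A B D) a' b"
  proof (rule bil_cong)
    fix x y assume xy: "x \<in> Pow (A \<union> B)" "y \<in> Pow (A \<union> B)"
    have dA: "differs i (x \<inter> A) (y \<inter> A) = differs i x y"
      using i by (auto simp: differs_def)
    show "a x * (if differs i x y then if h x \<noteq> h y then comb A B G H x y else 0 else 0) * b y
       = a' x * tensorI A B D x y * b y"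
    proof (cases "differs i x y \<and> x \<inter> B = y \<inter> B")
      case True
      then have ne: "x \<inter> A \<noteq> y \<inter> A"
        using dA by (auto simp: differs_def)
      have z: "G (x \<inter> A) (y \<inter> A) = 0" if "f (x \<inter> A) = f (y \<inter> A)"
        using G that by (auto simp: adv_sol_def)
      have "h x \<noteq> h y \<longleftrightarrow> m (x \<inter> B)" if "f (x \<inter> A) \<noteq> f (y \<inter> A)"
        using that True by (cases "f (x \<inter> A)"; cases "f (y \<inter> A)") (auto simp: h[OF xy(1)] h[OF xy(2)] m_def)
      then show ?thesis
        using True ne z dA by (auto simp: comb_def tensorI_def D_def a'_def)
    next
      case False
      then show ?thesis
        using dA by (auto simp: comb_def tensorI_def D_def a'_def differs_def)
    qed
  qed
  also have "\<dots> = (\<Sum>b'\<in>Pow B. bil (Pow A) D (\<lambda>x. a' (x \<union> b')) (\<lambda>x. b (x \<union> b')))"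
    by (rule bil_tensorI) (use fin disj in auto)
  also have "\<dots> \<le> (\<Sum>b'\<in>Pow B. ((\<Sum>x\<in>Pow A. (a' (x \<union> b'))\<^sup>2) + (\<Sum>x\<in>Pow A. (b (x \<union> b'))\<^sup>2)) / 2)"
    using G i by (intro sum_mono) (auto simp: adv_sol_def D_def[abs_def])
  also have "\<dots> = ((\<Sum>b'\<in>Pow B. \<Sum>x\<in>Pow A. (a' (x \<union> b'))\<^sup>2) + (\<Sum>b'\<in>Pow B. \<Sum>x\<in>Pow A. (b (x \<union> b'))\<^sup>2)) / 2"
    by (simp add: sum_divide_distrib[symmetric] sum.distrib)
  also have "\<dots> = ((\<Sum>x\<in>Pow (A \<union> B). (a' x)\<^sup>2) + (\<Sum>x\<in>Pow (A \<union> B). (b x)\<^sup>2)) / 2"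
    unfolding sum_Pow_Un[OF disj] by (subst (1 2) sum.swap) simp
  also have "\<dots> \<le> ((\<Sum>x\<in>Pow (A \<union> B). (a x)\<^sup>2) + (\<Sum>x\<in>Pow (A \<union> B). (b x)\<^sup>2)) / 2"
    by (intro divide_right_mono add_mono sum_mono) (auto simp: a'_def)
  finally show ?thesis .
qed

lemma comb_commute: "comb A B G H = comb B A H G"
  by (simp add: comb_def fun_eq_iff)

lemma adv_sol_comb:
  assumes fin: "finite A" "finite B" and disj: "A \<inter> B = {}"
    and G: "adv_sol A f G" and H: "adv_sol B g H"
    and h: "\<And>x. x \<in> Pow (A \<union> B) \<Longrightarrow> h x = F (f (x \<inter> A)) (g (x \<inter> B))"
  shows "adv_sol (A \<union> B) h (\<lambda>x y. if h x \<noteq> h y then comb A B G H x y else 0)"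
proof -
  have "bil (Pow (A \<union> B)) (\<lambda>x y. if differs i x y then if h x \<noteq> h y then comb A B G H x y else 0 else 0) a b
     \<le> ((\<Sum>x\<in>Pow (A \<union> B). (a x)\<^sup>2) + (\<Sum>x\<in>Pow (A \<union> B). (b x)\<^sup>2)) / 2"
    if i: "i \<in> A \<union> B" for i a b
  proof (cases "i \<in> A")
    case True
    show ?thesis
      by (rule comb_differs_bound[where F = F, OF fin disj G True]) (rule h)
  next
    case False
    then have "i \<in> B" using i by simp
    moreover have "h x = (\<lambda>u v. F v u) (g (x \<inter> B)) (f (x \<inter> A))" if "x \<in> Pow (B \<union> A)" for x
      using h that by (simp add: Un_commute)
    ultimately have "bil (Pow (B \<union> A)) (\<lambda>x y. if differs i x y then if h x \<noteq> h y then comb B A H G x y else 0 else 0) a b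
     \<le> ((\<Sum>x\<in>Pow (B \<union> A). (a x)\<^sup>2) + (\<Sum>x\<in>Pow (B \<union> A). (b x)\<^sup>2)) / 2"
      using fin disj H by (intro comb_differs_bound[where F = "\<lambda>u v. F v u"]) auto
    then show ?thesis
      unfolding Un_commute[of B A] comb_commute[of B A H G] .
  qed
  moreover have "comb A B G H x y = comb A B G H y x \<and> 0 \<le> comb A B G H x y" for x y
    using G H by (auto simp: comb_def tensorI_def adv_sol_def)
  ultimately show ?thesis
    unfolding adv_sol_def by (intro conjI ballI allI) simp_all
qed

section \<open>Dual solutions on a disjoint union\<close>

lemma dual_sol_pad:
  assumes "k \<le> k'" "dual_sol A f k u"
  shows "dual_sol A f k' (\<lambda>x i l. if l < k then u x i l else 0)"
    and "dual_cost A k' (\<lambda>x i l. if l < k then u x i l else 0) x = dual_cost A k u x"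
proof -
  have *: "(\<Sum>l<k'. if l < k then F l else 0) = (\<Sum>l<k. F l)" for F :: "nat \<Rightarrow> real"
  proof -
    have "(\<Sum>l<k'. if l < k then F l else 0) = (\<Sum>l\<in>{..<k'} \<inter> {..<k}. F l)"
      by (subst sum.inter_restrict) auto
    also have "{..<k'} \<inter> {..<k} = {..<k}" using assms(1) by auto
    finally show ?thesis .
  qed
  have mult: "(if l < k then u x i l else 0) * (if l < k then u y i l else 0)
      = (if l < k then u x i l * u y i l else 0)" for x y i l
    by simp
  show "dual_sol A f k' (\<lambda>x i l. if l < k then u x i l else 0)"
    using assms(2) unfolding dual_sol_def mult * .
  have sq: "(if l < k then u x i l else 0)\<^sup>2 = (if l < k then (u x i l)\<^sup>2 else 0)" for i l
    by simp
  show "dual_cost A k' (\<lambda>x i l. if l < k then u x i l else 0) x = dual_cost A k u x"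
    unfolding dual_cost_def sq * ..
qed

lemma has_dual_common_dim:
  assumes "has_dual A f a" "has_dual B g b"
  obtains k u v where "dual_sol A f k u" "\<And>x. x \<in> Pow A \<Longrightarrow> dual_cost A k u x \<le> a"
    "dual_sol B g k v" "\<And>x. x \<in> Pow B \<Longrightarrow> dual_cost B k v x \<le> b"
proof -
  obtain k1 u1 where 1: "dual_sol A f k1 u1" "\<forall>x\<in>Pow A. dual_cost A k1 u1 x \<le> a"
    using assms(1) unfolding has_dual_def by blast
  obtain k2 u2 where 2: "dual_sol B g k2 u2" "\<forall>x\<in>Pow B. dual_cost B k2 u2 x \<le> b"
    using assms(2) unfolding has_dual_def by blast
  show thesis
    by (rule that[of "max k1 k2" "\<lambda>x i l. if l < k1 then u1 x i l else 0" "\<lambda>x i l. if l < k2 then u2 x i l else 0"])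
       (use 1 2 dual_sol_pad[of k1 "max k1 k2"] dual_sol_pad[of k2 "max k1 k2"] in auto)
qed

lemma sum_Un_split:
  fixes F :: "nat \<Rightarrow> real"
  assumes "finite A" "finite B" "A \<inter> B = {}"
  shows "(\<Sum>i\<in>A \<union> B. if i \<in> A then F i else G i) = (\<Sum>i\<in>A. F i) + (\<Sum>i\<in>B. G i)"
proof -
  have "(\<Sum>i\<in>A \<union> B. if i \<in> A then F i else G i)
     = (\<Sum>i\<in>A. if i \<in> A then F i else G i) + (\<Sum>i\<in>B. if i \<in> A then F i else G i)"
    using assms by (rule sum.union_disjoint)
  also have "(\<Sum>i\<in>B. if i \<in> A then F i else G i) = (\<Sum>i\<in>B. G i)"
    using assms by (intro sum.cong) auto
  finally show ?thesis by simp
qed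

definition pairing :: "nat set \<Rightarrow> nat \<Rightarrow> (nat set \<Rightarrow> nat \<Rightarrow> nat \<Rightarrow> real) \<Rightarrow> nat set \<Rightarrow> nat set \<Rightarrow> real" where
  "pairing A k u x y = (\<Sum>i\<in>A. if differs i x y then \<Sum>l<k. u x i l * u y i l else 0)"

lemma dual_sol_pairing:
  "dual_sol A f k u \<longleftrightarrow> (\<forall>x\<in>Pow A. \<forall>y\<in>Pow A. f x \<noteq> f y \<longrightarrow> pairing A k u x y = 1)"
  by (simp add: dual_sol_def pairing_def)

lemma pairing_commute: "pairing A k u x y = pairing A k u y x"
  unfolding pairing_def by (intro sum.cong refl) (simp add: differs_commute[of _ x y] mult.commute)

lemma differs_Int: "i \<in> A \<Longrightarrow> differs i (x \<inter> A) (y \<inter> A) = differs i x y"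
  by (auto simp: differs_def)

text \<open>The scalars \<open>s\<close> and \<open>t\<close> may depend on the whole input; this
  lets conjunction weigh each part by the values of both subfunctions.\<close>

lemma pairing_split:
  assumes "finite A" "finite B" "A \<inter> B = {}"
  shows "pairing (A \<union> B) k (\<lambda>x i l. if i \<in> A then s x * u (x \<inter> A) i l else t x * v (x \<inter> B) i l) x y
    = s x * s y * pairing A k u (x \<inter> A) (y \<inter> A) + t x * t y * pairing B k v (x \<inter> B) (y \<inter> B)"
proof -
  have "pairing (A \<union> B) k (\<lambda>x i l. if i \<in> A then s x * u (x \<inter> A) i l else t x * v (x \<inter> B) i l) x y
    = (\<Sum>i\<in>A \<union> B. if i \<in> A then s x * s y * (if differs i x y then \<Sum>l<k. u (x \<inter> A) i l * u (y \<inter> A) i l else 0)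
         else t x * t y * (if differs i x y then \<Sum>l<k. v (x \<inter> B) i l * v (y \<inter> B) i l else 0))"
    unfolding pairing_def by (intro sum.cong refl) (simp add: sum_distrib_left mult_ac)
  also have "\<dots> = s x * s y * pairing A k u (x \<inter> A) (y \<inter> A) + t x * t y * pairing B k v (x \<inter> B) (y \<inter> B)"
    unfolding sum_Un_split[OF assms] pairing_def
    by (simp add: sum_distrib_left[symmetric] differs_Int cong: sum.cong)
  finally show ?thesis .
qed

lemma cost_split:
  assumes "finite A" "finite B" "A \<inter> B = {}"
  shows "dual_cost (A \<union> B) k (\<lambda>x i l. if i \<in> A then s x * u (x \<inter> A) i l else t x * v (x \<inter> B) i l) x
    = (s x)\<^sup>2 * dual_cost A k u (x \<inter> A) + (t x)\<^sup>2 * dual_cost B k v (x \<inter> B)"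
proof -
  have "dual_cost (A \<union> B) k (\<lambda>x i l. if i \<in> A then s x * u (x \<inter> A) i l else t x * v (x \<inter> B) i l) x
    = (\<Sum>i\<in>A \<union> B. if i \<in> A then (s x)\<^sup>2 * (\<Sum>l<k. (u (x \<inter> A) i l)\<^sup>2)
         else (t x)\<^sup>2 * (\<Sum>l<k. (v (x \<inter> B) i l)\<^sup>2))"
    unfolding dual_cost_def by (intro sum.cong refl) (simp add: sum_distrib_left power_mult_distrib)
  also have "\<dots> = (s x)\<^sup>2 * dual_cost A k u (x \<inter> A) + (t x)\<^sup>2 * dual_cost B k v (x \<inter> B)"
    unfolding sum_Un_split[OF assms] dual_cost_def by (simp add: sum_distrib_left[symmetric])
  finally show ?thesis .
qed

section \<open>Negation and additional variables\<close>

lemma has_dual_not: "has_dual A (\<lambda>x. \<not> f x) c \<longleftrightarrow> has_dual A f c"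
  by (simp add: has_dual_def dual_sol_def)

lemma has_primal_notI:
  assumes "has_primal A f c"
  shows "has_primal A (\<lambda>x. \<not> f x) c"
proof -
  obtain G p q where G: "adv_sol A f G"
     "\<forall>x\<in>Pow A. (f x \<longrightarrow> p x = 0) \<and> (\<not> f x \<longrightarrow> q x = 0)"
     "(\<Sum>x\<in>Pow A. (p x)\<^sup>2) = 1" "(\<Sum>x\<in>Pow A. (q x)\<^sup>2) = 1" "bil (Pow A) G p q = c"
    using assms unfolding has_primal_def by blast
  have "bil (Pow A) G q p = c"
    using G(5) bil_commute[of "Pow A" G q p] G(1) unfolding adv_sol_def by blast
  then show ?thesis
    using G unfolding has_primal_def
    by (intro exI[of _ G] exI[of _ q] exI[of _ p]) (auto simp: adv_sol_def)
qed

lemma opt_not: "opt A f \<Longrightarrow> opt A (\<lambda>x. \<not> f x)"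
  using has_dual_not[of A f] has_primal_notI[of A f] unfolding opt_def tight_def by blast

lemma has_dual_extend:
  assumes "finite A" "finite B" "A \<inter> B = {}" "has_dual A f c"
  shows "has_dual (A \<union> B) (\<lambda>x. f (x \<inter> A)) c"
proof -
  obtain k u where u: "dual_sol A f k u" "\<forall>x\<in>Pow A. dual_cost A k u x \<le> c"
    using assms(4) unfolding has_dual_def by blast
  define w where "w = (\<lambda>x i l. if i \<in> A then 1 * u (x \<inter> A) i l else 0 * u (x \<inter> B) i l)"
  have "dual_sol (A \<union> B) (\<lambda>x. f (x \<inter> A)) k w"
    using u(1) unfolding dual_sol_pairing w_def
      pairing_split[OF assms(1-3), where s = "\<lambda>_. 1" and t = "\<lambda>_. 0" and v = u] by simp
  moreover have "\<forall>x\<in>Pow (A \<union> B). dual_cost (A \<union> B) k w x \<le> c"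
    using u(2) unfolding w_def
      cost_split[OF assms(1-3), where s = "\<lambda>_. 1" and t = "\<lambda>_. 0" and v = u] by simp
  ultimately show ?thesis
    unfolding has_dual_def by blast
qed

lemma adv_sol_zero: "adv_sol A f (\<lambda>_ _. 0)"
  unfolding adv_sol_def bil_def by (simp add: sum_nonneg add_nonneg_nonneg)

text \<open>The deleted entries join inputs with equal h, and there either p or q vanishes.\<close>

lemma bil_mask:
  assumes "\<And>x. x \<in> S \<Longrightarrow> h x \<Longrightarrow> p x = 0" "\<And>x. x \<in> S \<Longrightarrow> \<not> h x \<Longrightarrow> q x = 0"
  shows "bil S (\<lambda>x y. if h x \<noteq> h y then G x y else 0) p q = bil S G p q"
proof (rule bil_cong)
  fix x y assume "x \<in> S" "y \<in> S"
  then show "p x * (if h x \<noteq> h y then G x y else 0) * q y = p x * G x y * q y"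
    using assms(1)[of x] assms(2)[of y] by (cases "h x"; cases "h y") simp_all
qed

text \<open>The mask makes the matrix admissible without changing its value at p and q, so for each
  connective only the unmasked \<open>comb\<close> has to be evaluated, where product vectors
  factor.\<close>

lemma has_primal_combI:
  assumes fin: "finite A" "finite B" and disj: "A \<inter> B = {}"
    and G: "adv_sol A f G" and H: "adv_sol B g H"
    and h: "\<And>x. x \<in> Pow (A \<union> B) \<Longrightarrow> h x = F (f (x \<inter> A)) (g (x \<inter> B))"
    and supp: "\<And>x. x \<in> Pow (A \<union> B) \<Longrightarrow> h x \<Longrightarrow> p x = 0" "\<And>x. x \<in> Pow (A \<union> B) \<Longrightarrow> \<not> h x \<Longrightarrow> q x = 0"
    and norm: "(\<Sum>x\<in>Pow (A \<union> B). (p x)\<^sup>2) = 1" "(\<Sum>x\<in>Pow (A \<union> B). (q x)\<^sup>2) = 1"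
    and val: "bil (Pow (A \<union> B)) (comb A B G H) p q = c"
  shows "has_primal (A \<union> B) h c"
proof -
  have "adv_sol (A \<union> B) h (\<lambda>x y. if h x \<noteq> h y then comb A B G H x y else 0)"
    by (rule adv_sol_comb[OF fin disj G H]) (rule h)
  moreover have "bil (Pow (A \<union> B)) (\<lambda>x y. if h x \<noteq> h y then comb A B G H x y else 0) p q = c"
    using val by (subst bil_mask) (use supp in auto)
  ultimately show ?thesis
    unfolding has_primal_def using supp norm by blast
qed

lemma has_primal_extend:
  assumes fin: "finite A" "finite B" and disj: "A \<inter> B = {}" and f: "has_primal A f c"
  shows "has_primal (A \<union> B) (\<lambda>x. f (x \<inter> A)) c"
proof -
  obtain G p q where G: "adv_sol A f G"
     "\<forall>x\<in>Pow A. (f x \<longrightarrow> p x = 0) \<and> (\<not> f x \<longrightarrow> q x = 0)"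
     "(\<Sum>x\<in>Pow A. (p x)\<^sup>2) = 1" "(\<Sum>x\<in>Pow A. (q x)\<^sup>2) = 1" "bil (Pow A) G p q = c"
    using f unfolding has_primal_def by blast
  \<comment> \<open>A point mass: the added variables are held at false, so only the block with
    empty \<open>B\<close>-part contributes.\<close>
  define e :: "nat set \<Rightarrow> real" where "e b = (if b = {} then 1 else 0)" for b
  have e: "(\<Sum>b\<in>Pow B. e b * e b) = 1" "(\<Sum>b\<in>Pow B. (e b)\<^sup>2) = 1"
    using fin by (simp_all add: e_def if_distrib[where f = "\<lambda>x. _ * x"] if_distrib[where f = "\<lambda>x. x\<^sup>2"] sum.delta cong: if_cong)
  show ?thesis
  proof (rule has_primal_combI[OF fin disj G(1) adv_sol_zero, where F = "\<lambda>u v. u"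
        and p = "\<lambda>x. p (x \<inter> A) * e (x \<inter> B)" and q = "\<lambda>x. q (x \<inter> A) * e (x \<inter> B)"])
    show "(\<Sum>x\<in>Pow (A \<union> B). (p (x \<inter> A) * e (x \<inter> B))\<^sup>2) = 1"
      unfolding power_mult_distrib
      by (subst sum_Pow_Un_prod[OF disj, where F = "\<lambda>a. (p a)\<^sup>2" and G = "\<lambda>b. (e b)\<^sup>2"]) (simp add: G e)
    show "(\<Sum>x\<in>Pow (A \<union> B). (q (x \<inter> A) * e (x \<inter> B))\<^sup>2) = 1"
      unfolding power_mult_distrib
      by (subst sum_Pow_Un_prod[OF disj, where F = "\<lambda>a. (q a)\<^sup>2" and G = "\<lambda>b. (e b)\<^sup>2"]) (simp add: G e)
    show "bil (Pow (A \<union> B)) (comb A B G (\<lambda>_ _. 0)) (\<lambda>x. p (x \<inter> A) * e (x \<inter> B)) (\<lambda>x. q (x \<inter> A) * e (x \<inter> B)) = c"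
      unfolding bil_comb_prod[OF fin disj] by (simp add: G e bil_def[of "Pow B"])
  qed (use G(2) in auto)
qed

lemma tight_extend:
  assumes "finite A" "finite B" "A \<inter> B = {}" "tight A f"
  shows "tight (A \<union> B) (\<lambda>x. f (x \<inter> A))"
  using assms(4) has_dual_extend[OF assms(1-3), of f] has_primal_extend[OF assms(1-3), of f]
  unfolding tight_def by blast

lemma has_dual_cong: "(\<And>x. x \<in> Pow A \<Longrightarrow> f x = g x) \<Longrightarrow> has_dual A f c = has_dual A g c"
  unfolding has_dual_def dual_sol_def by simp

lemma has_primal_cong: 
  assumes "\<And>x. x \<in> Pow A \<Longrightarrow> f x = g x" shows "has_primal A f c = has_primal A g c"
proof -
  have "adv_sol A f = adv_sol A g"
    unfolding adv_sol_def fun_eq_iff using assms by auto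
  then show ?thesis unfolding has_primal_def using assms by auto
qed

lemma opt_cong:
  assumes "\<And>x. x \<in> Pow A \<Longrightarrow> f x = g x" shows "opt A f = opt A g"
proof -
  have "has_dual A f = has_dual A g" "has_primal A f = has_primal A g"
    using has_dual_cong[of A f g] has_primal_cong[of A f g] assms by blast+
  moreover have "(\<forall>x\<in>Pow A. f x) = (\<forall>x\<in>Pow A. g x)" "(\<forall>x\<in>Pow A. \<not> f x) = (\<forall>x\<in>Pow A. \<not> g x)"
    using assms by blast+
  ultimately show ?thesis unfolding opt_def tight_def by simp
qed

lemma opt_const: "opt A (\<lambda>_. b)"
  by (cases b) (auto simp: opt_def)

lemma opt_extend:
  assumes "finite A" "finite B" "A \<inter> B = {}" "opt A f"
  shows "opt (A \<union> B) (\<lambda>x. f (x \<inter> A))"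
  using assms(4) tight_extend[OF assms(1-3), of f] unfolding opt_def by blast

section \<open>Conjunction\<close>

lemma has_dual_and:
  assumes fin: "finite A" "finite B" and disj: "A \<inter> B = {}"
    and ab: "a > 0" "b > 0" and f: "has_dual A f a" and g: "has_dual B g b"
  shows "has_dual (A \<union> B) (\<lambda>x. f (x \<inter> A) \<and> g (x \<inter> B)) (sqrt (a\<^sup>2 + b\<^sup>2))"
proof -
  obtain k u v where u: "dual_sol A f k u" "\<And>x. x \<in> Pow A \<Longrightarrow> dual_cost A k u x \<le> a"
    and v: "dual_sol B g k v" "\<And>x. x \<in> Pow B \<Longrightarrow> dual_cost B k v x \<le> b"
    using has_dual_common_dim[OF f g] by blast
  define C where "C = sqrt (a\<^sup>2 + b\<^sup>2)"
  have C: "C > 0" "C\<^sup>2 = a\<^sup>2 + b\<^sup>2"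
    using ab by (auto simp: C_def intro!: add_pos_pos)
  \<comment> \<open>A zero is certified by one false conjunct alone (the first if both are false), a
    one by both. The scalars of a zero and a one multiply to 1 on the part used by the zero. A zero
    then costs at most (C/a) a = C or (C/b) b = C and a one at most (a^2 + b^2)/C, which equals C
    exactly for C = sqrt (a^2 + b^2).\<close>
  define s where "s x = (if f (x \<inter> A) \<and> g (x \<inter> B) then sqrt (a / C) else if \<not> f (x \<inter> A) then sqrt (C / a) else 0)" for x
  define t where "t x = (if f (x \<inter> A) \<and> g (x \<inter> B) then sqrt (b / C) else if \<not> f (x \<inter> A) then 0 else sqrt (C / b))" for x
  define w where "w = (\<lambda>x i l. if i \<in> A then s x * u (x \<inter> A) i l else t x * v (x \<inter> B) i l)"
  have inv: "sqrt (a / C) * sqrt (C / a) = 1" "sqrt (b / C) * sqrt (C / b) = 1"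
    "sqrt (C / a) * sqrt (a / C) = 1" "sqrt (C / b) * sqrt (b / C) = 1"
    using ab C by (simp_all add: real_sqrt_mult[symmetric])
  have "pairing (A \<union> B) k w x y = 1"
    if "x \<in> Pow (A \<union> B)" "y \<in> Pow (A \<union> B)" "\<not> (f (x \<inter> A) \<and> g (x \<inter> B))" "f (y \<inter> A) \<and> g (y \<inter> B)" for x y
    unfolding w_def pairing_split[OF fin disj]
    using that u(1) v(1) inv unfolding dual_sol_pairing
    by (cases "f (x \<inter> A)") (auto simp: s_def t_def)
  then have "dual_sol (A \<union> B) (\<lambda>x. f (x \<inter> A) \<and> g (x \<inter> B)) k w"
    unfolding dual_sol_pairing using pairing_commute[of "A \<union> B" k w] by metis
  moreover have "dual_cost (A \<union> B) k w x \<le> C" if x: "x \<in> Pow (A \<union> B)" for x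
  proof -
    have ux: "dual_cost A k u (x \<inter> A) \<le> a" and vx: "dual_cost B k v (x \<inter> B) \<le> b"
      using u(2) v(2) by auto
    have "dual_cost (A \<union> B) k w x \<le> (s x)\<^sup>2 * a + (t x)\<^sup>2 * b"
      unfolding w_def cost_split[OF fin disj] by (intro add_mono mult_left_mono ux vx) auto
    also have "\<dots> \<le> C"
    proof (cases "f (x \<inter> A) \<and> g (x \<inter> B)")
      case True
      then have "(s x)\<^sup>2 * a + (t x)\<^sup>2 * b = (a\<^sup>2 + b\<^sup>2) / C"
        using ab C by (simp add: s_def t_def add_divide_distrib power2_eq_square)
      also have "\<dots> = C" using C(1) unfolding C(2)[symmetric] by (simp add: power2_eq_square)
      finally show ?thesis by simp
    next
      case False
      then show ?thesis using ab C by (auto simp: s_def t_def)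
    qed
    finally show ?thesis .
  qed
  ultimately show ?thesis unfolding has_dual_def C_def by blast
qed

lemma sum_Pow_Un_sq_prod:
  assumes "A \<inter> B = {}"
  shows "(\<Sum>x\<in>Pow (A \<union> B). (p (x \<inter> A) * q (x \<inter> B))\<^sup>2) = (\<Sum>a\<in>Pow A. (p a)\<^sup>2) * (\<Sum>b\<in>Pow B. (q b :: real)\<^sup>2)"
  unfolding power_mult_distrib
  by (rule sum_Pow_Un_prod[OF assms, where F = "\<lambda>a. (p a)\<^sup>2" and G = "\<lambda>b. (q b)\<^sup>2"])

lemma bil_same_side_zero:
  assumes "adv_sol A f G" "\<And>x y. x \<in> Pow A \<Longrightarrow> y \<in> Pow A \<Longrightarrow> p x \<noteq> 0 \<Longrightarrow> q y \<noteq> 0 \<Longrightarrow> f x = f y"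
  shows "bil (Pow A) G p q = 0"
proof -
  have "p x * G x y * q y = 0" if "x \<in> Pow A" "y \<in> Pow A" for x y
    using assms that unfolding adv_sol_def by (cases "p x = 0 \<or> q y = 0") auto
  then show ?thesis unfolding bil_def by (intro sum.neutral ballI)
qed

lemma has_primal_and:
  assumes fin: "finite A" "finite B" and disj: "A \<inter> B = {}"
    and ab: "a > 0" "b > 0" and f: "has_primal A f a" and g: "has_primal B g b"
  shows "has_primal (A \<union> B) (\<lambda>x. f (x \<inter> A) \<and> g (x \<inter> B)) (sqrt (a\<^sup>2 + b\<^sup>2))"
proof -
  obtain G p q where G: "adv_sol A f G"
     "\<And>x. x \<in> Pow A \<Longrightarrow> f x \<Longrightarrow> p x = 0" "\<And>x. x \<in> Pow A \<Longrightarrow> \<not> f x \<Longrightarrow> q x = 0"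
     "(\<Sum>x\<in>Pow A. (p x)\<^sup>2) = 1" "(\<Sum>x\<in>Pow A. (q x)\<^sup>2) = 1" "bil (Pow A) G p q = a"
    using f unfolding has_primal_def by blast
  obtain H r s where H: "adv_sol B g H"
     "\<And>x. x \<in> Pow B \<Longrightarrow> g x \<Longrightarrow> r x = 0" "\<And>x. x \<in> Pow B \<Longrightarrow> \<not> g x \<Longrightarrow> s x = 0"
     "(\<Sum>x\<in>Pow B. (r x)\<^sup>2) = 1" "(\<Sum>x\<in>Pow B. (s x)\<^sup>2) = 1" "bil (Pow B) H r s = b"
    using g unfolding has_primal_def by blast
  have "\<forall>x\<in>Pow A. p x * q x = 0" "\<forall>x\<in>Pow B. r x * s x = 0"
    using G(2,3) H(2,3) by (metis mult_eq_0_iff)+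
  note orth = this this[THEN sum.neutral]
  have "bil (Pow A) G q q = 0"
    by (rule bil_same_side_zero[OF G(1)]) (use G(3) in blast)
  moreover have "bil (Pow B) H s s = 0"
    by (rule bil_same_side_zero[OF H(1)]) (use H(3) in blast)
  ultimately have zero: "bil (Pow A) G q q = 0" "bil (Pow B) H s s = 0" by simp_all
  define C where "C = sqrt (a\<^sup>2 + b\<^sup>2)"
  have C: "C > 0" "C\<^sup>2 = a\<^sup>2 + b\<^sup>2"
    using ab by (auto simp: C_def intro!: add_pos_pos)
  have sq: "(\<Sum>x\<in>Pow A. q x * q x) = 1" "(\<Sum>x\<in>Pow B. s x * s x) = 1"
    using G(5) H(5) by (simp_all add: power2_eq_square)
  \<comment> \<open>Only zeros with exactly one false conjunct get weight. The two terms are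
    orthogonal, so the coefficients a/C and b/C give norm 1; their contributions a^2/C and b^2/C to
    the value add up to C.\<close>
  define P where "P = (\<lambda>x. a / C * (p (x \<inter> A) * s (x \<inter> B)) + b / C * (q (x \<inter> A) * r (x \<inter> B)))"
  have P2: "(P x)\<^sup>2 = (a / C)\<^sup>2 * (p (x \<inter> A) * s (x \<inter> B))\<^sup>2 + (b / C)\<^sup>2 * (q (x \<inter> A) * r (x \<inter> B))\<^sup>2" for x
  proof -
    have "p (x \<inter> A) * q (x \<inter> A) = 0" using orth(1) by blast
    then show ?thesis
      unfolding P_def by (auto simp: power2_eq_square)
  qed
  show ?thesis
    unfolding C_def[symmetric]
  proof (rule has_primal_combI[OF fin disj G(1) H(1), where F = "(\<and>)"
        and p = P and q = "\<lambda>x. q (x \<inter> A) * s (x \<inter> B)"])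
    show "(\<Sum>x\<in>Pow (A \<union> B). (P x)\<^sup>2) = 1"
      unfolding P2 sum.distrib sum_distrib_left[symmetric] sum_Pow_Un_sq_prod[OF disj]
      using C ab by (simp add: G(4-6) H(4-6) power_divide add_divide_distrib[symmetric])
    show "(\<Sum>x\<in>Pow (A \<union> B). (q (x \<inter> A) * s (x \<inter> B))\<^sup>2) = 1"
      unfolding sum_Pow_Un_sq_prod[OF disj] by (simp add: G(4-6) H(4-6))
    have "bil (Pow (A \<union> B)) (comb A B G H) P (\<lambda>x. q (x \<inter> A) * s (x \<inter> B)) = a / C * a + b / C * b"
      unfolding P_def bil_add_left bil_scale_left bil_comb_prod[OF fin disj]
      by (simp add: G(4-6) H(4-6) zero orth sq)
    also have "\<dots> = C\<^sup>2 / C" unfolding C(2) by (simp add: add_divide_distrib power2_eq_square)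
    also have "\<dots> = C" using C(1) by (simp add: power2_eq_square)
    finally show "bil (Pow (A \<union> B)) (comb A B G H) P (\<lambda>x. q (x \<inter> A) * s (x \<inter> B)) = C" .
    show "P x = 0" if "f (x \<inter> A) \<and> g (x \<inter> B)" for x
      using that by (simp add: P_def G(2) H(2))
    show "q (x \<inter> A) * s (x \<inter> B) = 0" if "\<not> (f (x \<inter> A) \<and> g (x \<inter> B))" for x
      using that G(3)[of "x \<inter> A"] H(3)[of "x \<inter> B"] by auto
  qed simp
qed

lemma opt_and:
  assumes fin: "finite A" "finite B" and disj: "A \<inter> B = {}" and f: "opt A f" and g: "opt B g"
  shows "opt (A \<union> B) (\<lambda>x. f (x \<inter> A) \<and> g (x \<inter> B))"
proof (cases "tight A f \<and> tight B g")
  case True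
  then obtain a b where "a > 0" "b > 0" "has_dual A f a" "has_primal A f a" "has_dual B g b" "has_primal B g b"
    unfolding tight_def by blast
  moreover from this have "sqrt (a\<^sup>2 + b\<^sup>2) > 0" by (auto intro!: add_pos_pos)
  ultimately show ?thesis
    unfolding opt_def tight_def using has_dual_and[OF fin disj] has_primal_and[OF fin disj] by blast
next
  case False
  then consider "\<forall>x\<in>Pow A. f x" | "\<forall>x\<in>Pow B. g x" | "\<forall>x\<in>Pow A. \<not> f x" | "\<forall>x\<in>Pow B. \<not> g x"
    using f g unfolding opt_def by blast
  then show ?thesis
  proof cases
    case 1
    have "opt (B \<union> A) (\<lambda>x. g (x \<inter> B))"
      using opt_extend[OF fin(2,1) _ g] disj by auto
    then show ?thesis
      using 1 by (subst opt_cong[where g = "\<lambda>x. g (x \<inter> B)"]) (auto simp: Un_commute)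
  next
    case 2
    then show ?thesis
      using opt_extend[OF fin disj f] by (subst opt_cong[where g = "\<lambda>x. f (x \<inter> A)"]) auto
  qed (auto simp: opt_def)
qed

section \<open>Parity and disjunction\<close>

lemma has_primalE:
  assumes "has_primal A f a"
  obtains G p q where "adv_sol A f G"
     "\<And>x. x \<in> Pow A \<Longrightarrow> f x \<Longrightarrow> p x = 0" "\<And>x. x \<in> Pow A \<Longrightarrow> \<not> f x \<Longrightarrow> q x = 0"
     "(\<Sum>x\<in>Pow A. (p x)\<^sup>2) = 1" "(\<Sum>x\<in>Pow A. (q x)\<^sup>2) = 1"
     "\<And>x. x \<in> Pow A \<Longrightarrow> p x * q x = 0"
     "(\<Sum>x\<in>Pow A. p x * p x) = 1" "(\<Sum>x\<in>Pow A. q x * q x) = 1"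
     "(\<Sum>x\<in>Pow A. p x * q x) = 0" "(\<Sum>x\<in>Pow A. q x * p x) = 0"
     "bil (Pow A) G p q = a" "bil (Pow A) G q p = a" "bil (Pow A) G p p = 0" "bil (Pow A) G q q = 0"
proof -
  obtain G p q where G: "adv_sol A f G"
     "\<And>x. x \<in> Pow A \<Longrightarrow> f x \<Longrightarrow> p x = 0" "\<And>x. x \<in> Pow A \<Longrightarrow> \<not> f x \<Longrightarrow> q x = 0"
     "(\<Sum>x\<in>Pow A. (p x)\<^sup>2) = 1" "(\<Sum>x\<in>Pow A. (q x)\<^sup>2) = 1" "bil (Pow A) G p q = a"
    using assms unfolding has_primal_def by blast
  have orth: "p x * q x = 0" if "x \<in> Pow A" for x
    using G(2,3) that by (metis mult_eq_0_iff)
  show thesis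
  proof (rule that[OF G(1-5) orth])
    show "(\<Sum>x\<in>Pow A. p x * p x) = 1" "(\<Sum>x\<in>Pow A. q x * q x) = 1"
      using G(4,5) by (simp_all add: power2_eq_square)
    show pq: "(\<Sum>x\<in>Pow A. p x * q x) = 0"
      by (rule sum.neutral) (use orth in blast)
    show "(\<Sum>x\<in>Pow A. q x * p x) = 0"
      using pq by (simp add: mult.commute)
    show "bil (Pow A) G q p = a"
      using G(6) bil_commute[of "Pow A" G q p] G(1) unfolding adv_sol_def by blast
    show "bil (Pow A) G p p = 0"
      by (rule bil_same_side_zero[OF G(1)]) (use G(2) in blast)
    show "bil (Pow A) G q q = 0"
      by (rule bil_same_side_zero[OF G(1)]) (use G(3) in blast)
  qed (use G in auto)
qed

text \<open>An index \<open>l < 2 * k\<close> encodes coordinate \<open>l div 2\<close> together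
  with the flag \<open>odd l\<close>, that is, a vector tensored with one of two orthogonal unit
  vectors.\<close>

lemma sum_flag:
  fixes F :: "nat \<Rightarrow> real"
  shows "(\<Sum>l<2 * k. if odd l = b then F (l div 2) else 0) = (\<Sum>l<k. F l)"
  by (induction k) (simp_all add: mult_Suc_right)

text \<open>
  Tagging the vectors of f by the value of g makes them orthogonal exactly when the g-values
  differ, so for h = f xor g only one of the two parts contributes to each pairing.
\<close>

lemma pairing_flag_split:
  assumes "finite A" "finite B" "A \<inter> B = {}"
  shows "pairing (A \<union> B) (2 * k) (\<lambda>x i l. if i \<in> A then (if odd l = g (x \<inter> B) then u (x \<inter> A) i (l div 2) else 0)
        else (if odd l = f (x \<inter> A) then v (x \<inter> B) i (l div 2) else 0)) x y
    = (if g (x \<inter> B) = g (y \<inter> B) then pairing A k u (x \<inter> A) (y \<inter> A) else 0) +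
      (if f (x \<inter> A) = f (y \<inter> A) then pairing B k v (x \<inter> B) (y \<inter> B) else 0)"
proof -
  have flags: "(\<Sum>l<2 * k. (if odd l = b then F (l div 2) else 0) * (if odd l = b' then F' (l div 2) else 0))
     = (if b = b' then \<Sum>l<k. F l * F' l else 0)" for b b' and F F' :: "nat \<Rightarrow> real"
  proof (cases "b = b'")
    case True
    have "(\<Sum>l<2 * k. (if odd l = b then F (l div 2) else 0) * (if odd l = b' then F' (l div 2) else 0))
       = (\<Sum>l<2 * k. if odd l = b then F (l div 2) * F' (l div 2) else 0)"
      using True by (intro sum.cong) auto
    also have "\<dots> = (\<Sum>l<k. F l * F' l)"
      by (rule sum_flag[where F = "\<lambda>l. F l * F' l"])
    finally show ?thesis using True by simp
  next
    case False
    then have "(\<Sum>l<2 * k. (if odd l = b then F (l div 2) else 0) * (if odd l = b' then F' (l div 2) else 0)) = 0"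
      by (intro sum.neutral) auto
    then show ?thesis using False by simp
  qed
  have "pairing (A \<union> B) (2 * k) (\<lambda>x i l. if i \<in> A then (if odd l = g (x \<inter> B) then u (x \<inter> A) i (l div 2) else 0)
        else (if odd l = f (x \<inter> A) then v (x \<inter> B) i (l div 2) else 0)) x y
    = (\<Sum>i\<in>A \<union> B. if i \<in> A then
         (if g (x \<inter> B) = g (y \<inter> B) then (if differs i x y then \<Sum>l<k. u (x \<inter> A) i l * u (y \<inter> A) i l else 0) else 0)
       else
         (if f (x \<inter> A) = f (y \<inter> A) then (if differs i x y then \<Sum>l<k. v (x \<inter> B) i l * v (y \<inter> B) i l else 0) else 0))"
    unfolding pairing_def
  proof (intro sum.cong refl, goal_cases)
    case (1 i)
    show ?case by (cases "i \<in> A"; simp only: if_True if_False flags) simp_all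
  qed
  also have "\<dots> = (if g (x \<inter> B) = g (y \<inter> B) then pairing A k u (x \<inter> A) (y \<inter> A) else 0) +
      (if f (x \<inter> A) = f (y \<inter> A) then pairing B k v (x \<inter> B) (y \<inter> B) else 0)"
    unfolding sum_Un_split[OF assms] pairing_def
    by (simp add: differs_Int cong: sum.cong)
  finally show ?thesis .
qed

lemma cost_flag_split:
  assumes "finite A" "finite B" "A \<inter> B = {}"
  shows "dual_cost (A \<union> B) (2 * k) (\<lambda>x i l. if i \<in> A then (if odd l = g (x \<inter> B) then u (x \<inter> A) i (l div 2) else 0)
        else (if odd l = f (x \<inter> A) then v (x \<inter> B) i (l div 2) else 0)) x
    = dual_cost A k u (x \<inter> A) + dual_cost B k v (x \<inter> B)"
proof -
  have flags: "(\<Sum>l<2 * k. (if odd l = b then F (l div 2) else 0)\<^sup>2) = (\<Sum>l<k. (F l)\<^sup>2)" for b and F :: "nat \<Rightarrow> real"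
  proof -
    have "(\<Sum>l<2 * k. (if odd l = b then F (l div 2) else 0)\<^sup>2) = (\<Sum>l<2 * k. if odd l = b then (F (l div 2))\<^sup>2 else 0)"
      by (intro sum.cong) auto
    also have "\<dots> = (\<Sum>l<k. (F l)\<^sup>2)"
      by (rule sum_flag[where F = "\<lambda>l. (F l)\<^sup>2"])
    finally show ?thesis .
  qed
  have "dual_cost (A \<union> B) (2 * k) (\<lambda>x i l. if i \<in> A then (if odd l = g (x \<inter> B) then u (x \<inter> A) i (l div 2) else 0)
        else (if odd l = f (x \<inter> A) then v (x \<inter> B) i (l div 2) else 0)) x
    = (\<Sum>i\<in>A \<union> B. if i \<in> A then (\<Sum>l<k. (u (x \<inter> A) i l)\<^sup>2) else (\<Sum>l<k. (v (x \<inter> B) i l)\<^sup>2))"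
    unfolding dual_cost_def by (intro sum.cong refl) (simp add: flags)
  then show ?thesis
    unfolding sum_Un_split[OF assms] dual_cost_def .
qed

lemma has_dual_xor:
  assumes fin: "finite A" "finite B" and disj: "A \<inter> B = {}" and f: "has_dual A f a" and g: "has_dual B g b"
  shows "has_dual (A \<union> B) (\<lambda>x. f (x \<inter> A) \<noteq> g (x \<inter> B)) (a + b)"
proof -
  obtain k u v where u: "dual_sol A f k u" "\<And>x. x \<in> Pow A \<Longrightarrow> dual_cost A k u x \<le> a"
    and v: "dual_sol B g k v" "\<And>x. x \<in> Pow B \<Longrightarrow> dual_cost B k v x \<le> b"
    using has_dual_common_dim[OF f g] by blast
  define w where "w = (\<lambda>x i l. if i \<in> A then (if odd l = g (x \<inter> B) then u (x \<inter> A) i (l div 2) else 0)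
        else (if odd l = f (x \<inter> A) then v (x \<inter> B) i (l div 2) else 0))"
  have "pairing (A \<union> B) (2 * k) w x y = 1" if ne: "(f (x \<inter> A) \<noteq> g (x \<inter> B)) \<noteq> (f (y \<inter> A) \<noteq> g (y \<inter> B))" for x y
  proof (cases "f (x \<inter> A) = f (y \<inter> A)")
    case True
    then have "g (x \<inter> B) \<noteq> g (y \<inter> B)" using ne by blast
    then show ?thesis
      using True v(1) unfolding w_def pairing_flag_split[OF fin disj] dual_sol_pairing by simp
  next
    case False
    then have "g (x \<inter> B) = g (y \<inter> B)" using ne by blast
    then show ?thesis
      using False u(1) unfolding w_def pairing_flag_split[OF fin disj] dual_sol_pairing by simp
  qed
  then have "dual_sol (A \<union> B) (\<lambda>x. f (x \<inter> A) \<noteq> g (x \<inter> B)) (2 * k) w"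
    unfolding dual_sol_pairing by blast
  moreover have "dual_cost (A \<union> B) (2 * k) w x \<le> a + b" for x
    unfolding w_def cost_flag_split[OF fin disj] by (intro add_mono u(2) v(2)) auto
  ultimately show ?thesis unfolding has_dual_def by blast
qed

lemma has_primal_xor:
  assumes fin: "finite A" "finite B" and disj: "A \<inter> B = {}"
    and f: "has_primal A f a" and g: "has_primal B g b"
  shows "has_primal (A \<union> B) (\<lambda>x. f (x \<inter> A) \<noteq> g (x \<inter> B)) (a + b)"
proof -
  obtain G p q where G: "adv_sol A f G"
     "\<And>x. x \<in> Pow A \<Longrightarrow> f x \<Longrightarrow> p x = 0" "\<And>x. x \<in> Pow A \<Longrightarrow> \<not> f x \<Longrightarrow> q x = 0"
     "(\<Sum>x\<in>Pow A. (p x)\<^sup>2) = 1" "(\<Sum>x\<in>Pow A. (q x)\<^sup>2) = 1"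
     "\<And>x. x \<in> Pow A \<Longrightarrow> p x * q x = 0"
     "(\<Sum>x\<in>Pow A. p x * p x) = 1" "(\<Sum>x\<in>Pow A. q x * q x) = 1"
     "(\<Sum>x\<in>Pow A. p x * q x) = 0" "(\<Sum>x\<in>Pow A. q x * p x) = 0"
     "bil (Pow A) G p q = a" "bil (Pow A) G q p = a" "bil (Pow A) G p p = 0" "bil (Pow A) G q q = 0"
    using has_primalE[OF f] by blast
  obtain H r s where H: "adv_sol B g H"
     "\<And>x. x \<in> Pow B \<Longrightarrow> g x \<Longrightarrow> r x = 0" "\<And>x. x \<in> Pow B \<Longrightarrow> \<not> g x \<Longrightarrow> s x = 0"
     "(\<Sum>x\<in>Pow B. (r x)\<^sup>2) = 1" "(\<Sum>x\<in>Pow B. (s x)\<^sup>2) = 1"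
     "\<And>x. x \<in> Pow B \<Longrightarrow> r x * s x = 0"
     "(\<Sum>x\<in>Pow B. r x * r x) = 1" "(\<Sum>x\<in>Pow B. s x * s x) = 1"
     "(\<Sum>x\<in>Pow B. r x * s x) = 0" "(\<Sum>x\<in>Pow B. s x * r x) = 0"
     "bil (Pow B) H r s = b" "bil (Pow B) H s r = b" "bil (Pow B) H r r = 0" "bil (Pow B) H s s = 0"
    using has_primalE[OF g] by blast
  define C where "C = 1 / sqrt (2 :: real)"
  have C: "C * C = 1 / 2" "C\<^sup>2 = 1 / 2"
    by (simp_all add: C_def power_divide)
  \<comment> \<open>\<open>P\<close> lives on inputs with equal values of f and g, \<open>Q\<close>
    on those with unequal values. Each summand of \<open>comb\<close> changes one factor and fixes
    the other, so it links each term of \<open>P\<close> to exactly one term of \<open>Q\<close>.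
    With the factor 1/2 from normalisation, the two links of \<open>G\<close> give a and those of
    \<open>H\<close> give b.\<close>
  define P where "P = (\<lambda>x. C * (p (x \<inter> A) * r (x \<inter> B)) + C * (q (x \<inter> A) * s (x \<inter> B)))"
  define Q where "Q = (\<lambda>x. C * (p (x \<inter> A) * s (x \<inter> B)) + C * (q (x \<inter> A) * r (x \<inter> B)))"
  have orth: "p (x \<inter> A) * q (x \<inter> A) = 0" for x
    using G(6) by blast
  have P2: "(P x)\<^sup>2 = C\<^sup>2 * (p (x \<inter> A) * r (x \<inter> B))\<^sup>2 + C\<^sup>2 * (q (x \<inter> A) * s (x \<inter> B))\<^sup>2"
   and Q2: "(Q x)\<^sup>2 = C\<^sup>2 * (p (x \<inter> A) * s (x \<inter> B))\<^sup>2 + C\<^sup>2 * (q (x \<inter> A) * r (x \<inter> B))\<^sup>2" for x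
    using orth[of x] unfolding P_def Q_def by (auto simp: power2_eq_square)
  show ?thesis
  proof (rule has_primal_combI[OF fin disj G(1) H(1), where F = "(\<noteq>)" and p = P and q = Q])
    show "(\<Sum>x\<in>Pow (A \<union> B). (P x)\<^sup>2) = 1"
      unfolding P2 sum.distrib sum_distrib_left[symmetric] sum_Pow_Un_sq_prod[OF disj]
      by (simp add: G(4-5) H(4-5) C)
    show "(\<Sum>x\<in>Pow (A \<union> B). (Q x)\<^sup>2) = 1"
      unfolding Q2 sum.distrib sum_distrib_left[symmetric] sum_Pow_Un_sq_prod[OF disj]
      by (simp add: G(4-5) H(4-5) C)
    show "bil (Pow (A \<union> B)) (comb A B G H) P Q = a + b"
      unfolding P_def Q_def bil_add_left bil_add_right bil_scale_left bil_scale_right bil_comb_prod[OF fin disj]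
      by (simp add: G(7-14) H(7-14) mult.assoc[symmetric] C)
    show "P x = 0" if "f (x \<inter> A) \<noteq> g (x \<inter> B)" for x
      using that by (cases "f (x \<inter> A)") (simp_all add: P_def G(2,3) H(2,3))
    show "Q x = 0" if "\<not> (f (x \<inter> A) \<noteq> g (x \<inter> B))" for x
      using that by (cases "f (x \<inter> A)") (simp_all add: Q_def G(2,3) H(2,3))
  qed simp
qed

lemma opt_xor:
  assumes fin: "finite A" "finite B" and disj: "A \<inter> B = {}" and f: "opt A f" and g: "opt B g"
  shows "opt (A \<union> B) (\<lambda>x. f (x \<inter> A) \<noteq> g (x \<inter> B))"
proof -
  have ext_f: "opt (A \<union> B) (\<lambda>x. f (x \<inter> A))"
    by (rule opt_extend[OF fin disj f])
  have "opt (B \<union> A) (\<lambda>x. g (x \<inter> B))"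
    using disj by (intro opt_extend[OF fin(2,1) _ g]) auto
  then have ext_g: "opt (A \<union> B) (\<lambda>x. g (x \<inter> B))"
    by (simp add: Un_commute)
  consider "tight A f" "tight B g" | c where "\<forall>x\<in>Pow A. f x = c" | c where "\<forall>x\<in>Pow B. g x = c"
  proof -
    have "tight A f \<or> (\<forall>x\<in>Pow A. f x = True) \<or> (\<forall>x\<in>Pow A. f x = False)"
      "tight B g \<or> (\<forall>x\<in>Pow B. g x = True) \<or> (\<forall>x\<in>Pow B. g x = False)"
      using f g unfolding opt_def by simp_all
    then show thesis using that by metis
  qed
  then show ?thesis
  proof cases
    case 1
    then obtain a b where "a > 0" "b > 0" "has_dual A f a" "has_primal A f a" "has_dual B g b" "has_primal B g b"
      unfolding tight_def by blast
    moreover from this have "a + b > 0" by simp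
    ultimately show ?thesis
      unfolding opt_def tight_def using has_dual_xor[OF fin disj] has_primal_xor[OF fin disj] by blast
  next
    case (2 c)
    have "opt (A \<union> B) (\<lambda>x. f (x \<inter> A) \<noteq> g (x \<inter> B)) = opt (A \<union> B) (\<lambda>x. c \<noteq> g (x \<inter> B))"
      using 2 by (intro opt_cong) blast
    then show ?thesis
      using ext_g opt_not[OF ext_g] by (cases c) simp_all
  next
    case (3 c)
    have "opt (A \<union> B) (\<lambda>x. f (x \<inter> A) \<noteq> g (x \<inter> B)) = opt (A \<union> B) (\<lambda>x. f (x \<inter> A) \<noteq> c)"
      using 3 by (intro opt_cong) blast
    then show ?thesis
      using ext_f opt_not[OF ext_f] by (cases c) simp_all
  qed
qed

lemma opt_or:
  assumes fin: "finite A" "finite B" and disj: "A \<inter> B = {}" and f: "opt A f" and g: "opt B g"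
  shows "opt (A \<union> B) (\<lambda>x. f (x \<inter> A) \<or> g (x \<inter> B))"
  using opt_not[OF opt_and[OF fin disj opt_not[OF f] opt_not[OF g]]] by simp

section \<open>Negation of variables\<close>

lemma bil_reindex:
  assumes "bij_betw T S' S"
  shows "bil S' (\<lambda>x y. G (T x) (T y)) (\<lambda>x. p (T x)) (\<lambda>x. q (T x)) = bil S G p q"
proof -
  have "bil S G p q = (\<Sum>x\<in>S'. \<Sum>y\<in>S. p (T x) * G (T x) y * q y)"
    unfolding bil_def by (rule sum.reindex_bij_betw[OF assms, symmetric])
  also have "\<dots> = bil S' (\<lambda>x y. G (T x) (T y)) (\<lambda>x. p (T x)) (\<lambda>x. q (T x))"
    unfolding bil_def by (intro sum.cong refl sum.reindex_bij_betw[OF assms, symmetric])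
  finally show ?thesis ..
qed

text \<open>Symmetric difference with \<open>S\<close> is an involution of the inputs that preserves
  in which variables two inputs differ, so both certificates can be transported along it.\<close>

lemma tight_flip:
  assumes S: "S \<subseteq> A" and f: "tight A f"
  shows "tight A (\<lambda>x. f (sym_diff x S))"
proof -
  let ?T = "\<lambda>x. sym_diff x S"
  have bij: "bij_betw ?T (Pow A) (Pow A)"
    by (rule bij_betw_byWitness[where f' = ?T]) (use S in auto)
  have T2: "?T (?T x) = x" for x
    by auto
  have mem: "?T x \<in> Pow A" if "x \<in> Pow A" for x
    using that S by auto
  have diff: "differs i (?T x) (?T y) = differs i x y" for i x y
    by (auto simp: differs_def)
  obtain c where c: "c > 0" "has_dual A f c" "has_primal A f c"
    using f unfolding tight_def by blast
  obtain k u where u: "dual_sol A f k u" "\<forall>x\<in>Pow A. dual_cost A k u x \<le> c"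
    using c(2) unfolding has_dual_def by blast
  have "dual_sol A (\<lambda>x. f (?T x)) k (\<lambda>x. u (?T x))"
    unfolding dual_sol_def
  proof (intro ballI impI)
    fix x y assume "x \<in> Pow A" "y \<in> Pow A" "f (?T x) \<noteq> f (?T y)"
    then show "(\<Sum>i\<in>A. if differs i x y then \<Sum>l<k. u (?T x) i l * u (?T y) i l else 0) = 1"
      using u(1)[unfolded dual_sol_def, rule_format, OF mem mem, of x y] unfolding diff by blast
  qed
  moreover have "\<forall>x\<in>Pow A. dual_cost A k (\<lambda>x. u (?T x)) x \<le> c"
    using u(2) mem unfolding dual_cost_def by blast
  ultimately have d: "has_dual A (\<lambda>x. f (?T x)) c"
    unfolding has_dual_def by blast
  obtain G p q where G: "adv_sol A f G"
     "\<forall>x\<in>Pow A. (f x \<longrightarrow> p x = 0) \<and> (\<not> f x \<longrightarrow> q x = 0)"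
     "(\<Sum>x\<in>Pow A. (p x)\<^sup>2) = 1" "(\<Sum>x\<in>Pow A. (q x)\<^sup>2) = 1" "bil (Pow A) G p q = c"
    using c(3) unfolding has_primal_def by blast
  have re: "(\<Sum>x\<in>Pow A. F (?T x)) = (\<Sum>x\<in>Pow A. F x)" for F :: "nat set \<Rightarrow> real"
    by (rule sum.reindex_bij_betw[OF bij])
  have "adv_sol A (\<lambda>x. f (?T x)) (\<lambda>x y. G (?T x) (?T y))"
    unfolding adv_sol_def
  proof (intro conjI ballI allI)
    fix x y assume "x \<in> Pow A" "y \<in> Pow A"
    then have xy: "?T x \<in> Pow A" "?T y \<in> Pow A" using mem by blast+
    show "G (?T x) (?T y) = G (?T y) (?T x)" "0 \<le> G (?T x) (?T y)"
      "f (?T x) = f (?T y) \<longrightarrow> G (?T x) (?T y) = 0"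
      using G(1) xy unfolding adv_sol_def by blast+
  next
    fix i a b assume i: "i \<in> A"
    have "bil (Pow A) (\<lambda>x y. if differs i x y then G (?T x) (?T y) else 0) a b =
       bil (Pow A) (\<lambda>x y. if differs i (?T x) (?T y) then G (?T x) (?T y) else 0) (\<lambda>x. a (?T (?T x))) (\<lambda>x. b (?T (?T x)))"
      by (simp only: diff T2)
    also have "\<dots> = bil (Pow A) (\<lambda>x y. if differs i x y then G x y else 0) (\<lambda>x. a (?T x)) (\<lambda>x. b (?T x))"
      by (rule bil_reindex[OF bij, where p = "\<lambda>x. a (?T x)" and q = "\<lambda>x. b (?T x)"])
    also have "\<dots> \<le> ((\<Sum>x\<in>Pow A. (a (?T x))\<^sup>2) + (\<Sum>x\<in>Pow A. (b (?T x))\<^sup>2)) / 2"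
      using G(1) i unfolding adv_sol_def by blast
    also have "\<dots> = ((\<Sum>x\<in>Pow A. (a x)\<^sup>2) + (\<Sum>x\<in>Pow A. (b x)\<^sup>2)) / 2"
      by (simp only: re[where F = "\<lambda>x. (a x)\<^sup>2"] re[where F = "\<lambda>x. (b x)\<^sup>2"])
    finally show "bil (Pow A) (\<lambda>x y. if differs i x y then G (?T x) (?T y) else 0) a b
      \<le> ((\<Sum>x\<in>Pow A. (a x)\<^sup>2) + (\<Sum>x\<in>Pow A. (b x)\<^sup>2)) / 2" .
  qed
  moreover have "\<forall>x\<in>Pow A. (f (?T x) \<longrightarrow> p (?T x) = 0) \<and> (\<not> f (?T x) \<longrightarrow> q (?T x) = 0)"
    using G(2) mem by blast
  moreover have "(\<Sum>x\<in>Pow A. (p (?T x))\<^sup>2) = 1" "(\<Sum>x\<in>Pow A. (q (?T x))\<^sup>2) = 1"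
    using G(3,4) by (simp_all only: re[where F = "\<lambda>x. (p x)\<^sup>2"] re[where F = "\<lambda>x. (q x)\<^sup>2"])
  moreover have "bil (Pow A) (\<lambda>x y. G (?T x) (?T y)) (\<lambda>x. p (?T x)) (\<lambda>x. q (?T x)) = c"
    using bil_reindex[OF bij] G(5) by simp
  ultimately have "has_primal A (\<lambda>x. f (?T x)) c"
    unfolding has_primal_def
    by (intro exI[of _ "\<lambda>x y. G (?T x) (?T y)"] exI[of _ "\<lambda>x. p (?T x)"] exI[of _ "\<lambda>x. q (?T x)"]) simp
  then show ?thesis
    using c(1) d unfolding tight_def by blast
qed

lemma opt_flip:
  assumes "S \<subseteq> A" and f: "opt A f"
  shows "opt A (\<lambda>x. f (sym_diff x S))"
proof -
  have "sym_diff x S \<in> Pow A" if "x \<in> Pow A" for x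
    using that assms(1) by auto
  then show ?thesis
    using f tight_flip[OF assms(1), of f] unfolding opt_def by blast
qed

section \<open>Tools for explicit certificates\<close>

text \<open>The Schur test: a positive vector \<open>d\<close> with M d at most d entrywise forces
  the norm of the nonnegative symmetric matrix M to be at most 1.\<close>

lemma bil_schur:
  assumes nonneg: "\<And>x y. x \<in> S \<Longrightarrow> y \<in> S \<Longrightarrow> 0 \<le> M x y"
    and sym: "\<And>x y. x \<in> S \<Longrightarrow> y \<in> S \<Longrightarrow> M x y = M y x"
    and pos: "\<And>x. x \<in> S \<Longrightarrow> 0 < d x"
    and row: "\<And>x. x \<in> S \<Longrightarrow> (\<Sum>y\<in>S. M x y * d y) \<le> d x"
  shows "bil S M a b \<le> ((\<Sum>x\<in>S. (a x)\<^sup>2) + (\<Sum>x\<in>S. (b x)\<^sup>2)) / 2"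
proof -
  have weighted: "(\<Sum>x\<in>S. \<Sum>y\<in>S. M x y * (e x)\<^sup>2 * (d y / d x)) \<le> (\<Sum>x\<in>S. (e x)\<^sup>2)" for e
  proof (rule sum_mono)
    fix x assume x: "x \<in> S"
    have "(\<Sum>y\<in>S. M x y * (e x)\<^sup>2 * (d y / d x)) = (e x)\<^sup>2 / d x * (\<Sum>y\<in>S. M x y * d y)"
      by (simp add: sum_distrib_left sum_divide_distrib mult_ac)
    also have "\<dots> \<le> (e x)\<^sup>2 / d x * d x"
      using row[OF x] pos[OF x] by (intro mult_left_mono) auto
    finally show "(\<Sum>y\<in>S. M x y * (e x)\<^sup>2 * (d y / d x)) \<le> (e x)\<^sup>2"
      using pos[OF x] by simp
  qed
  have "bil S M a b \<le> (\<Sum>x\<in>S. \<Sum>y\<in>S. (M x y * (a x)\<^sup>2 * (d y / d x) + M x y * (b y)\<^sup>2 * (d x / d y)) / 2)"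
    unfolding bil_def
  proof (intro sum_mono)
    fix x y assume xy: "x \<in> S" "y \<in> S"
    \<comment> \<open>The factor \<open>s\<close> balances the inequality of the two means so that
      each half, summed over the other index, is bounded by a row condition.\<close>
    define s where "s = sqrt (d y / d x)"
    have s: "s > 0" "s\<^sup>2 = d y / d x" "(1 / s)\<^sup>2 = d x / d y"
      using pos[OF xy(1)] pos[OF xy(2)] by (simp_all add: s_def power_divide)
    have "2 * (a x * s) * (b y * (1 / s)) \<le> (a x * s)\<^sup>2 + (b y * (1 / s))\<^sup>2"
      by (rule sum_squares_bound)
    then have "a x * b y \<le> ((a x)\<^sup>2 * (d y / d x) + (b y)\<^sup>2 * (d x / d y)) / 2"
      using s(1) unfolding power_mult_distrib s(2,3) by simp
    then have "M x y * (a x * b y) \<le> M x y * (((a x)\<^sup>2 * (d y / d x) + (b y)\<^sup>2 * (d x / d y)) / 2)"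
      by (rule mult_left_mono) (rule nonneg[OF xy])
    then show "a x * M x y * b y \<le> (M x y * (a x)\<^sup>2 * (d y / d x) + M x y * (b y)\<^sup>2 * (d x / d y)) / 2"
      by (simp add: algebra_simps)
  qed
  also have "\<dots> = ((\<Sum>x\<in>S. \<Sum>y\<in>S. M x y * (a x)\<^sup>2 * (d y / d x)) + (\<Sum>x\<in>S. \<Sum>y\<in>S. M x y * (b y)\<^sup>2 * (d x / d y))) / 2"
    by (simp add: sum_divide_distrib[symmetric] sum.distrib)
  also have "(\<Sum>x\<in>S. \<Sum>y\<in>S. M x y * (b y)\<^sup>2 * (d x / d y)) = (\<Sum>y\<in>S. \<Sum>x\<in>S. M y x * (b y)\<^sup>2 * (d x / d y))"
    by (subst sum.swap) (intro sum.cong refl, simp add: sym)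
  also have "((\<Sum>x\<in>S. \<Sum>y\<in>S. M x y * (a x)\<^sup>2 * (d y / d x)) + (\<Sum>y\<in>S. \<Sum>x\<in>S. M y x * (b y)\<^sup>2 * (d x / d y))) / 2
     \<le> ((\<Sum>x\<in>S. (a x)\<^sup>2) + (\<Sum>x\<in>S. (b x)\<^sup>2)) / 2"
    by (intro divide_right_mono add_mono weighted) simp
  finally show ?thesis .
qed

lemma adv_sol_schurI:
  assumes "\<And>x y. x \<in> Pow A \<Longrightarrow> y \<in> Pow A \<Longrightarrow> G x y = G y x \<and> 0 \<le> G x y \<and> (f x = f y \<longrightarrow> G x y = 0)"
    and "\<And>i x. i \<in> A \<Longrightarrow> x \<in> Pow A \<Longrightarrow> 0 < d i x"
    and "\<And>i x. i \<in> A \<Longrightarrow> x \<in> Pow A \<Longrightarrow> (\<Sum>y\<in>Pow A. (if differs i x y then G x y else 0) * d i y) \<le> d i x"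
  shows "adv_sol A f G"
  unfolding adv_sol_def
proof (intro conjI ballI allI)
  fix i a b assume i: "i \<in> A"
  show "bil (Pow A) (\<lambda>x y. if differs i x y then G x y else 0) a b
     \<le> ((\<Sum>x\<in>Pow A. (a x)\<^sup>2) + (\<Sum>x\<in>Pow A. (b x)\<^sup>2)) / 2"
  proof (rule bil_schur[where d = "d i"])
    fix x y assume "x \<in> Pow A" "y \<in> Pow A"
    then show "(if differs i x y then G x y else 0) = (if differs i y x then G y x else 0)"
      "0 \<le> (if differs i x y then G x y else 0)"
      using assms(1)[of x y] differs_commute[of i x y] by auto
  qed (use assms(2,3) i in auto)
qed (use assms(1) in blast)+

text \<open>Multiplying the vectors of ones by the fourth root of c0/c1 and those of zeros by its
  inverse keeps all constrained pairings and turns both cost bounds into the geometric mean.\<close>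

lemma has_dual_asymI:
  assumes u: "dual_sol A f k u" and c: "c0 > 0" "c1 > 0"
    and cost: "\<And>x. x \<in> Pow A \<Longrightarrow> dual_cost A k u x \<le> (if f x then c1 else c0)"
  shows "has_dual A f (sqrt (c0 * c1))"
proof -
  define s where "s x = (if f x then sqrt (sqrt (c0 / c1)) else sqrt (sqrt (c1 / c0)))" for x
  have "s x * s y = 1" if "f x \<noteq> f y" for x y
    using that c by (auto simp: s_def real_sqrt_mult[symmetric])
  then have "(\<Sum>l<k. (s x * u x i l) * (s y * u y i l)) = (\<Sum>l<k. u x i l * u y i l)" if "f x \<noteq> f y" for x y i
    using that by (intro sum.cong refl) (metis (no_types, lifting) mult.assoc mult.commute mult_1)
  note scale = this
  have "dual_sol A f k (\<lambda>x i l. s x * u x i l)"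
    unfolding dual_sol_def
  proof (intro ballI impI)
    fix x y assume "x \<in> Pow A" "y \<in> Pow A" "f x \<noteq> f y"
    then show "(\<Sum>i\<in>A. if differs i x y then \<Sum>l<k. (s x * u x i l) * (s y * u y i l) else 0) = 1"
      using u unfolding dual_sol_def scale[OF \<open>f x \<noteq> f y\<close>] by blast
  qed
  moreover have "dual_cost A k (\<lambda>x i l. s x * u x i l) x \<le> sqrt (c0 * c1)" if x: "x \<in> Pow A" for x
  proof -
    have "dual_cost A k (\<lambda>x i l. s x * u x i l) x = (s x)\<^sup>2 * dual_cost A k u x"
      by (simp add: dual_cost_def power_mult_distrib sum_distrib_left)
    also have "\<dots> \<le> (s x)\<^sup>2 * (if f x then c1 else c0)"
      by (intro mult_left_mono cost x) simp
    also have "\<dots> = sqrt (c0 * c1)"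
    proof -
      have "sqrt (c0 / c1) * c1 = sqrt (c0 * c1)" "sqrt (c1 / c0) * c0 = sqrt (c0 * c1)"
        using c by (simp_all add: real_sqrt_divide real_sqrt_mult field_simps)
      then show ?thesis using c by (simp add: s_def)
    qed
    finally show ?thesis .
  qed
  ultimately show ?thesis unfolding has_dual_def by blast
qed

section \<open>The EQUAL function\<close>

text \<open>The matrix for EQUAL joins the two constant inputs only to inputs of weight 1 and n - 1.
  Three variables are what keeps these two families disjoint: on two variables a singleton is also a
  cosingleton.\<close>

lemma sum_Pow_singletons_cosingletons:
  fixes F :: "'a set \<Rightarrow> real"
  assumes A: "finite A" "card A \<ge> 3"
    and zero: "\<And>x. x \<in> Pow A \<Longrightarrow> x \<notin> (\<lambda>j. {j}) ` A \<Longrightarrow> x \<notin> (\<lambda>j. A - {j}) ` A \<Longrightarrow> F x = 0"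
  shows "(\<Sum>x\<in>Pow A. F x) = (\<Sum>j\<in>A. F {j}) + (\<Sum>j\<in>A. F (A - {j}))"
proof -
  have disj: "(\<lambda>j. {j}) ` A \<inter> (\<lambda>j. A - {j}) ` A = {}"
  proof -
    have "{j} \<noteq> A - {k}" if "j \<in> A" "k \<in> A" for j k
    proof
      assume "{j} = A - {k}"
      then have "card (A - {k}) = 1" by (metis is_singletonI is_singleton_altdef)
      then show False using A that by simp
    qed
    then show ?thesis by blast
  qed
  have "(\<Sum>x\<in>Pow A. F x) = (\<Sum>x\<in>(\<lambda>j. {j}) ` A \<union> (\<lambda>j. A - {j}) ` A. F x)"
    using A(1) zero by (intro sum.mono_neutral_right) auto
  also have "\<dots> = (\<Sum>x\<in>(\<lambda>j. {j}) ` A. F x) + (\<Sum>x\<in>(\<lambda>j. A - {j}) ` A. F x)"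
    using A(1) disj by (intro sum.union_disjoint) auto
  also have "(\<Sum>x\<in>(\<lambda>j. {j}) ` A. F x) = (\<Sum>j\<in>A. F {j})"
    by (subst sum.reindex) (auto simp: inj_on_def)
  also have "(\<Sum>x\<in>(\<lambda>j. A - {j}) ` A. F x) = (\<Sum>j\<in>A. F (A - {j}))"
    by (subst sum.reindex) (auto simp: inj_on_def)
  finally show ?thesis .
qed

lemma has_dual_EQUAL:
  assumes A: "finite A" "card A = n" "n \<ge> 3"
  shows "has_dual A (\<lambda>x. x = {} \<or> x = A) (real n / sqrt (real n - 1))"
proof -
  \<comment> \<open>The inputs \<open>{}\<close> and \<open>A\<close> use the orthogonal unit
    vectors 0 and 1 at every variable. Any other \<open>x\<close> differs from \<open>{}\<close>
    exactly on \<open>x\<close> and from \<open>A\<close> exactly on \<open>A - x\<close>, so it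
    spreads total weight 1 evenly over each of these two sets, using the matching unit
    vector.\<close>
  define u :: "nat set \<Rightarrow> nat \<Rightarrow> nat \<Rightarrow> real" where
    "u x i l = (if x = {} then (if l = 0 then 1 else 0) else if x = A then (if l = 1 then 1 else 0)
       else if i \<in> x then (if l = 0 then 1 / card x else 0) else (if l = 1 then 1 / card (A - x) else 0))" for x i l
  have ne: "A \<noteq> {}" using A by auto
  have two: "(\<Sum>l<2. F l) = F 0 + F (1 :: nat)" for F :: "nat \<Rightarrow> real"
    by (simp add: numeral_2_eq_2)
  have cards: "card x > 0" "card (A - x) > 0" "card x + card (A - x) = n" if "x \<in> Pow A" "x \<noteq> {}" "x \<noteq> A" for x
  proof -
    have "finite x" using that A finite_subset by auto
    then show "card x > 0" using that by (simp add: card_gt_0_iff)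
    show "card (A - x) > 0" using that A by (auto simp: card_gt_0_iff)
    show "card x + card (A - x) = n"
      using that A \<open>finite x\<close> card_mono[of A x] by (simp add: card_Diff_subset)
  qed
  have p0: "pairing A 2 u x {} = 1" if x: "x \<in> Pow A" "x \<noteq> {}" "x \<noteq> A" for x
  proof -
    have "pairing A 2 u x {} = (\<Sum>i\<in>A. if i \<in> x then 1 / card x else 0)"
      unfolding pairing_def using x by (intro sum.cong refl) (auto simp: two differs_def u_def)
    also have "\<dots> = (\<Sum>i\<in>A \<inter> x. 1 / card x)"
      using A by (subst sum.inter_restrict) auto
    also have "A \<inter> x = x" using x by auto
    finally show ?thesis using cards[OF x] by simp
  qed
  have p1: "pairing A 2 u x A = 1" if x: "x \<in> Pow A" "x \<noteq> {}" "x \<noteq> A" for x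
  proof -
    have "pairing A 2 u x A = (\<Sum>i\<in>A. if i \<in> A - x then 1 / card (A - x) else 0)"
      unfolding pairing_def using x ne by (intro sum.cong refl) (auto simp: two differs_def u_def)
    also have "\<dots> = (\<Sum>i\<in>A \<inter> (A - x). 1 / card (A - x))"
      using A by (subst sum.inter_restrict) auto
    also have "A \<inter> (A - x) = A - x" by auto
    finally show ?thesis using cards[OF x] by simp
  qed
  have "dual_sol A (\<lambda>x. x = {} \<or> x = A) 2 u"
    unfolding dual_sol_pairing
  proof (intro ballI impI)
    fix x y assume "x \<in> Pow A" "y \<in> Pow A" "(x = {} \<or> x = A) \<noteq> (y = {} \<or> y = A)"
    then show "pairing A 2 u x y = 1"
      using p0 p1 pairing_commute[of A 2 u] by metis
  qed
  moreover have "dual_cost A 2 u x \<le> (if x = {} \<or> x = A then real n else real n / (real n - 1))" if x: "x \<in> Pow A" for x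
  proof (cases "x = {} \<or> x = A")
    case True
    have "dual_cost A 2 u x = (\<Sum>i\<in>A. 1)"
      unfolding dual_cost_def using True by (intro sum.cong refl) (auto simp: two u_def)
    then show ?thesis using True A by simp
  next
    case False
    then have x': "x \<noteq> {}" "x \<noteq> A" by auto
    note c = cards[OF x x']
    define s t where "s = real (card x)" and "t = real (card (A - x))"
    have st: "s \<ge> 1" "t \<ge> 1" "real n = s + t"
      using c by (simp_all add: s_def t_def)
    have "dual_cost A 2 u x = (\<Sum>i\<in>A. if i \<in> x then (1 / s)\<^sup>2 else (1 / t)\<^sup>2)"
      unfolding dual_cost_def using x' by (intro sum.cong refl) (auto simp: two u_def s_def t_def)
    also have "\<dots> = (\<Sum>i\<in>x \<union> (A - x). if i \<in> x then (1 / s)\<^sup>2 else (1 / t)\<^sup>2)"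
      using x by (intro sum.cong) auto
    also have "\<dots> = (\<Sum>i\<in>x. (1 / s)\<^sup>2) + (\<Sum>i\<in>A - x. (1 / t)\<^sup>2)"
    proof -
      have "finite x" "finite (A - x)" using x A finite_subset by auto
      then show ?thesis
        by (subst sum.union_disjoint) (auto intro!: arg_cong2[where f = "(+)"] sum.cong)
    qed
    also have "\<dots> = 1 / s + 1 / t"
      using st by (simp add: s_def[symmetric] t_def[symmetric] power2_eq_square)
    also have "\<dots> = (s + t) / (s * t)"
      using st by (simp add: field_simps)
    \<comment> \<open>With s + t fixed, the product s t is smallest when one of them is 1:
      unbalanced inputs are the expensive ones.\<close>
    also have "\<dots> \<le> (s + t) / (s + t - 1)"
    proof (intro divide_left_mono)
      have "(s - 1) * (t - 1) \<ge> 0" using st by simp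
      then show "s + t - 1 \<le> s * t" by (simp add: algebra_simps)
    qed (use st in auto)
    finally show ?thesis using False st by simp
  qed
  ultimately have "has_dual A (\<lambda>x. x = {} \<or> x = A) (sqrt (real n / (real n - 1) * real n))"
    using A by (intro has_dual_asymI[where u = u and k = 2]) auto
  moreover have "sqrt (real n / (real n - 1) * real n) = real n / sqrt (real n - 1)"
    using A by (simp add: real_sqrt_divide)
  ultimately show ?thesis by simp
qed

lemma has_primal_EQUAL:
  assumes A: "finite A" "card A = n" "n \<ge> 3"
  shows "has_primal A (\<lambda>x. x = {} \<or> x = A) (real n / sqrt (real n - 1))"
proof -
  define S1 S2 where "S1 = (\<lambda>j. {j}) ` A" and "S2 = (\<lambda>j. A - {j}) ` A"
  \<comment> \<open>Among weights with \<alpha>^2 + (n-1) \<beta>^2 = 1, which is the norm condition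
    for each variable, the value sqrt n (\<alpha> + \<beta>) is largest at \<alpha> = (n-1) \<beta>;
    this gives n \<beta>^2 (n-1) = 1.\<close>
  define \<beta> where "\<beta> = 1 / sqrt (real n * (real n - 1))"
  define \<alpha> where "\<alpha> = (real n - 1) * \<beta>"
  have \<beta>: "\<beta> > 0" "\<alpha> > 0" using A by (auto simp: \<beta>_def \<alpha>_def)
  have \<beta>2: "\<beta>\<^sup>2 = 1 / (real n * (real n - 1))"
    using A by (simp add: \<beta>_def power_divide)
  have "\<alpha>\<^sup>2 + (real n - 1) * \<beta>\<^sup>2 = \<beta>\<^sup>2 * (real n * (real n - 1))"
    by (simp add: \<alpha>_def power2_eq_square algebra_simps)
  also have "\<dots> = 1"
    unfolding \<beta>2 using A by simp
  finally have star: "\<alpha>\<^sup>2 + (real n - 1) * \<beta>\<^sup>2 = 1" .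
  have ne: "A \<noteq> {}" using A by auto
  have c1: "card x = 1" if "x \<in> S1" for x
    using that by (auto simp: S1_def)
  have c2: "card x = n - 1" if "x \<in> S2" for x
    using that A by (auto simp: S2_def)
  have card1: "x \<noteq> {}" "x \<noteq> A" "x \<notin> S2" if "x \<in> S1" for x
    using c1[OF that] c2[of x] A by auto
  have card2: "x \<noteq> {}" "x \<noteq> A" "x \<notin> S1" if "x \<in> S2" for x
    using c2[OF that] c1[of x] A by auto
  have nin: "{} \<notin> S1" "{} \<notin> S2" "A \<notin> S1" "A \<notin> S2"
    using card1 card2 by blast+
  have inS: "{j} \<in> S1" "{j} \<notin> S2" "A - {j} \<in> S2" "A - {j} \<notin> S1" if "j \<in> A" for j
    using that card1(3)[of "{j}"] card2(3)[of "A - {j}"] by (auto simp: S1_def S2_def)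
  \<comment> \<open>\<open>w\<close> holds the edge weights at \<open>{}\<close> and
    \<open>w'\<close> those at \<open>A\<close>: \<alpha> to an input one bit away, \<beta> to an
    input n - 1 bits away.\<close>
  define w where "w x = (if x \<in> S1 then \<alpha> else if x \<in> S2 then \<beta> else 0)" for x
  define w' where "w' x = (if x \<in> S2 then \<alpha> else if x \<in> S1 then \<beta> else 0)" for x
  define G where "G x y = (if y = {} then w x else 0) + (if y = A then w' x else 0)
      + (if x = {} then w y else 0) + (if x = A then w' y else 0)" for x y :: "nat set"
  have w0: "w {} = 0" "w A = 0" "w' {} = 0" "w' A = 0"
    using nin by (auto simp: w_def w'_def)
  have wpos: "w x \<ge> 0" "w' x \<ge> 0" for x
    using \<beta> by (auto simp: w_def w'_def)
  have w1: "w {j} = \<alpha>" "w' {j} = \<beta>" "w (A - {j}) = \<beta>" "w' (A - {j}) = \<alpha>" if "j \<in> A" for j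
    using inS[OF that] by (simp_all add: w_def w'_def)
  \<comment> \<open>A nonconstant input differs in variable i from exactly one of \<open>{}\<close>
    and \<open>A\<close>, so the restricted matrix consists of two stars. At inputs of weight 1 or n
    - 1 the Schur weight is the weight of that single edge, and the row of each centre is then
    \<alpha>^2 + (n-1) \<beta>^2.\<close>
  define d where "d i x = (if x = {} \<or> x = A then 1 else if x = {i} \<or> x = A - {i} then \<alpha>
      else if x \<in> S1 \<union> S2 then \<beta> else 1)" for i :: nat and x
  have d1: "d i {j} = (if i = j then \<alpha> else \<beta>)" "d i (A - {j}) = (if i = j then \<alpha> else \<beta>)"
    if "i \<in> A" "j \<in> A" for i j
  proof -
    note inS[OF that(1)] inS[OF that(2)]
    moreover from this have "{j} \<noteq> A - {i}" "A - {j} \<noteq> {i}" "{j} \<noteq> {}" "{j} \<noteq> A" "A - {j} \<noteq> {}" "A - {j} \<noteq> A"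
      using nin by metis+
    moreover have "A - {j} = A - {i} \<longleftrightarrow> i = j" using that by auto
    ultimately show "d i {j} = (if i = j then \<alpha> else \<beta>)" "d i (A - {j}) = (if i = j then \<alpha> else \<beta>)"
      unfolding d_def by simp_all
  qed
  have row: "(\<Sum>y\<in>Pow A. (if differs i x y then G x y else 0) * d i y) \<le> d i x" if i: "i \<in> A" and x: "x \<in> Pow A" for i x
  proof -
    have star_sum: "(\<Sum>j\<in>A. if i = j then \<alpha>\<^sup>2 else 0) + (\<Sum>j\<in>A. if i = j then 0 else \<beta>\<^sup>2) = 1"
    proof -
      have "(\<Sum>j\<in>A. if i = j then 0 else \<beta>\<^sup>2) = (\<Sum>j\<in>A - {i}. \<beta>\<^sup>2)"
        using A i by (intro sum.mono_neutral_cong_right) auto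
      also have "\<dots> = (real n - 1) * \<beta>\<^sup>2"
        using A i by (simp add: of_nat_diff)
      finally show ?thesis using star A i by simp
    qed
    consider "x = {}" | "x = A" | "x \<noteq> {}" "x \<noteq> A" by blast
    then show ?thesis
    proof cases
      case 1
      have "(\<Sum>y\<in>Pow A. (if differs i x y then G x y else 0) * d i y) = (\<Sum>y\<in>Pow A. (if i \<in> y then w y else 0) * d i y)"
        using 1 ne w0 by (intro sum.cong refl) (auto simp: G_def differs_def)
      also have "\<dots> = (\<Sum>j\<in>A. (if i \<in> {j} then w {j} else 0) * d i {j}) + (\<Sum>j\<in>A. (if i \<in> A - {j} then w (A - {j}) else 0) * d i (A - {j}))"
        using A by (intro sum_Pow_singletons_cosingletons) (auto simp: w_def S1_def S2_def)
      also have "\<dots> = (\<Sum>j\<in>A. if i = j then \<alpha>\<^sup>2 else 0) + (\<Sum>j\<in>A. if i = j then 0 else \<beta>\<^sup>2)"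
        using i by (intro arg_cong2[where f = "(+)"] sum.cong refl) (auto simp: w1 d1 power2_eq_square)
      finally show ?thesis using 1 star_sum by (simp add: d_def)
    next
      case 2
      have "(\<Sum>y\<in>Pow A. (if differs i x y then G x y else 0) * d i y) = (\<Sum>y\<in>Pow A. (if i \<notin> y then w' y else 0) * d i y)"
        using 2 ne w0 i by (intro sum.cong refl) (auto simp: G_def differs_def)
      also have "\<dots> = (\<Sum>j\<in>A. (if i \<notin> {j} then w' {j} else 0) * d i {j}) + (\<Sum>j\<in>A. (if i \<notin> A - {j} then w' (A - {j}) else 0) * d i (A - {j}))"
        using A by (intro sum_Pow_singletons_cosingletons) (auto simp: w'_def S1_def S2_def)
      also have "\<dots> = (\<Sum>j\<in>A. if i = j then 0 else \<beta>\<^sup>2) + (\<Sum>j\<in>A. if i = j then \<alpha>\<^sup>2 else 0)"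
        using i by (intro arg_cong2[where f = "(+)"] sum.cong refl) (auto simp: w1 d1 power2_eq_square)
      finally show ?thesis using 2 star_sum by (simp add: d_def)
    next
      case 3
      have "(\<Sum>y\<in>Pow A. (if differs i x y then G x y else 0) * d i y) = (\<Sum>y\<in>{{}, A}. (if differs i x y then G x y else 0) * d i y)"
        using A 3 by (intro sum.mono_neutral_right) (auto simp: G_def)
      also have "\<dots> = (if i \<in> x then w x else w' x)"
        using 3 ne i by (auto simp: G_def differs_def d_def)
      also have "\<dots> \<le> d i x"
      proof (cases "x \<in> S1 \<union> S2")
        case True
        then obtain j where "j \<in> A" "x = {j} \<or> x = A - {j}" by (auto simp: S1_def S2_def)
        then show ?thesis using i by (auto simp: w1 d1)
      next
        case False
        then show ?thesis using 3 \<beta> by (auto simp: w_def w'_def d_def)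
      qed
      finally show ?thesis .
    qed
  qed
  have adv: "adv_sol A (\<lambda>x. x = {} \<or> x = A) G"
  proof (rule adv_sol_schurI[where d = d])
    fix x y assume "x \<in> Pow A" "y \<in> Pow A"
    show "G x y = G y x \<and> 0 \<le> G x y \<and> ((x = {} \<or> x = A) = (y = {} \<or> y = A) \<longrightarrow> G x y = 0)"
      using w0 wpos by (auto simp: G_def)
  next
    fix i x show "0 < d i x" using \<beta> by (simp add: d_def)
  qed (rule row)
  define p where "p x = (if x \<in> S1 \<union> S2 then 1 / sqrt (2 * real n) else 0)" for x
  define q where "q x = (if x = {} \<or> x = A then 1 / sqrt 2 else 0)" for x
  have p1: "p {j} = 1 / sqrt (2 * real n)" "p (A - {j}) = 1 / sqrt (2 * real n)" if "j \<in> A" for j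
    using that by (auto simp: p_def S1_def S2_def)
  have "(\<Sum>x\<in>Pow A. (p x)\<^sup>2) = (\<Sum>j\<in>A. (p {j})\<^sup>2) + (\<Sum>j\<in>A. (p (A - {j}))\<^sup>2)"
    using A by (intro sum_Pow_singletons_cosingletons) (auto simp: p_def S1_def S2_def)
  also have "\<dots> = 1"
    using A by (simp add: p1 power_divide)
  finally have pn: "(\<Sum>x\<in>Pow A. (p x)\<^sup>2) = 1" .
  have "(\<Sum>x\<in>Pow A. (q x)\<^sup>2) = (\<Sum>x\<in>{{}, A}. (q x)\<^sup>2)"
    using A by (intro sum.mono_neutral_right) (auto simp: q_def)
  also have "\<dots> = 1" using ne by (simp add: q_def power_divide)
  finally have qn: "(\<Sum>x\<in>Pow A. (q x)\<^sup>2) = 1" .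
  have inner: "(\<Sum>y\<in>Pow A. p x * G x y * q y) = p x * (w x + w' x) / sqrt 2" if "x \<in> Pow A" for x
  proof -
    have "(\<Sum>y\<in>Pow A. p x * G x y * q y) = (\<Sum>y\<in>{{}, A}. p x * G x y * q y)"
      using A by (intro sum.mono_neutral_right) (auto simp: q_def)
    also have "\<dots> = p x * (w x + w' x) / sqrt 2"
      using ne nin by (cases "x = {} \<or> x = A") (auto simp: q_def p_def G_def field_simps)
    finally show ?thesis .
  qed
  have "bil (Pow A) G p q = (\<Sum>x\<in>Pow A. p x * (w x + w' x) / sqrt 2)"
    unfolding bil_def by (intro sum.cong refl inner)
  also have "\<dots> = (\<Sum>j\<in>A. p {j} * (w {j} + w' {j}) / sqrt 2) + (\<Sum>j\<in>A. p (A - {j}) * (w (A - {j}) + w' (A - {j})) / sqrt 2)"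
    using A by (intro sum_Pow_singletons_cosingletons) (auto simp: p_def S1_def S2_def)
  also have "\<dots> = (\<Sum>j\<in>A. (\<alpha> + \<beta>) / (2 * sqrt (real n))) + (\<Sum>j\<in>A. (\<alpha> + \<beta>) / (2 * sqrt (real n)))"
    by (intro arg_cong2[where f = "(+)"] sum.cong refl) (simp_all add: p1 w1 real_sqrt_mult add.commute)
  also have "\<dots> = real n * (\<alpha> + \<beta>) / sqrt (real n)"
    using A by simp
  also have "\<dots> = sqrt (real n) * (\<alpha> + \<beta>)"
    using real_div_sqrt[of "real n"] by (metis of_nat_0_le_iff times_divide_eq_left)
  also have "\<dots> = real n / sqrt (real n - 1)"
  proof -
    have "\<alpha> + \<beta> = real n * \<beta>" by (simp add: \<alpha>_def algebra_simps)
    then show ?thesis using A by (simp add: \<beta>_def real_sqrt_mult)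
  qed
  finally have "bil (Pow A) G p q = real n / sqrt (real n - 1)" .
  moreover have "\<forall>x\<in>Pow A. (x = {} \<or> x = A \<longrightarrow> p x = 0) \<and> (\<not> (x = {} \<or> x = A) \<longrightarrow> q x = 0)"
    using nin by (auto simp: p_def q_def)
  ultimately show ?thesis
    unfolding has_primal_def using adv pn qn by blast
qed

lemma opt_EQUAL:
  assumes "finite A" "card A \<ge> 3"
  shows "opt A (\<lambda>x. x = {} \<or> x = A)"
  using has_dual_EQUAL[OF assms(1) refl assms(2)] has_primal_EQUAL[OF assms(1) refl assms(2)] assms(2)
  unfolding opt_def tight_def by (intro disjI1 exI[of _ "real (card A) / sqrt (real (card A) - 1)"]) auto

section \<open>Functions of three bits\<close>

lemma sum_Pow_3:
  assumes "distinct [a, b, c]"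
  shows "(\<Sum>x\<in>Pow {a, b, c}. F (a \<in> x) (b \<in> x) (c \<in> x)) = (\<Sum>p\<in>UNIV. \<Sum>q\<in>UNIV. \<Sum>r\<in>UNIV. F p q r)"
proof -
  have "(\<Sum>x\<in>Pow {a, b, c}. F (a \<in> x) (b \<in> x) (c \<in> x)) = (\<Sum>(p, q, r)\<in>UNIV \<times> UNIV \<times> UNIV. F p q r)"
    using assms
    by (intro sum.reindex_bij_witness[where j = "\<lambda>x. (a \<in> x, b \<in> x, c \<in> x)"
          and i = "\<lambda>(p, q, r). {z. z = a \<and> p \<or> z = b \<and> q \<or> z = c \<and> r}"]) auto
  then show ?thesis
    by (simp only: sum.cartesian_product)
qed

text \<open>Quantifying over all placements of the three variables makes permuting the arguments a
  mere renaming.\<close>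

definition opt3 :: "(bool \<Rightarrow> bool \<Rightarrow> bool \<Rightarrow> bool) \<Rightarrow> bool" where
  "opt3 F \<longleftrightarrow> (\<forall>a b c. distinct [a, b, c] \<longrightarrow> opt {a, b, c} (\<lambda>x. F (a \<in> x) (b \<in> x) (c \<in> x)))"

text \<open>All conditions are tables over bits, so a concrete certificate is checked by expanding
  the quantifiers and sums over \<open>bool\<close>. \<open>c0\<close> and \<open>c1\<close> bound
  the costs at zeros and at ones; dimension 3 is enough for all certificates below.\<close>

lemma opt3I:
  fixes F :: "bool \<Rightarrow> bool \<Rightarrow> bool \<Rightarrow> bool"
    and U :: "bool \<Rightarrow> bool \<Rightarrow> bool \<Rightarrow> nat \<Rightarrow> nat \<Rightarrow> real"
    and W :: "bool \<Rightarrow> bool \<Rightarrow> bool \<Rightarrow> bool \<Rightarrow> bool \<Rightarrow> bool \<Rightarrow> real"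
    and d :: "nat \<Rightarrow> bool \<Rightarrow> bool \<Rightarrow> bool \<Rightarrow> real"
  assumes c01: "c0 > 0" "c1 > 0"
    and dual: "\<forall>p q r p' q' r'. \<not> F p q r \<longrightarrow> F p' q' r' \<longrightarrow>
      (if p = p' then 0 else \<Sum>l<3. U p q r 0 l * U p' q' r' 0 l) +
      (if q = q' then 0 else \<Sum>l<3. U p q r 1 l * U p' q' r' 1 l) +
      (if r = r' then 0 else \<Sum>l<3. U p q r 2 l * U p' q' r' 2 l) = 1"
    and cost: "\<forall>p q r. (\<Sum>l<3. (U p q r 0 l)\<^sup>2) + (\<Sum>l<3. (U p q r 1 l)\<^sup>2) + (\<Sum>l<3. (U p q r 2 l)\<^sup>2)
      \<le> (if F p q r then c1 else c0)"
    and W: "\<forall>p q r p' q' r'. 0 \<le> W p q r p' q' r' \<and> W p q r p' q' r' = W p' q' r' p q r \<and>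
       (F p q r = F p' q' r' \<longrightarrow> W p q r p' q' r' = 0)"
    and d: "\<forall>i p q r. 0 < d i p q r"
    and row: "\<forall>p q r. (\<Sum>p'\<in>UNIV. \<Sum>q'\<in>UNIV. \<Sum>r'\<in>UNIV. (if p = p' then 0 else W p q r p' q' r') * d 0 p' q' r') \<le> d 0 p q r"
      "\<forall>p q r. (\<Sum>p'\<in>UNIV. \<Sum>q'\<in>UNIV. \<Sum>r'\<in>UNIV. (if q = q' then 0 else W p q r p' q' r') * d 1 p' q' r') \<le> d 1 p q r"
      "\<forall>p q r. (\<Sum>p'\<in>UNIV. \<Sum>q'\<in>UNIV. \<Sum>r'\<in>UNIV. (if r = r' then 0 else W p q r p' q' r') * d 2 p' q' r') \<le> d 2 p q r"
    and supp: "\<forall>p q r. (F p q r \<longrightarrow> P p q r = 0) \<and> (\<not> F p q r \<longrightarrow> Q p q r = 0)"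
    and norm: "(\<Sum>p\<in>UNIV. \<Sum>q\<in>UNIV. \<Sum>r\<in>UNIV. (P p q r)\<^sup>2) = 1"
      "(\<Sum>p\<in>UNIV. \<Sum>q\<in>UNIV. \<Sum>r\<in>UNIV. (Q p q r)\<^sup>2) = 1"
    and val: "(\<Sum>p\<in>UNIV. \<Sum>q\<in>UNIV. \<Sum>r\<in>UNIV. \<Sum>p'\<in>UNIV. \<Sum>q'\<in>UNIV. \<Sum>r'\<in>UNIV.
        P p q r * W p q r p' q' r' * Q p' q' r') = sqrt (c0 * c1)"
  shows "opt3 F"
  unfolding opt3_def
proof (intro allI impI)
  fix a b c :: nat assume abc: "distinct [a, b, c]"
  define A where "A = {a, b, c}"
  let ?f = "\<lambda>x. F (a \<in> x) (b \<in> x) (c \<in> x)"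
  define ix where "ix i = (if i = a then 0 else if i = b then 1 else 2 :: nat)" for i
  have ix: "ix a = 0" "ix b = 1" "ix c = 2" using abc by (auto simp: ix_def)
  have sumA: "(\<Sum>i\<in>A. H i) = H a + H b + H c" for H :: "nat \<Rightarrow> real"
    using abc by (simp add: A_def)
  have sw: "(if differs i x y then S else 0) = (if (i \<in> x) = (i \<in> y) then 0 else S)" for i x y and S :: real
    by (simp add: differs_def)
  define u where "u x i l = U (a \<in> x) (b \<in> x) (c \<in> x) (ix i) l" for x i l
  have pair: "pairing A 3 u x y = 1" if "\<not> ?f x" "?f y" for x y
    using dual[rule_format, OF that] unfolding pairing_def sw sumA u_def ix .
  have "dual_sol A ?f 3 u"
    unfolding dual_sol_pairing using pair pairing_commute[of A 3 u] by metis
  moreover have "dual_cost A 3 u x \<le> (if ?f x then c1 else c0)" for x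
    using cost unfolding dual_cost_def sumA u_def ix by simp
  ultimately have hd: "has_dual A ?f (sqrt (c0 * c1))"
    using c01 by (intro has_dual_asymI[where u = u and k = 3]) auto
  define G where "G x y = W (a \<in> x) (b \<in> x) (c \<in> x) (a \<in> y) (b \<in> y) (c \<in> y)" for x y
  have "adv_sol A ?f G"
  proof (rule adv_sol_schurI[where d = "\<lambda>i x. d (ix i) (a \<in> x) (b \<in> x) (c \<in> x)"])
    fix x y
    show "G x y = G y x \<and> 0 \<le> G x y \<and> (?f x = ?f y \<longrightarrow> G x y = 0)"
      using W unfolding G_def by blast
  next
    fix i x assume "i \<in> A" "x \<in> Pow A"
    show "(\<Sum>y\<in>Pow A. (if differs i x y then G x y else 0) * d (ix i) (a \<in> y) (b \<in> y) (c \<in> y))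
      \<le> d (ix i) (a \<in> x) (b \<in> x) (c \<in> x)"
    proof -
      have "(\<Sum>y\<in>Pow A. (if (a \<in> x) = (a \<in> y) then 0 else G x y) * d (ix a) (a \<in> y) (b \<in> y) (c \<in> y)) \<le> d (ix a) (a \<in> x) (b \<in> x) (c \<in> x)"
        unfolding G_def A_def ix sum_Pow_3[OF abc, where F = "\<lambda>p q r. (if (a \<in> x) = p then 0 else W (a \<in> x) (b \<in> x) (c \<in> x) p q r) * d 0 p q r"]
        using row(1) by blast
      moreover have "(\<Sum>y\<in>Pow A. (if (b \<in> x) = (b \<in> y) then 0 else G x y) * d (ix b) (a \<in> y) (b \<in> y) (c \<in> y)) \<le> d (ix b) (a \<in> x) (b \<in> x) (c \<in> x)"
        unfolding G_def A_def ix sum_Pow_3[OF abc, where F = "\<lambda>p q r. (if (b \<in> x) = q then 0 else W (a \<in> x) (b \<in> x) (c \<in> x) p q r) * d 1 p q r"]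
        using row(2) by blast
      moreover have "(\<Sum>y\<in>Pow A. (if (c \<in> x) = (c \<in> y) then 0 else G x y) * d (ix c) (a \<in> y) (b \<in> y) (c \<in> y)) \<le> d (ix c) (a \<in> x) (b \<in> x) (c \<in> x)"
        unfolding G_def A_def ix sum_Pow_3[OF abc, where F = "\<lambda>p q r. (if (c \<in> x) = r then 0 else W (a \<in> x) (b \<in> x) (c \<in> x) p q r) * d 2 p q r"]
        using row(3) by blast
      moreover have "i = a \<or> i = b \<or> i = c"
        using \<open>i \<in> A\<close> unfolding A_def by blast
      ultimately show ?thesis
        unfolding sw by (elim disjE) (simp_all only:)
    qed
  qed (use d in blast)
  moreover have "(\<Sum>x\<in>Pow A. (P (a \<in> x) (b \<in> x) (c \<in> x))\<^sup>2) = 1" "(\<Sum>x\<in>Pow A. (Q (a \<in> x) (b \<in> x) (c \<in> x))\<^sup>2) = 1"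
    unfolding A_def sum_Pow_3[OF abc, where F = "\<lambda>p q r. (P p q r)\<^sup>2"] sum_Pow_3[OF abc, where F = "\<lambda>p q r. (Q p q r)\<^sup>2"]
    by (fact norm)+
  moreover have "bil (Pow A) G (\<lambda>x. P (a \<in> x) (b \<in> x) (c \<in> x)) (\<lambda>x. Q (a \<in> x) (b \<in> x) (c \<in> x)) = sqrt (c0 * c1)"
    unfolding bil_def G_def A_def
      sum_Pow_3[OF abc, where F = "\<lambda>p' q' r'. P _ _ _ * W _ _ _ p' q' r' * Q p' q' r'"]
      sum_Pow_3[OF abc, where F = "\<lambda>p q r. \<Sum>p'\<in>UNIV. \<Sum>q'\<in>UNIV. \<Sum>r'\<in>UNIV. P p q r * W p q r p' q' r' * Q p' q' r'"]
    by (fact val)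
  ultimately have "has_primal A ?f (sqrt (c0 * c1))"
    unfolding has_primal_def using supp
    by (intro exI[of _ G] exI[of _ "\<lambda>x. P (a \<in> x) (b \<in> x) (c \<in> x)"] exI[of _ "\<lambda>x. Q (a \<in> x) (b \<in> x) (c \<in> x)"]) blast
  moreover have "sqrt (c0 * c1) > 0" using c01 by simp
  ultimately show "opt {a, b, c} ?f"
    using hd unfolding opt_def tight_def A_def by blast
qed

text \<open>The position of an input in the truth table; the certificates below name inputs by this
  number.\<close>

definition bits :: "bool \<Rightarrow> bool \<Rightarrow> bool \<Rightarrow> nat" where
  "bits p q r = (if p then 4 else 0) + (if q then 2 else 0) + (if r then 1 else 0)"

definition bit3 :: "bool \<Rightarrow> bool \<Rightarrow> bool \<Rightarrow> nat \<Rightarrow> bool" where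
  "bit3 p q r l = (if l = 0 then p else if l = 1 then q else r)"

text \<open>The certificates list each edge once, from a zero to a one; adding the transpose yields
  a symmetric matrix.\<close>

definition sym_edge :: "(nat \<times> nat \<Rightarrow> real) \<Rightarrow> bool \<Rightarrow> bool \<Rightarrow> bool \<Rightarrow> bool \<Rightarrow> bool \<Rightarrow> bool \<Rightarrow> real" where
  "sym_edge w p q r p' q' r' = w (bits p q r, bits p' q' r') + w (bits p' q' r', bits p q r)"

lemma sum_lessThan_3: "(\<Sum>l<3. F l) = F 0 + F 1 + (F (2::nat) :: real)"
  by (simp add: eval_nat_numeral)

lemma bits_simps [simp]:
  "bits False False False = 0" "bits False False True = 1" "bits False True False = 2" "bits False True True = 3"
  "bits True False False = 4" "bits True False True = 5" "bits True True False = 6" "bits True True True = 7"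
  by (simp_all add: bits_def)

lemma bit3_simps [simp]: "bit3 p q r 0 = p" "bit3 p q r (Suc 0) = q" "bit3 p q r 2 = r"
  by (simp_all add: bit3_def)

lemma sum_UNIV_bool: "(\<Sum>p\<in>UNIV. F p) = F False + (F True :: real)"
  by (simp add: UNIV_bool)

text \<open>Value 2. The vectors mark the variables that a decision tree reads: p and then the
  selected one. If p differs, the second variables read are different, so only p contributes. The
  matrix is the complete bipartite graph on 2 + 2 inputs; for each variable its edges form a perfect
  matching.\<close>

lemma opt3_ITE: "opt3 (\<lambda>p q r. if p then q else r)"
  by (rule opt3I[where ?c0.0 = 2 and ?c1.0 = 2
      and U = "\<lambda>p q r i l. if l = 0 then if i = 0 then 1 else if i = 1 then of_bool p else of_bool (\<not> p) else 0"
      and W = "sym_edge (\<lambda>e. of_bool (e \<in> {2, 5} \<times> {1, 6}))" and d = "\<lambda>_ _ _ _. 1"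
      and P = "\<lambda>p q r. if bits p q r \<in> {2, 5} then 1 / sqrt 2 else 0"
      and Q = "\<lambda>p q r. if bits p q r \<in> {1, 6} then 1 / sqrt 2 else 0"])
    (simp_all only: all_bool_eq sum_UNIV_bool sum_lessThan_3 sym_edge_def,
     simp_all add: power_divide power_mult_distrib)

text \<open>Value 2. The matrix is the hexagon of inputs of weight 1 and 2 that are one bit apart:
  degree 2 gives norm 2, and the edges of one variable form a matching. An input of weight 2 carries
  half the indicator of its true bits at each true variable; an input of weight 1 with true bit k
  carries e_i + e_k at each false variable i. Their product is 1 at the single differing variable,
  or 1/2 at two of three. Symmetric combinations of the all-ones vector and e_i fit the inputs of
  weight 0 and 3.\<close>

lemma opt3_MAJ: "opt3 (\<lambda>p q r. (p \<and> q) \<or> (q \<and> r) \<or> (p \<and> r))"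
  by (rule opt3I[where ?c0.0 = 4 and ?c1.0 = 1
      and U = "\<lambda>p q r i l. if bits p q r = 0 then (1 + of_bool (l = i)) / 3
         else if bits p q r = 7 then (1 + of_bool (l = i)) / 6
         else if (p \<and> q) \<or> (q \<and> r) \<or> (p \<and> r) then of_bool (bit3 p q r i \<and> bit3 p q r l) / 2
         else of_bool (\<not> bit3 p q r i) * (of_bool (l = i) + of_bool (bit3 p q r l))"
      and W = "sym_edge (\<lambda>e. of_bool (e \<in> {(1, 3), (1, 5), (2, 3), (2, 6), (4, 5), (4, 6)}))" and d = "\<lambda>_ _ _ _. 1"
      and P = "\<lambda>p q r. if bits p q r \<in> {1, 2, 4} then 1 / sqrt 3 else 0"
      and Q = "\<lambda>p q r. if bits p q r \<in> {3, 5, 6} then 1 / sqrt 3 else 0"])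
    (simp_all only: all_bool_eq sum_UNIV_bool sum_lessThan_3 sym_edge_def,
     simp_all add: power_divide power_mult_distrib)

text \<open>Value sqrt 7. All cube edges from weight 1 to weights 0 and 2 have weight 1, again a
  matching for each variable. They send the uniform vector \<open>Q\<close> to sqrt 3 at weight 0
  and 2 / sqrt 3 at weight 2, of squared norm 3 + 4; \<open>P\<close> is the normalised image. The
  vectors of majority are reused at weights 2 and 3 and at the false variables of weight 1. The
  all-ones vector at the true variable of weight 1 adds 3 to the cost 4 and contributes only to the
  pairing with weight 0.\<close>

lemma opt3_EXACT1: "opt3 (\<lambda>p q r. (p \<noteq> q \<and> \<not> r) \<or> (\<not> p \<and> \<not> q \<and> r))"
  by (rule opt3I[where ?c0.0 = 1 and ?c1.0 = 7
      and U = "\<lambda>p q r i l. if bits p q r = 0 then 1 / 3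
         else if bits p q r = 7 then (1 + of_bool (l = i)) / 6
         else if (p \<and> q) \<or> (q \<and> r) \<or> (p \<and> r) then of_bool (bit3 p q r i \<and> bit3 p q r l) / 2
         else if bit3 p q r i then 1 else of_bool (l = i) + of_bool (bit3 p q r l)"
      and W = "sym_edge (\<lambda>e. of_bool (e \<in> {(0, 1), (0, 2), (0, 4), (3, 1), (3, 2), (5, 1), (5, 4), (6, 2), (6, 4)}))" and d = "\<lambda>_ _ _ _. 1"
      and P = "\<lambda>p q r. if bits p q r = 0 then sqrt 3 / sqrt 7 else if bits p q r \<in> {3, 5, 6} then 2 / (sqrt 3 * sqrt 7) else 0"
      and Q = "\<lambda>p q r. if bits p q r \<in> {1, 2, 4} then 1 / sqrt 3 else 0"])
    (simp_all only: all_bool_eq sum_UNIV_bool sum_lessThan_3 sym_edge_def,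
     simp_all add: power_divide power_mult_distrib, simp add: mult.assoc[symmetric], simp add: field_simps)

text \<open>
  The value is sqrt(3 + sqrt 3) = 2 S e. The weights in d are the Perron vectors of the matrices
  restricted to the pairs that differ in one variable.
\<close>

lemma opt3_and3_or_nor2: "opt3 (\<lambda>p q r. (p \<and> q \<and> r) \<or> (\<not> p \<and> \<not> q))"
proof -
  define S where "S = sqrt (3 :: real)"
  \<comment> \<open>\<open>e\<close> and \<open>h\<close> serve both as entries of the vector on the
    zeros, where 2 e^2 + h^2 = 1, and as edge weights at the input 000.\<close>
  define e where "e = sqrt ((3 + S) / 12)"
  define h where "h = (S - 1) * e"
  define t where "t = sqrt (1 / 2 :: real)"
  \<comment> \<open>This \<open>v\<close> makes the input 111 cost 2 v^2 + (S-1)^2 = 2, like the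
    other ones, and makes every zero with p or q false cost 1 + 1/v^2 = (3+S)/2, like 110.\<close>
  define v where "v = sqrt (S - 1)"
  have S: "S * S = 3" "S > 1" "S \<le> 2"
    by (auto simp: S_def real_le_lsqrt)
  have e: "e * e = (3 + S) / 12" "e > 0"
    using S by (auto simp: e_def)
  have "h * h = (S * S - 2 * S + 1) * (e * e)"
    by (simp add: h_def algebra_simps)
  also have "\<dots> = (4 - 2 * S) * ((3 + S) / 12)"
    by (simp add: S(1) e(1))
  also have "\<dots> = (12 - 2 * S - 2 * (S * S)) / 12"
    by (simp add: field_simps)
  also have "\<dots> = (3 - S) / 6"
    by (simp add: S(1))
  finally have hh: "h * h = (3 - S) / 6" .
  have "e * h = (S - 1) * (e * e)"
    by (simp add: h_def)
  also have "\<dots> = (S * S + 2 * S - 3) / 12"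
    unfolding e(1) by (simp add: field_simps)
  finally have eh: "e * h = S / 6"
    by (simp add: S(1))
  have h: "h * h = (3 - S) / 6" "e * h = S / 6" "h > 0"
    using S e hh eh by (simp_all add: h_def)
  have t: "t * t = 1 / 2" "t > 0"
    by (auto simp: t_def)
  have v: "v * v = S - 1" "v > 0" "v \<noteq> 0"
    using S by (auto simp: v_def)
  have c: "sqrt ((3 + S) / 2 * 2) = 2 * S * e"
  proof (rule real_sqrt_unique)
    have "(2 * S * e)\<^sup>2 = 4 * (S * S) * (e * e)"
      by (simp add: power2_eq_square)
    then show "(2 * S * e)\<^sup>2 = (3 + S) / 2 * 2"
      by (simp add: S(1) e(1))
  qed (use S e in auto)
  have "h * (3 + S) = (S * S + 2 * S - 3) * e"
    by (simp add: h_def algebra_simps)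
  then have hS: "h * (3 + S) = 2 * S * e"
    by (simp add: S(1))
  \<comment> \<open>The facts \<open>f1\<close> to \<open>f5\<close> supply the arithmetic for the
    certificate: \<open>f1\<close> and \<open>f2\<close> for pairings and costs, \<open>f3\<close>
    for the Perron equations of the variables p and q, \<open>f4\<close> for the norm of
    \<open>Q\<close> and \<open>f5\<close> for the value.\<close>
  have f1: "(S + 1) * (S - 1) = 2" "2 * S + (S - 1) * (S - 1) = 4" "(S + 1) * (S + 1) = 4 + S * 2"
    by (simp_all add: algebra_simps S(1))
  have f2: "2 / (S - 1) = 1 + S"
    using f1(1) S(2) by (simp add: field_simps)
  have "h * (h * h) = h * (3 - S) / 6"
    by (simp add: h(1))
  also have "\<dots> = h - h * (3 + S) / 6"
    by (simp add: field_simps)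
  finally have hhh: "h * (h * h) = h - S * e / 3"
    by (simp add: hS)
  have tS: "t * (t * S) = S / 2"
    unfolding mult.assoc[symmetric] t(1) by simp
  have f3: "e * h * 3 + t * (t * S) = S" "e * S / 3 + h * (h * h) = h"
    unfolding h(2) tS hhh by simp_all
  have "t * S * (t * S) = (t * t) * (S * S)"
    by (simp only: mult_ac)
  then have "t * S * (t * S) = 3 / 2"
    by (simp add: t(1) S(1))
  then have f4: "h * h + t * S * (t * S) / 9 + (3 + S) * (3 + S) / 36 = 1"
    by (simp add: h(1) S(1) algebra_simps add_divide_distrib diff_divide_distrib)
  have f5: "2 * (e * (e * h)) + (2 * (S * (e * (t * t))) / 3 + (e * (3 + S) / 3 + (h * h * h + h * (3 + S) / 6)))
      = sqrt ((6 + S * 2) / 2)"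
  proof -
    have "2 * (e * (e * h)) + (2 * (S * (e * (t * t))) / 3 + (e * (3 + S) / 3 + (h * h * h + h * (3 + S) / 6)))
      = e * S / 3 + (S * e / 3 + (e + e * S / 3 + h))"
    proof -
      have "h * h * h = h - S * e / 3" using hhh by simp
      then show ?thesis
        unfolding h(2) t(1) hS by (simp add: field_simps)
    qed
    also have "\<dots> = 2 * S * e"
      by (simp add: h_def algebra_simps)
    also have "\<dots> = sqrt ((6 + S * 2) / 2)"
      unfolding c[symmetric] by (simp add: field_simps)
    finally show ?thesis .
  qed
  show ?thesis
    by (rule opt3I[where ?c0.0 = "(3 + S) / 2" and ?c1.0 = 2
      and U = "\<lambda>p q r i l. if l = 0 then
           if \<not> p \<and> \<not> q then (if i = 2 then 0 else 1)
           else if \<not> p then (if i = 0 then 1 / v else if i = 1 then 1 else 0)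
           else if \<not> q then (if i = 0 then 1 else if i = 1 then 1 / v else 0)
           else if \<not> r then (if i = 2 then (S + 1) / 2 else 1 / 2)
           else (if i = 2 then S - 1 else v) else 0"
      and W = "sym_edge (\<lambda>a. if a \<in> {(3, 7), (5, 7), (6, 7)} then 1 else if a \<in> {(3, 0), (5, 0)} then e
           else if a = (6, 0) then h else if a \<in> {(3, 1), (5, 1)} then t else 0)"
      and d = "\<lambda>i p q r. if i = 2 then (if bits p q r \<in> {3, 5} then e else 1)
         else if bits p q r = 0 then h else if bits p q r = 1 then t * S / 3 else if bits p q r = 6 then h * h
         else if bits p q r = (if i = 0 then 5 else 3) then S / 3 else 1"
      and P = "\<lambda>p q r. if bits p q r \<in> {3, 5} then e else if bits p q r = 6 then h else 0"
      and Q = "\<lambda>p q r. if bits p q r = 7 then (3 + S) / 6 else if bits p q r = 0 then h else if bits p q r = 1 then t * S / 3 else 0"])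
      (simp_all only: all_bool_eq sum_UNIV_bool sum_lessThan_3 sym_edge_def, insert S e h t v,
       simp_all add: power2_eq_square, insert f1 f2 f3 f4 f5, simp_all)
qed

section \<open>One and two bits\<close>

lemma opt_var: "opt {a} (\<lambda>x. a \<in> x)"
proof -
  have Pow: "Pow {a} = {{}, {a}}" by auto
  have "dual_sol {a} (\<lambda>x. a \<in> x) 1 (\<lambda>_ _ _. 1)"
    unfolding dual_sol_def by (auto simp: differs_def)
  then have "has_dual {a} (\<lambda>x. a \<in> x) 1"
    unfolding has_dual_def by (intro exI[of _ 1] exI[of _ "\<lambda>_ _ _. 1"]) (simp add: dual_cost_def)
  moreover have "adv_sol {a} (\<lambda>x. a \<in> x) (\<lambda>x y. if x = y then 0 else 1)"
    by (rule adv_sol_schurI[where d = "\<lambda>_ _. 1"]) (auto simp: Pow differs_def)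
  then have "has_primal {a} (\<lambda>x. a \<in> x) 1"
    unfolding has_primal_def
    by (intro exI[of _ "\<lambda>x y. if x = y then 0 else 1"] exI[of _ "\<lambda>x. of_bool (a \<notin> x)"] exI[of _ "\<lambda>x. of_bool (a \<in> x)"])
       (simp add: Pow bil_def)
  ultimately show ?thesis
    unfolding opt_def tight_def using zero_less_one by blast
qed

lemma opt_1: "opt {a} (\<lambda>x. F (a \<in> x))"
proof -
  have "F = (\<lambda>p. p) \<or> F = (\<lambda>p. \<not> p) \<or> F = (\<lambda>p. False) \<or> F = (\<lambda>p. True)"
    unfolding fun_eq_iff all_bool_eq by blast
  then show ?thesis
    using opt_var[of a] opt_not[OF opt_var[of a]] opt_const[of "{a}"] by auto
qed

text \<open>Up to negating the output, every two-bit function is a conjunction or a parity of two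
  one-bit functions.\<close>

lemma opt_2:
  assumes "a \<noteq> b"
  shows "opt {a, b} (\<lambda>x. F (a \<in> x) (b \<in> x))"
proof -
  have U: "{a} \<union> {b} = {a, b}" by auto
  have disj: "{a} \<inter> {b} = {}" using assms by simp
  have and2: "opt {a, b} (\<lambda>x. G (a \<in> x) \<and> H (b \<in> x))" for G H :: "bool \<Rightarrow> bool"
    using opt_and[OF _ _ disj opt_1[of a G] opt_1[of b H]] unfolding U by simp
  have xor2: "opt {a, b} (\<lambda>x. G (a \<in> x) \<noteq> H (b \<in> x))" for G H :: "bool \<Rightarrow> bool"
    using opt_xor[OF _ _ disj opt_1[of a G] opt_1[of b H]] unfolding U by simp
  \<comment> \<open>One-bit functions are given by their two values, so the existential ranges over
    four booleans and can be expanded.\<close>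
  let ?sel = "\<lambda>g h p. if p then h else g :: bool"
  have "\<exists>g h g' h'. (\<forall>p q. F p q = (?sel g h p \<and> ?sel g' h' q)) \<or>
     (\<forall>p q. F p q = (\<not> (?sel g h p \<and> ?sel g' h' q))) \<or> (\<forall>p q. F p q = (?sel g h p \<noteq> ?sel g' h' q))"
    by (cases "F True True"; cases "F True False"; cases "F False True"; cases "F False False")
       (simp_all add: all_bool_eq ex_bool_eq)
  then obtain g h g' h' where *: "(\<forall>p q. F p q = (?sel g h p \<and> ?sel g' h' q)) \<or>
     (\<forall>p q. F p q = (\<not> (?sel g h p \<and> ?sel g' h' q))) \<or> (\<forall>p q. F p q = (?sel g h p \<noteq> ?sel g' h' q))"
    by (elim exE) (rule that)
  define G H where "G = ?sel g h" and "H = ?sel g' h'"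
  have "(\<forall>p q. F p q = (G p \<and> H q)) \<or> (\<forall>p q. F p q = (\<not> (G p \<and> H q))) \<or> (\<forall>p q. F p q = (G p \<noteq> H q))"
    using * unfolding G_def H_def .
  then show ?thesis
    using and2[of G H] opt_not[OF and2[of G H]] xor2[of G H] by (elim disjE) simp_all
qed

section \<open>Symmetries and truth tables of three-bit functions\<close>

lemma opt3_not: "opt3 F \<Longrightarrow> opt3 (\<lambda>p q r. \<not> F p q r)"
  unfolding opt3_def by (intro allI impI opt_not) blast

lemma opt3_swap12: "opt3 F \<Longrightarrow> opt3 (\<lambda>p q r. F q p r)"
  unfolding opt3_def
proof (intro allI impI)
  fix a b c :: nat assume F: "\<forall>a b c. distinct [a, b, c] \<longrightarrow> opt {a, b, c} (\<lambda>x. F (a \<in> x) (b \<in> x) (c \<in> x))"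
    and "distinct [a, b, c]"
  then show "opt {a, b, c} (\<lambda>x. F (b \<in> x) (a \<in> x) (c \<in> x))"
    using F[rule_format, of b a c] by (simp add: insert_commute)
qed

lemma opt3_swap23: "opt3 F \<Longrightarrow> opt3 (\<lambda>p q r. F p r q)"
  unfolding opt3_def
proof (intro allI impI)
  fix a b c :: nat assume F: "\<forall>a b c. distinct [a, b, c] \<longrightarrow> opt {a, b, c} (\<lambda>x. F (a \<in> x) (b \<in> x) (c \<in> x))"
    and "distinct [a, b, c]"
  then show "opt {a, b, c} (\<lambda>x. F (a \<in> x) (c \<in> x) (b \<in> x))"
    using F[rule_format, of a c b] by (simp add: insert_commute)
qed

lemma opt3_flip1: "opt3 F \<Longrightarrow> opt3 (\<lambda>p q r. F (\<not> p) q r)"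
  unfolding opt3_def
proof (intro allI impI)
  fix a b c :: nat assume F: "\<forall>a b c. distinct [a, b, c] \<longrightarrow> opt {a, b, c} (\<lambda>x. F (a \<in> x) (b \<in> x) (c \<in> x))"
    and abc: "distinct [a, b, c]"
  have "opt {a, b, c} (\<lambda>x. F (a \<in> sym_diff x {a}) (b \<in> sym_diff x {a}) (c \<in> sym_diff x {a}))"
    by (rule opt_flip) (use F abc in auto)
  then show "opt {a, b, c} (\<lambda>x. F (a \<notin> x) (b \<in> x) (c \<in> x))"
    using abc by simp
qed

lemma opt3_and_xor:
  fixes G :: "bool \<Rightarrow> bool" and H :: "bool \<Rightarrow> bool \<Rightarrow> bool"
  shows "opt3 (\<lambda>p q r. G p \<and> H q r)" "opt3 (\<lambda>p q r. G p \<noteq> H q r)"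
proof -
  have "opt {a, b, c} (\<lambda>x. G (a \<in> x) \<and> H (b \<in> x) (c \<in> x)) \<and> opt {a, b, c} (\<lambda>x. G (a \<in> x) \<noteq> H (b \<in> x) (c \<in> x))"
    if "distinct [a, b, c]" for a b c
  proof -
    have disj: "{a} \<inter> {b, c} = {}" and bc: "b \<noteq> c" using that by auto
    have U: "{a} \<union> {b, c} = {a, b, c}" by auto
    show ?thesis
      using opt_and[OF _ _ disj opt_1[of a G] opt_2[OF bc, of H]]
        opt_xor[OF _ _ disj opt_1[of a G] opt_2[OF bc, of H]] unfolding U by simp
  qed
  then show "opt3 (\<lambda>p q r. G p \<and> H q r)" "opt3 (\<lambda>p q r. G p \<noteq> H q r)"
    unfolding opt3_def by blast+
qed

lemma opt3_EQUAL: "opt3 (\<lambda>p q r. p = q \<and> q = r)"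
  unfolding opt3_def
proof (intro allI impI)
  fix a b c :: nat assume abc: "distinct [a, b, c]"
  have "opt {a, b, c} (\<lambda>x. x = {} \<or> x = {a, b, c})"
    using abc by (intro opt_EQUAL) simp_all
  moreover have "opt {a, b, c} (\<lambda>x. x = {} \<or> x = {a, b, c}) = opt {a, b, c} (\<lambda>x. (a \<in> x) = (b \<in> x) \<and> (b \<in> x) = (c \<in> x))"
    using abc by (intro opt_cong) auto
  ultimately show "opt {a, b, c} (\<lambda>x. (a \<in> x) = (b \<in> x) \<and> (b \<in> x) = (c \<in> x))" by simp
qed

text \<open>With a function given by eight booleans, a claim about all three-bit functions is a
  quantification over \<open>bool\<close> that expands into 256 instances.\<close>

definition opt_table :: "bool \<Rightarrow> bool \<Rightarrow> bool \<Rightarrow> bool \<Rightarrow> bool \<Rightarrow> bool \<Rightarrow> bool \<Rightarrow> bool \<Rightarrow> bool" where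
  "opt_table a b c d e f g h = opt3 (\<lambda>p q r. [a, b, c, d, e, f, g, h] ! bits p q r)"

lemma opt3_iff_table:
  "opt3 F \<longleftrightarrow> opt_table (F False False False) (F False False True) (F False True False) (F False True True)
     (F True False False) (F True False True) (F True True False) (F True True True)"
proof -
  have "F = (\<lambda>p q r. [F False False False, F False False True, F False True False, F False True True,
     F True False False, F True False True, F True True False, F True True True] ! bits p q r)"
    unfolding fun_eq_iff all_bool_eq by simp
  then show ?thesis
    unfolding opt_table_def by (rule arg_cong)
qed

lemma opt_table_not:
  assumes "opt_table a b c d e f g h"
  shows "opt_table (\<not> a) (\<not> b) (\<not> c) (\<not> d) (\<not> e) (\<not> f) (\<not> g) (\<not> h)"
  using opt3_not[OF assms[unfolded opt_table_def]] unfolding opt3_iff_table by simp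

lemma opt_table_flip1:
  assumes "opt_table a b c d e f g h"
  shows "opt_table e f g h a b c d"
  using opt3_flip1[OF assms[unfolded opt_table_def]] unfolding opt3_iff_table by simp

lemma opt_table_swap12:
  assumes "opt_table a b c d e f g h"
  shows "opt_table a b e f c d g h"
  using opt3_swap12[OF assms[unfolded opt_table_def]] unfolding opt3_iff_table by simp

lemma opt_table_swap23:
  assumes "opt_table a b c d e f g h"
  shows "opt_table a c b d e g f h"
  using opt3_swap23[OF assms[unfolded opt_table_def]] unfolding opt3_iff_table by simp

text \<open>The flip of the first variable, conjugated by a transposition; the third variable is
  treated in the same way.\<close>

lemmas opt_table_flip2 = opt_table_swap12[THEN opt_table_flip1, THEN opt_table_swap12]
lemmas opt_table_flip3 = opt_table_swap23[THEN opt_table_flip2, THEN opt_table_swap23]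

lemma opt3_degenerate: "opt3 (\<lambda>p q r. False)" "opt3 (\<lambda>p q r. p)"
  using opt3_and_xor(1)[of "\<lambda>_. False" "\<lambda>_ _. True"] opt3_and_xor(1)[of "\<lambda>p. p" "\<lambda>_ _. True"]
  by simp_all

lemma opt3_read_once:
  "opt3 (\<lambda>p q r. p \<and> q)" "opt3 (\<lambda>p q r. p \<noteq> q)"
  "opt3 (\<lambda>p q r. p \<and> q \<and> r)" "opt3 (\<lambda>p q r. p \<and> (q \<or> r))" "opt3 (\<lambda>p q r. p \<and> (q \<noteq> r))"
  "opt3 (\<lambda>p q r. p \<noteq> (q \<and> r))" "opt3 (\<lambda>p q r. p \<noteq> (q \<noteq> r))"
  by (rule opt3_and_xor[where G = "\<lambda>p. p"])+

text \<open>
  The fourteen representatives generate all 256 truth tables under flipping a variable, negating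
  the output and permuting variables.
\<close>

lemmas tables0 = opt3_degenerate[unfolded opt3_iff_table, simplified] opt3_read_once[unfolded opt3_iff_table, simplified]
  opt3_EQUAL[unfolded opt3_iff_table, simplified] opt3_ITE[unfolded opt3_iff_table, simplified]
  opt3_MAJ[unfolded opt3_iff_table, simplified] opt3_EXACT1[unfolded opt3_iff_table, simplified]
  opt3_and3_or_nor2[unfolded opt3_iff_table, simplified]

lemmas tables1 = tables0 tables0[THEN opt_table_flip1]
lemmas tables2 = tables1 tables1[THEN opt_table_flip2]
lemmas tables3 = tables2 tables2[THEN opt_table_flip3]
lemmas tables4 = tables3 tables3[THEN opt_table_not, simplified]
lemmas tables5 = tables4 tables4[THEN opt_table_swap12]
text \<open>\<open>tables5\<close> already covers the subgroup generated by the first transposition;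
  the three families here run through its cosets in the group of all permutations of three
  variables.\<close>

lemmas tables6 = tables5 tables5[THEN opt_table_swap23] tables5[THEN opt_table_swap23, THEN opt_table_swap12]

lemma opt3_all: "opt3 F"
proof -
  have "\<forall>a b c d e f g h. opt_table a b c d e f g h"
    by (simp only: all_bool_eq tables6 simp_thms)
  then show ?thesis
    unfolding opt3_iff_table by blast
qed

section \<open>Read-once formulas\<close>

lemma opt_gate:
  assumes "SK'_gate K phi vs"
  shows "opt (set vs) (\<lambda>x. phi (map (\<lambda>i. i \<in> x) vs))"
proof -
  have d: "distinct vs" using assms by (simp add: SK'_gate_def)
  show ?thesis
  proof (cases "length vs \<in> {1, 2, 3}")
    case True
    then consider a where "vs = [a]" | a b where "vs = [a, b]" | a b c where "vs = [a, b, c]"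
      by (auto simp: numeral_eq_Suc length_Suc_conv)
    then show ?thesis
    proof cases
      case 1
      then show ?thesis using opt_1[of a "\<lambda>p. phi [p]"] by simp
    next
      case 2
      then show ?thesis using opt_2[of a b "\<lambda>p q. phi [p, q]"] d by simp
    next
      case 3
      then show ?thesis using opt3_all[of "\<lambda>p q r. phi [p, q, r]"] d by (simp add: opt3_def)
    qed
  next
    case False
    \<comment> \<open>EQUAL on two or three bits falls under the previous case, so enough variables
      remain for \<open>opt_EQUAL\<close>.\<close>
    then have len: "3 \<le> length vs" and phi: "\<And>ys. length ys = length vs \<Longrightarrow> phi ys = EQUAL_fn ys"
      using assms by (auto simp: SK'_gate_def)
    have "opt (set vs) (\<lambda>x. x = {} \<or> x = set vs)"
      using len distinct_card[OF d] by (intro opt_EQUAL) auto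
    moreover have "opt (set vs) (\<lambda>x. x = {} \<or> x = set vs) = opt (set vs) (\<lambda>x. phi (map (\<lambda>i. i \<in> x) vs))"
    proof (rule opt_cong)
      fix x assume "x \<in> Pow (set vs)"
      moreover have "phi (map (\<lambda>i. i \<in> x) vs) = (\<forall>a\<in>set vs. \<forall>b\<in>set vs. (a \<in> x) = (b \<in> x))"
        by (subst phi) (auto simp: EQUAL_fn_def)
      ultimately show "(x = {} \<or> x = set vs) = phi (map (\<lambda>i. i \<in> x) vs)"
        by blast
    qed
    ultimately show ?thesis by simp
  qed
qed

text \<open>Each set is required to be disjoint from the union of the later ones, the form needed to
  compose the head of a list with the rest.\<close>

fun disjoint_list :: "('b \<Rightarrow> 'a set) \<Rightarrow> 'b list \<Rightarrow> bool" where
  "disjoint_list V [] \<longleftrightarrow> True"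
| "disjoint_list V (g # gs) \<longleftrightarrow> V g \<inter> (\<Union>g'\<in>set gs. V g') = {} \<and> disjoint_list V gs"

text \<open>Binary composition of the head with the tail. The empty list gives a constant, which
  \<open>opt\<close> admits, so it can serve as base case. The last assumption says that
  \<open>E g\<close> depends only on the variables in \<open>V g\<close>.\<close>

lemma opt_list:
  assumes "disjoint_list V gs" "\<And>g. g \<in> set gs \<Longrightarrow> finite (V g)"
    and "\<And>g. g \<in> set gs \<Longrightarrow> opt (V g) (E g)"
    and "\<And>g x. g \<in> set gs \<Longrightarrow> E g (x \<inter> V g) = E g x"
  shows "opt (\<Union>g\<in>set gs. V g) (\<lambda>x. list_all (\<lambda>g. E g x) gs) \<and>
    opt (\<Union>g\<in>set gs. V g) (\<lambda>x. list_ex (\<lambda>g. E g x) gs) \<and>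
    opt (\<Union>g\<in>set gs. V g) (\<lambda>x. odd (length (filter (\<lambda>g. E g x) gs)))"
  using assms
proof (induction gs)
  case Nil
  then show ?case by (simp add: opt_const)
next
  case (Cons g gs)
  define B where "B = (\<Union>g\<in>set gs. V g)"
  have fin: "finite (V g)" "finite B" and disj: "V g \<inter> B = {}"
    using Cons.prems by (auto simp: B_def)
  have U: "(\<Union>g\<in>set (g # gs). V g) = V g \<union> B"
    by (simp add: B_def)
  have f: "opt (V g) (E g)" using Cons.prems by simp
  have Eg: "E g (x \<inter> V g) = E g x" for x using Cons.prems(4) by simp
  have E: "E g' (x \<inter> B) = E g' x" if "g' \<in> set gs" for g' x
  proof -
    have "V g' \<subseteq> B" using that by (auto simp: B_def)
    then have "x \<inter> B \<inter> V g' = x \<inter> V g'" by auto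
    then show ?thesis using Cons.prems(4)[of g'] that by (metis list.set_intros(2))
  qed
  have ih: "opt B (\<lambda>x. list_all (\<lambda>g. E g x) gs)" "opt B (\<lambda>x. list_ex (\<lambda>g. E g x) gs)"
    "opt B (\<lambda>x. odd (length (filter (\<lambda>g. E g x) gs)))"
    using Cons.IH Cons.prems unfolding B_def by simp_all
  have la: "list_all (\<lambda>g. E g (x \<inter> B)) gs = list_all (\<lambda>g. E g x) gs" for x
    using E by (simp cong: list.pred_cong)
  have le: "list_ex (\<lambda>g. E g (x \<inter> B)) gs = list_ex (\<lambda>g. E g x) gs" for x
    using E by (simp add: list_ex_iff)
  have lf: "filter (\<lambda>g. E g (x \<inter> B)) gs = filter (\<lambda>g. E g x) gs" for x
    using E by (simp cong: filter_cong)
  have "list_all (\<lambda>g. E g x) (g # gs) = (E g x \<and> list_all (\<lambda>g. E g x) gs)"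
    "list_ex (\<lambda>g. E g x) (g # gs) = (E g x \<or> list_ex (\<lambda>g. E g x) gs)" for x
    by simp_all
  moreover have "odd (length (filter (\<lambda>g. E g x) (g # gs))) = (E g x \<noteq> odd (length (filter (\<lambda>g. E g x) gs)))" for x
    by simp
  note step = calculation this
  show ?case
    unfolding U step
    using opt_and[OF fin disj f ih(1)] opt_or[OF fin disj f ih(2)] opt_xor[OF fin disj f ih(3)]
    unfolding Eg la le lf by blast
qed

lemma rof_eval_cong:
  "(\<And>r. r \<in> set (rof_leaves g) \<Longrightarrow> y r = y' r) \<Longrightarrow> rof_eval g y = rof_eval g y'"
proof (induction g)
  case (RAnd gs)
  then have "rof_eval g y = rof_eval g y'" if "g \<in> set gs" for g using that by auto
  then show ?case by (simp cong: list.pred_cong)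
next
  case (ROr gs)
  then have "rof_eval g y = rof_eval g y'" if "g \<in> set gs" for g using that by auto
  then show ?case by (simp add: list_ex_iff)
next
  case (RPar gs)
  then have "rof_eval g y = rof_eval g y'" if "g \<in> set gs" for g using that by auto
  then show ?case by (simp cong: filter_cong)
qed auto

lemma disjoint_list_leaves:
  assumes "distinct (concat (map rof_leaves gs))"
    and "\<And>r r'. r \<in> R \<Longrightarrow> r' \<in> R \<Longrightarrow> r \<noteq> r' \<Longrightarrow> W r \<inter> W r' = {}"
    and "set (concat (map rof_leaves gs)) \<subseteq> R"
  shows "disjoint_list (\<lambda>g. \<Union>r\<in>set (rof_leaves g). W r) gs"
  using assms(1,3)
proof (induction gs)
  case (Cons g gs)
  have "W r \<inter> W r' = {}" if "r \<in> set (rof_leaves g)" "g' \<in> set gs" "r' \<in> set (rof_leaves g')" for r g' r'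
    using Cons.prems that by (intro assms(2)) auto
  then have "(\<Union>r\<in>set (rof_leaves g). W r) \<inter> (\<Union>g'\<in>set gs. \<Union>r\<in>set (rof_leaves g'). W r) = {}"
    by blast
  then show ?case using Cons by simp
qed simp

text \<open>Because the formula is read-once, sibling subformulas have different leaves and hence
  disjoint variable sets, so composition applies at every node.\<close>

lemma opt_formula:
  assumes gate: "\<And>r. r \<in> R \<Longrightarrow> SK'_gate K (phi r) (vs r)"
    and disj: "\<And>r r'. r \<in> R \<Longrightarrow> r' \<in> R \<Longrightarrow> r \<noteq> r' \<Longrightarrow> set (vs r) \<inter> set (vs r') = {}"
  shows "distinct (rof_leaves g) \<Longrightarrow> set (rof_leaves g) \<subseteq> R \<Longrightarrow>
    opt (\<Union>r\<in>set (rof_leaves g). set (vs r)) (\<lambda>x. rof_eval g (\<lambda>r. phi r (map (\<lambda>i. i \<in> x) (vs r))))"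
proof (induction g)
  case (RLeaf r)
  then show ?case using opt_gate[OF gate[of r]] by simp
next
  case (RNot g)
  then show ?case using opt_not by simp
next
  define V where "V g = (\<Union>r\<in>set (rof_leaves g). set (vs r))" for g
  define E where "E g x = rof_eval g (\<lambda>r. phi r (map (\<lambda>i. i \<in> x) (vs r)))" for g x
  have E: "E g (x \<inter> V g) = E g x" for g x
    unfolding E_def
    by (intro rof_eval_cong arg_cong[where f = "phi _"] map_cong refl) (auto simp: V_def)
  have list: "opt (\<Union>g\<in>set gs. V g) (\<lambda>x. list_all (\<lambda>g. E g x) gs) \<and>
    opt (\<Union>g\<in>set gs. V g) (\<lambda>x. list_ex (\<lambda>g. E g x) gs) \<and>
    opt (\<Union>g\<in>set gs. V g) (\<lambda>x. odd (length (filter (\<lambda>g. E g x) gs)))"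
    if IH: "\<And>g. g \<in> set gs \<Longrightarrow> distinct (rof_leaves g) \<Longrightarrow> set (rof_leaves g) \<subseteq> R \<Longrightarrow> opt (V g) (E g)"
      and leaves: "distinct (concat (map rof_leaves gs))" "set (concat (map rof_leaves gs)) \<subseteq> R" for gs
  proof (rule opt_list)
    show "disjoint_list V gs"
      unfolding V_def[abs_def] by (rule disjoint_list_leaves[OF leaves(1) disj leaves(2)])
    fix g assume g: "g \<in> set gs"
    show "finite (V g)" by (simp add: V_def)
    show "opt (V g) (E g)"
      using leaves g by (intro IH) (auto simp: distinct_concat_iff)
  qed (rule E)
  have V: "(\<Union>r\<in>set (concat (map rof_leaves gs)). set (vs r)) = (\<Union>g\<in>set gs. V g)" for gs
    by (auto simp: V_def)
  {
    case (RAnd gs)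
    then show ?case using list[of gs] unfolding rof_leaves.simps V rof_eval.simps by (simp add: V_def E_def[abs_def])
  next
    case (ROr gs)
    then show ?case using list[of gs] unfolding rof_leaves.simps V rof_eval.simps by (simp add: V_def E_def[abs_def])
  next
    case (RPar gs)
    then show ?case using list[of gs] unfolding rof_leaves.simps V rof_eval.simps by (simp add: V_def E_def[abs_def])
  }
qed

section \<open>Weak duality and the adversary bound\<close>

text \<open>For nonnegative \<open>B\<close> this is the operator norm bound, in the arithmetic-mean
  form used in \<open>adv_sol\<close>.\<close>

definition form_bounded :: "'a set \<Rightarrow> ('a \<Rightarrow> 'a \<Rightarrow> real) \<Rightarrow> real \<Rightarrow> bool" where
  "form_bounded S M B \<longleftrightarrow> (\<forall>a b. bil S M a b \<le> B * ((\<Sum>x\<in>S. (a x)\<^sup>2) + (\<Sum>x\<in>S. (b x)\<^sup>2)) / 2)"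

lemma form_bounded_mono: "form_bounded S M B \<Longrightarrow> B \<le> B' \<Longrightarrow> form_bounded S M B'"
  unfolding form_bounded_def
  by (meson divide_right_mono mult_right_mono order_trans add_nonneg_nonneg sum_nonneg zero_le_power2 zero_le_numeral)

lemma form_bounded_reindex:
  assumes T: "bij_betw T S' S" and M: "\<And>x y. x \<in> S' \<Longrightarrow> y \<in> S' \<Longrightarrow> M' x y = M (T x) (T y)"
  shows "form_bounded S' M' B \<longleftrightarrow> form_bounded S M B"
proof
  assume M': "form_bounded S' M' B"
  show "form_bounded S M B"
    unfolding form_bounded_def
  proof (intro allI)
    fix a b
    have "bil S M a b = bil S' (\<lambda>x y. M (T x) (T y)) (\<lambda>x. a (T x)) (\<lambda>x. b (T x))"
      by (rule bil_reindex[OF T, symmetric])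
    also have "\<dots> = bil S' M' (\<lambda>x. a (T x)) (\<lambda>x. b (T x))"
      by (intro bil_cong) (simp add: M)
    also have "\<dots> \<le> B * ((\<Sum>x\<in>S'. (a (T x))\<^sup>2) + (\<Sum>x\<in>S'. (b (T x))\<^sup>2)) / 2"
      using M' unfolding form_bounded_def by blast
    also have "\<dots> = B * ((\<Sum>x\<in>S. (a x)\<^sup>2) + (\<Sum>x\<in>S. (b x)\<^sup>2)) / 2"
      by (simp add: sum.reindex_bij_betw[OF T, of "\<lambda>x. (a x)\<^sup>2"] sum.reindex_bij_betw[OF T, of "\<lambda>x. (b x)\<^sup>2"])
    finally show "bil S M a b \<le> B * ((\<Sum>x\<in>S. (a x)\<^sup>2) + (\<Sum>x\<in>S. (b x)\<^sup>2)) / 2" .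
  qed
next
  assume MB: "form_bounded S M B"
  let ?R = "the_inv_into S' T"
  have R: "?R (T x) = x" if "x \<in> S'" for x
    using T that by (simp add: bij_betw_def the_inv_into_f_f)
  show "form_bounded S' M' B"
    unfolding form_bounded_def
  proof (intro allI)
    fix a b
    have "bil S' M' a b = bil S' (\<lambda>x y. M (T x) (T y)) (\<lambda>x. a (?R (T x))) (\<lambda>x. b (?R (T x)))"
      by (intro bil_cong) (simp add: R M)
    also have "\<dots> = bil S M (\<lambda>x. a (?R x)) (\<lambda>x. b (?R x))"
      by (rule bil_reindex[OF T, where p = "\<lambda>x. a (?R x)" and q = "\<lambda>x. b (?R x)"])
    also have "\<dots> \<le> B * ((\<Sum>x\<in>S. (a (?R x))\<^sup>2) + (\<Sum>x\<in>S. (b (?R x))\<^sup>2)) / 2"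
      using MB unfolding form_bounded_def by blast
    also have "\<dots> = B * ((\<Sum>x\<in>S'. (a x)\<^sup>2) + (\<Sum>x\<in>S'. (b x)\<^sup>2)) / 2"
    proof -
      have "(\<Sum>x\<in>S. (e (?R x))\<^sup>2) = (\<Sum>x\<in>S'. (e x)\<^sup>2)" for e :: "_ \<Rightarrow> real"
        using sum.reindex_bij_betw[OF T, of "\<lambda>x. (e (?R x))\<^sup>2"] by (simp add: R cong: sum.cong)
      then show ?thesis by simp
    qed
    finally show "bil S' M' a b \<le> B * ((\<Sum>x\<in>S'. (a x)\<^sup>2) + (\<Sum>x\<in>S'. (b x)\<^sup>2)) / 2" .
  qed
qed

lemma bil_eq: "bil S M a b = (\<Sum>x\<in>S. a x * (\<Sum>y\<in>S. M x y * b y))"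
  by (simp add: bil_def sum_distrib_left mult.assoc)

text \<open>Evaluating the form at the normalised image of u on the left and u on the right gives
  the norm of the image.\<close>

lemma opnorm_le:
  assumes M: "form_bounded S M B" and B: "B \<ge> 0"
  shows "opnorm S M \<le> B"
  unfolding opnorm_def
proof (rule cSup_least)
  show "{sqrt (\<Sum>x\<in>S. (\<Sum>y\<in>S. M x y * u y)\<^sup>2) |u. (\<Sum>y\<in>S. (u y)\<^sup>2) \<le> 1} \<noteq> {}"
    by (auto intro!: exI[of _ "\<lambda>_. 0"])
  fix r assume "r \<in> {sqrt (\<Sum>x\<in>S. (\<Sum>y\<in>S. M x y * u y)\<^sup>2) |u. (\<Sum>y\<in>S. (u y)\<^sup>2) \<le> 1}"
  then obtain u where u: "(\<Sum>y\<in>S. (u y)\<^sup>2) \<le> 1" and r: "r = sqrt (\<Sum>x\<in>S. (\<Sum>y\<in>S. M x y * u y)\<^sup>2)"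
    by blast
  define v where "v x = (\<Sum>y\<in>S. M x y * u y)" for x
  have r2: "(\<Sum>x\<in>S. (v x)\<^sup>2) = r\<^sup>2"
    unfolding r v_def by (simp add: sum_nonneg)
  have "r \<ge> 0" unfolding r by (simp add: sum_nonneg)
  show "r \<le> B"
  proof (cases "r = 0")
    case False
    then have rpos: "r > 0" using \<open>r \<ge> 0\<close> by simp
    have n1: "(\<Sum>x\<in>S. (v x / r)\<^sup>2) = 1"
      unfolding power_divide sum_divide_distrib[symmetric] r2 using rpos by simp
    have "bil S M (\<lambda>x. v x / r) u = (\<Sum>x\<in>S. v x / r * v x)"
      unfolding bil_eq v_def[symmetric] ..
    also have "\<dots> = (\<Sum>x\<in>S. (v x)\<^sup>2) / r"
      by (simp add: sum_divide_distrib power2_eq_square)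
    also have "\<dots> = r" unfolding r2 using rpos by (simp add: power2_eq_square)
    finally have "r \<le> B * ((\<Sum>x\<in>S. (v x / r)\<^sup>2) + (\<Sum>x\<in>S. (u x)\<^sup>2)) / 2"
      using M unfolding form_bounded_def by metis
    also have "\<dots> \<le> B * (1 + 1) / 2"
      unfolding n1 using u B by (intro divide_right_mono mult_left_mono add_mono) auto
    finally show ?thesis by simp
  qed (use B in simp)
qed

text \<open>By Cauchy-Schwarz the Frobenius norm is an upper bound; the real supremum in
  \<open>opnorm\<close> is meaningful only with such a bound.\<close>

lemma opnorm_bdd_above:
  assumes "finite S"
  shows "bdd_above {sqrt (\<Sum>x\<in>S. (\<Sum>y\<in>S. M x y * u y)\<^sup>2) |u. (\<Sum>y\<in>S. (u y)\<^sup>2) \<le> 1}"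
proof (rule bdd_aboveI)
  fix r assume "r \<in> {sqrt (\<Sum>x\<in>S. (\<Sum>y\<in>S. M x y * u y)\<^sup>2) |u. (\<Sum>y\<in>S. (u y)\<^sup>2) \<le> 1}"
  then obtain u where u: "(\<Sum>y\<in>S. (u y)\<^sup>2) \<le> 1" and r: "r = sqrt (\<Sum>x\<in>S. (\<Sum>y\<in>S. M x y * u y)\<^sup>2)"
    by blast
  have "(\<Sum>y\<in>S. M x y * u y)\<^sup>2 \<le> (\<Sum>y\<in>S. (M x y)\<^sup>2)" for x
  proof -
    have "(\<Sum>y\<in>S. M x y * u y)\<^sup>2 \<le> (\<Sum>y\<in>S. (M x y)\<^sup>2) * (\<Sum>y\<in>S. (u y)\<^sup>2)"
      by (rule Cauchy_Schwarz_ineq_sum)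
    also have "\<dots> \<le> (\<Sum>y\<in>S. (M x y)\<^sup>2) * 1"
      by (intro mult_left_mono u sum_nonneg) simp
    finally show ?thesis by simp
  qed
  then show "r \<le> sqrt (\<Sum>x\<in>S. \<Sum>y\<in>S. (M x y)\<^sup>2)"
    unfolding r by (intro real_sqrt_le_mono sum_mono)
qed

lemma opnorm_nonneg:
  assumes "finite S"
  shows "0 \<le> opnorm S M"
  unfolding opnorm_def by (rule cSup_upper[OF _ opnorm_bdd_above[OF assms]]) (auto intro!: exI[of _ "\<lambda>_. 0"])

lemma form_bounded_opnorm:
  assumes S: "finite S"
  shows "form_bounded S M (opnorm S M)"
  unfolding form_bounded_def
proof (intro allI)
  fix a b :: "'a \<Rightarrow> real"
  define s t where "s = sqrt (\<Sum>x\<in>S. (a x)\<^sup>2)" and "t = sqrt (\<Sum>x\<in>S. (b x)\<^sup>2)"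
  have st: "s \<ge> 0" "t \<ge> 0" "s\<^sup>2 = (\<Sum>x\<in>S. (a x)\<^sup>2)" "t\<^sup>2 = (\<Sum>x\<in>S. (b x)\<^sup>2)"
    by (simp_all add: s_def t_def sum_nonneg)
  have "bil S M a b \<le> opnorm S M * (s * t)"
  proof (cases "t = 0")
    case True
    then have "b x = 0" if "x \<in> S" for x
      using st(4) S that by (simp add: sum_nonneg_eq_0_iff)
    then have "bil S M a b = 0" by (simp add: bil_def)
    then show ?thesis using True by simp
  next
    case False
    then have t: "t > 0" using st by simp
    define v where "v x = (\<Sum>y\<in>S. M x y * (b y / t))" for x
    have "(\<Sum>y\<in>S. (b y / t)\<^sup>2) \<le> 1"
      unfolding power_divide sum_divide_distrib[symmetric] st(4)[symmetric] using t by simp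
    then have v: "sqrt (\<Sum>x\<in>S. (v x)\<^sup>2) \<le> opnorm S M"
      unfolding opnorm_def v_def
      by (intro cSup_upper[OF _ opnorm_bdd_above[OF S]] CollectI exI[of _ "\<lambda>y. b y / t"] conjI refl)
    have "bil S M a b = t * (\<Sum>x\<in>S. a x * v x)"
      unfolding bil_eq v_def using t by (simp add: sum_distrib_left mult_ac)
    also have "(\<Sum>x\<in>S. a x * v x) \<le> sqrt ((\<Sum>x\<in>S. (a x)\<^sup>2) * (\<Sum>x\<in>S. (v x)\<^sup>2))"
      by (rule real_le_rsqrt) (rule Cauchy_Schwarz_ineq_sum)
    also have "\<dots> = s * sqrt (\<Sum>x\<in>S. (v x)\<^sup>2)"
      by (simp add: real_sqrt_mult s_def)
    also have "\<dots> \<le> s * opnorm S M"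
      by (rule mult_left_mono[OF v st(1)])
    finally show ?thesis using t by (simp add: mult_ac)
  qed
  also have "\<dots> \<le> opnorm S M * ((s\<^sup>2 + t\<^sup>2) / 2)"
    using sum_squares_bound[of s t] by (intro mult_left_mono opnorm_nonneg S) simp
  finally show "bil S M a b \<le> opnorm S M * ((\<Sum>x\<in>S. (a x)\<^sup>2) + (\<Sum>x\<in>S. (b x)\<^sup>2)) / 2"
    by (simp add: st)
qed

text \<open>Wherever G is nonzero, the pairing of u equals 1 and may be inserted as a factor.
  Exchanging sums turns the form of G into a sum over i and l of forms of the restricted matrices,
  evaluated at a and b scaled by the coordinates of u. The squared norms of these scaled vectors add
  up to at most c times those of a and b.\<close>

lemma weak_duality:
  assumes A: "finite A" and u: "dual_sol A f k u" "\<And>x. x \<in> Pow A \<Longrightarrow> dual_cost A k u x \<le> c"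
    and G: "\<And>x y. x \<in> Pow A \<Longrightarrow> y \<in> Pow A \<Longrightarrow> f x = f y \<Longrightarrow> G x y = 0"
    and D: "\<And>i. i \<in> A \<Longrightarrow> form_bounded (Pow A) (\<lambda>x y. if differs i x y then G x y else 0) M"
    and M: "M \<ge> 0"
  shows "form_bounded (Pow A) G (c * M)"
  unfolding form_bounded_def
proof (intro allI)
  fix a b :: "nat set \<Rightarrow> real"
  let ?D = "\<lambda>i x y. if differs i x y then G x y else 0"
  have cost: "(\<Sum>i\<in>A. \<Sum>l<k. \<Sum>x\<in>Pow A. (e x * u x i l)\<^sup>2) \<le> c * (\<Sum>x\<in>Pow A. (e x)\<^sup>2)" for e
  proof -
    have "(\<Sum>i\<in>A. \<Sum>l<k. \<Sum>x\<in>Pow A. (e x * u x i l)\<^sup>2) = (\<Sum>i\<in>A. \<Sum>x\<in>Pow A. \<Sum>l<k. (e x * u x i l)\<^sup>2)"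
      by (intro sum.cong refl sum.swap)
    also have "\<dots> = (\<Sum>x\<in>Pow A. \<Sum>i\<in>A. \<Sum>l<k. (e x * u x i l)\<^sup>2)"
      by (rule sum.swap)
    also have "\<dots> = (\<Sum>x\<in>Pow A. (e x)\<^sup>2 * dual_cost A k u x)"
      by (simp add: dual_cost_def power_mult_distrib sum_distrib_left)
    also have "\<dots> \<le> (\<Sum>x\<in>Pow A. (e x)\<^sup>2 * c)"
      by (intro sum_mono mult_left_mono u(2)) auto
    finally show ?thesis by (simp add: sum_distrib_left mult.commute)
  qed
  have "bil (Pow A) G a b = (\<Sum>x\<in>Pow A. \<Sum>y\<in>Pow A. \<Sum>i\<in>A. \<Sum>l<k. (a x * u x i l) * ?D i x y * (b y * u y i l))"
    unfolding bil_def
  proof (intro sum.cong refl)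
    fix x y assume xy: "x \<in> Pow A" "y \<in> Pow A"
    have "a x * G x y * b y = a x * G x y * b y * (\<Sum>i\<in>A. if differs i x y then \<Sum>l<k. u x i l * u y i l else 0)"
      using u(1) G[OF xy] xy unfolding dual_sol_def by (cases "f x = f y") auto
    also have "\<dots> = (\<Sum>i\<in>A. \<Sum>l<k. (a x * u x i l) * ?D i x y * (b y * u y i l))"
      unfolding sum_distrib_left
      by (intro sum.cong refl) (simp add: sum_distrib_left mult_ac)
    finally show "a x * G x y * b y = (\<Sum>i\<in>A. \<Sum>l<k. (a x * u x i l) * ?D i x y * (b y * u y i l))" .
  qed
  also have "\<dots> = (\<Sum>x\<in>Pow A. \<Sum>i\<in>A. \<Sum>l<k. \<Sum>y\<in>Pow A. (a x * u x i l) * ?D i x y * (b y * u y i l))"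
    by (intro sum.cong refl, subst sum.swap, intro sum.cong refl sum.swap)
  also have "\<dots> = (\<Sum>i\<in>A. \<Sum>l<k. bil (Pow A) (?D i) (\<lambda>x. a x * u x i l) (\<lambda>x. b x * u x i l))"
    unfolding bil_def by (subst sum.swap, intro sum.cong refl sum.swap)
  also have "\<dots> \<le> (\<Sum>i\<in>A. \<Sum>l<k. M * ((\<Sum>x\<in>Pow A. (a x * u x i l)\<^sup>2) + (\<Sum>x\<in>Pow A. (b x * u x i l)\<^sup>2)) / 2)"
    using D unfolding form_bounded_def by (intro sum_mono) blast
  also have "\<dots> = M * ((\<Sum>i\<in>A. \<Sum>l<k. \<Sum>x\<in>Pow A. (a x * u x i l)\<^sup>2) + (\<Sum>i\<in>A. \<Sum>l<k. \<Sum>x\<in>Pow A. (b x * u x i l)\<^sup>2)) / 2"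
    by (simp only: sum_divide_distrib[symmetric] sum_distrib_left[symmetric] sum.distrib)
  also have "\<dots> \<le> M * (c * (\<Sum>x\<in>Pow A. (a x)\<^sup>2) + c * (\<Sum>x\<in>Pow A. (b x)\<^sup>2)) / 2"
    by (intro divide_right_mono mult_left_mono add_mono cost M) simp
  finally show "bil (Pow A) G a b \<le> c * M * ((\<Sum>x\<in>Pow A. (a x)\<^sup>2) + (\<Sum>x\<in>Pow A. (b x)\<^sup>2)) / 2"
    by (simp add: algebra_simps)
qed

lemma bij_betw_cube: "bij_betw (\<lambda>x i. i \<in> x) (Pow {..<n}) (cube n)"
  by (rule bij_betw_byWitness[where f' = "\<lambda>x. {i. x i}"]) (auto simp: cube_def not_le[symmetric])

lemma finite_cube: "finite (cube n)"
  using bij_betw_finite[OF bij_betw_cube[of n]] by simp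

lemma has_primal_le_dual:
  assumes A: "finite A" and p: "has_primal A f c" and u: "dual_sol A f k u" "\<And>x. x \<in> Pow A \<Longrightarrow> dual_cost A k u x \<le> c'"
  shows "c \<le> c'"
proof -
  obtain G p q where G: "adv_sol A f G" "(\<Sum>x\<in>Pow A. (p x)\<^sup>2) = 1" "(\<Sum>x\<in>Pow A. (q x)\<^sup>2) = 1" "bil (Pow A) G p q = c"
    using p unfolding has_primal_def by blast
  have "form_bounded (Pow A) G (c' * 1)"
    using G(1) by (intro weak_duality[OF A u]) (auto simp: adv_sol_def form_bounded_def)
  then have "bil (Pow A) G p q \<le> c' * ((\<Sum>x\<in>Pow A. (p x)\<^sup>2) + (\<Sum>x\<in>Pow A. (q x)\<^sup>2)) / 2"
    unfolding form_bounded_def by simp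
  then show ?thesis by (simp add: G)
qed

lemma ADV_eq:
  assumes n: "n > 0" and c: "c > 0"
    and d: "has_dual {..<n} (\<lambda>x. f (\<lambda>i. i \<in> x)) c" and p: "has_primal {..<n} (\<lambda>x. f (\<lambda>i. i \<in> x)) c"
  shows "ADV n f = c"
proof -
  let ?F = "\<lambda>x. f (\<lambda>i. i \<in> x)" and ?T = "\<lambda>x i. (i::nat) \<in> x"
  let ?D = "\<lambda>G i x y. G x y * (if x i \<noteq> y i then 1 else (0::real))"
  let ?M = "\<lambda>G. Max ((\<lambda>i. opnorm (cube n) (?D G i)) ` {..<n})"
  obtain k u where u: "dual_sol {..<n} ?F k u" "\<And>x. x \<in> Pow {..<n} \<Longrightarrow> dual_cost {..<n} k u x \<le> c"
    using d unfolding has_dual_def by blast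
  have D: "form_bounded (Pow {..<n}) (\<lambda>x y. if differs i x y then G (?T x) (?T y) else 0) B
      \<longleftrightarrow> form_bounded (cube n) (?D G i) B" for G i B
    by (rule form_bounded_reindex[OF bij_betw_cube]) (simp add: differs_def)
  have Mge: "opnorm (cube n) (?D G i) \<le> ?M G" if "i < n" for G i
    using that by (intro Max_ge) auto
  have M0: "0 \<le> ?M G" for G
    using Mge[OF n] opnorm_nonneg[OF finite_cube] order_trans by blast
  have upper: "opnorm (cube n) G \<le> c * ?M G" if "adv_matrix n f G" for G
  proof -
    have "form_bounded (Pow {..<n}) (\<lambda>x y. G (?T x) (?T y)) (c * ?M G)"
    proof (rule weak_duality[OF _ u])
      fix x y assume "x \<in> Pow {..<n}" "y \<in> Pow {..<n}" "?F x = ?F y"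
      moreover from this have "?T x \<in> cube n" "?T y \<in> cube n"
        using bij_betw_apply[OF bij_betw_cube] by blast+
      ultimately show "G (?T x) (?T y) = 0"
        using that unfolding adv_matrix_def by blast
    next
      fix i assume "i \<in> {..<n}"
      then show "form_bounded (Pow {..<n}) (\<lambda>x y. if differs i x y then G (?T x) (?T y) else 0) (?M G)"
        unfolding D using Mge[of i G] form_bounded_mono form_bounded_opnorm[OF finite_cube] by blast
    qed (use M0 in auto)
    then have "form_bounded (cube n) G (c * ?M G)"
      using form_bounded_reindex[OF bij_betw_cube, of n "\<lambda>x y. G (?T x) (?T y)" G] by simp
    then show ?thesis
      using c M0 by (intro opnorm_le) auto
  qed
  obtain G0 p q where G0: "adv_sol {..<n} ?F G0" "(\<Sum>x\<in>Pow {..<n}. (p x)\<^sup>2) = 1" "(\<Sum>x\<in>Pow {..<n}. (q x)\<^sup>2) = 1"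
     "bil (Pow {..<n}) G0 p q = c"
    using p unfolding has_primal_def by blast
  define G where "G x y = G0 {i. x i} {i. y i}" for x y
  have GT: "G (?T x) (?T y) = G0 x y" for x y
    by (simp add: G_def)
  have cubeD: "{i. x i} \<in> Pow {..<n}" if "x \<in> cube n" for x
    using that by (auto simp: cube_def not_le[symmetric])
  have "adv_matrix n f G"
    unfolding adv_matrix_def
  proof (intro conjI ballI)
    fix x y assume "x \<in> cube n" "y \<in> cube n"
    then have xy: "{i. x i} \<in> Pow {..<n}" "{i. y i} \<in> Pow {..<n}" using cubeD by blast+
    have "G0 {i. x i} {i. y i} = G0 {i. y i} {i. x i} \<and> 0 \<le> G0 {i. x i} {i. y i} \<and>
       (?F {i. x i} = ?F {i. y i} \<longrightarrow> G0 {i. x i} {i. y i} = 0)"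
      using G0(1) xy unfolding adv_sol_def by blast
    then show "G x y = G y x" "0 \<le> G x y" "f x = f y \<longrightarrow> G x y = 0"
      unfolding G_def mem_Collect_eq by blast+
  next
    show "\<exists>x\<in>cube n. \<exists>y\<in>cube n. G x y \<noteq> 0"
    proof (rule ccontr)
      assume neg: "\<not> ?thesis"
      have "G0 x y = 0" if "x \<in> Pow {..<n}" "y \<in> Pow {..<n}" for x y
      proof -
        have "?T x \<in> cube n" "?T y \<in> cube n"
          using that bij_betw_apply[OF bij_betw_cube] by blast+
        then show ?thesis using neg GT by metis
      qed
      then have "bil (Pow {..<n}) G0 p q = 0"
        unfolding bil_def by (intro sum.neutral ballI) simp
      then show False using G0(4) c by simp
    qed
  qed
  note G = this
  have "opnorm (cube n) (?D G i) \<le> 1" if "i < n" for i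
  proof (rule opnorm_le)
    have "form_bounded (Pow {..<n}) (\<lambda>x y. if differs i x y then G (?T x) (?T y) else 0) 1"
      unfolding GT form_bounded_def using G0(1) that unfolding adv_sol_def by simp
    then show "form_bounded (cube n) (?D G i) 1" unfolding D .
  qed simp
  then have M1: "?M G \<le> 1"
    using n by (subst Max_le_iff) auto
  have "form_bounded (Pow {..<n}) G0 (opnorm (cube n) G)"
    using form_bounded_reindex[OF bij_betw_cube, of n G0 G] form_bounded_opnorm[OF finite_cube] GT by simp
  then have "bil (Pow {..<n}) G0 p q \<le> opnorm (cube n) G * ((\<Sum>x\<in>Pow {..<n}. (p x)\<^sup>2) + (\<Sum>x\<in>Pow {..<n}. (q x)\<^sup>2)) / 2"
    unfolding form_bounded_def by blast
  then have cG: "c \<le> opnorm (cube n) G"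
    by (simp add: G0)
  also note upper[OF G]
  \<comment> \<open>The chain c <= norm <= c M, with M the maximum over the variables, forces M >=
    1. The bound is therefore attained with M = 1.\<close>
  finally have "1 \<le> ?M G" using c by simp
  with M1 have M: "?M G = 1" by simp
  have "opnorm (cube n) G = c"
    using cG upper[OF G] M by simp
  then have mem: "opnorm (cube n) G / ?M G = c" using M by simp
  show ?thesis
    unfolding ADV_def
  proof (rule cSup_eq_maximum)
    show "c \<in> {opnorm (cube n) G / ?M G |G. adv_matrix n f G}"
      using mem G by force
    fix r assume "r \<in> {opnorm (cube n) G / ?M G |G. adv_matrix n f G}"
    then obtain H where H: "adv_matrix n f H" "r = opnorm (cube n) H / ?M H" by blast
    show "r \<le> c"
    \<comment> \<open>With maximum 0 the quotient is 0 by the convention for division, hence below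
      c.\<close>
    proof (cases "?M H = 0")
      case True
      show ?thesis unfolding H(2) True using c by simp
    next
      case False
      then have "?M H > 0" using M0[of H] by simp
      then show ?thesis unfolding H(2) using upper[OF H(1)] by (simp only: pos_divide_le_eq)
    qed
  qed
qed

section \<open>Span programs\<close>

lemma sum_lessThan_double:
  fixes F :: "nat \<Rightarrow> real"
  shows "(\<Sum>l<2 * k. F l) = (\<Sum>j<k. F (2 * j) + F (2 * j + 1))"
  by (induction k) (simp_all add: mult_Suc_right)

definition pos_wit :: "spanprog \<Rightarrow> (nat \<Rightarrow> bool) \<Rightarrow> (nat \<Rightarrow> complex) \<Rightarrow> bool" where
  "pos_wit P x w \<longleftrightarrow> (\<forall>k<sp_m P. (\<Sum>j<sp_N P. (if sp_true P x j then w j else 0) * sp_v P j k) = sp_target k)"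

definition neg_wit :: "spanprog \<Rightarrow> (nat \<Rightarrow> bool) \<Rightarrow> (nat \<Rightarrow> complex) \<Rightarrow> bool" where
  "neg_wit P x w' \<longleftrightarrow> (\<Sum>k<sp_m P. cnj (sp_target k) * w' k) = 1 \<and>
     (\<forall>j<sp_N P. sp_true P x j \<longrightarrow> (\<Sum>k<sp_m P. cnj (sp_v P j k) * w' k) = 0)"

text \<open>Moving A to the other side of the inner product turns the pairing of the two witnesses
  into that of the target with w', which is 1.\<close>

lemma wit_pairing:
  assumes w: "pos_wit P y w" and w': "(\<Sum>k<sp_m P. cnj (sp_target k) * w' k) = 1"
  shows "(\<Sum>j<sp_N P. (if sp_true P y j then w j else 0) * cnj (\<Sum>k<sp_m P. cnj (sp_v P j k) * w' k)) = 1"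
proof -
  have "(\<Sum>j<sp_N P. (if sp_true P y j then w j else 0) * cnj (\<Sum>k<sp_m P. cnj (sp_v P j k) * w' k))
     = (\<Sum>j<sp_N P. \<Sum>k<sp_m P. (if sp_true P y j then w j else 0) * sp_v P j k * cnj (w' k))"
    by (simp add: sum_distrib_left mult.assoc)
  also have "\<dots> = (\<Sum>k<sp_m P. (\<Sum>j<sp_N P. (if sp_true P y j then w j else 0) * sp_v P j k) * cnj (w' k))"
    by (subst sum.swap) (simp add: sum_distrib_right)
  also have "\<dots> = (\<Sum>k<sp_m P. sp_target k * cnj (w' k))"
    using w unfolding pos_wit_def by (intro sum.cong refl) simp
  also have "\<dots> = cnj (\<Sum>k<sp_m P. cnj (sp_target k) * w' k)"
    by simp
  finally show ?thesis using w' by simp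
qed

lemma sp_eval_iff_pos_wit: "sp_eval P x \<longleftrightarrow> (\<exists>w. pos_wit P x w)"
  by (simp add: sp_eval_def pos_wit_def)

text \<open>For witnesses of both kinds at the same input the pairing would vanish term by term,
  although it is 1.\<close>

lemma not_sp_eval_if_neg_wit:
  assumes "neg_wit P x w'"
  shows "\<not> sp_eval P x"
proof
  assume "sp_eval P x"
  then obtain w where w: "pos_wit P x w" unfolding sp_eval_iff_pos_wit by blast
  have "(\<Sum>j<sp_N P. (if sp_true P x j then w j else 0) * cnj (\<Sum>k<sp_m P. cnj (sp_v P j k) * w' k)) = 0"
  proof (intro sum.neutral ballI)
    fix j assume "j \<in> {..<sp_N P}"
    then have "(\<Sum>k<sp_m P. cnj (sp_v P j k) * w' k) = 0" if "sp_true P x j"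
      using assms that unfolding neg_wit_def by blast
    then show "(if sp_true P x j then w j else 0) * cnj (\<Sum>k<sp_m P. cnj (sp_v P j k) * w' k) = 0"
      by (cases "sp_true P x j") (simp_all only: if_True if_False complex_cnj_zero mult_zero_right mult_zero_left)
  qed
  moreover have "(\<Sum>j<sp_N P. (if sp_true P x j then w j else 0) * cnj (\<Sum>k<sp_m P. cnj (sp_v P j k) * w' k)) = 1"
    using assms unfolding neg_wit_def by (intro wit_pairing[OF w]) blast
  ultimately show False by simp
qed

lemma wsize_at_eq:
  "wsize_at P x = (if sp_eval P x then Inf {(\<Sum>j<sp_N P. sp_U P x j * (cmod (w j))\<^sup>2) | w. pos_wit P x w}
     else Inf {(\<Sum>j<sp_N P. sp_U P x j * (cmod (\<Sum>k<sp_m P. cnj (sp_v P j k) * w' k))\<^sup>2) | w'. neg_wit P x w'})"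
  unfolding wsize_at_def pos_wit_def neg_wit_def ..

lemma sp_U_nonneg: "0 \<le> sp_U P x j"
  by (simp add: sp_U_def sum_nonneg le_max_iff_disj)

text \<open>With one literal per vector both cases of the grouped complexity give 1, so witness
  sizes are plain squared norms.\<close>

lemma sp_U_singleton: "sp_X P j = {l} \<Longrightarrow> sp_U P x j = 1"
proof -
  assume X: "sp_X P j = {l}"
  show ?thesis
  proof (cases "sp_true P x j")
    case True
    then show ?thesis by (simp add: sp_U_def X)
  next
    case False
    then have "{l' \<in> sp_X P j. x (fst l') \<noteq> snd l'} = {l}"
      by (auto simp: X sp_true_def)
    then show ?thesis using False by (simp add: sp_U_def)
  qed
qed

lemma wsize_at_le:
  shows "pos_wit P x w \<Longrightarrow> wsize_at P x \<le> (\<Sum>j<sp_N P. sp_U P x j * (cmod (w j))\<^sup>2)"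
    and "neg_wit P x w' \<Longrightarrow> wsize_at P x \<le> (\<Sum>j<sp_N P. sp_U P x j * (cmod (\<Sum>k<sp_m P. cnj (sp_v P j k) * w' k))\<^sup>2)"
proof -
  have bdd: "bdd_below {(\<Sum>j<sp_N P. sp_U P x j * (cmod (g w j))\<^sup>2) | w. Q w}" for g :: "(nat \<Rightarrow> complex) \<Rightarrow> nat \<Rightarrow> complex" and Q
    by (rule bdd_belowI[of _ 0]) (auto intro!: sum_nonneg mult_nonneg_nonneg sp_U_nonneg)
  show "wsize_at P x \<le> (\<Sum>j<sp_N P. sp_U P x j * (cmod (w j))\<^sup>2)" if "pos_wit P x w"
  proof -
    have "sp_eval P x" using that sp_eval_iff_pos_wit by blast
    then show ?thesis
      unfolding wsize_at_eq using that bdd[of "\<lambda>w. w"] by (auto intro!: cInf_lower)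
  qed
  show "wsize_at P x \<le> (\<Sum>j<sp_N P. sp_U P x j * (cmod (\<Sum>k<sp_m P. cnj (sp_v P j k) * w' k))\<^sup>2)" if "neg_wit P x w'"
  proof -
    have "\<not> sp_eval P x" using that not_sp_eval_if_neg_wit by blast
    then show ?thesis
      unfolding wsize_at_eq using that bdd[of "\<lambda>w' j. \<Sum>k<sp_m P. cnj (sp_v P j k) * w' k"] by (auto intro!: cInf_lower)
  qed
qed

text \<open>Witnesses of a program with one literal per vector are themselves a dual solution, once
  their entries are grouped by the variable of the label. Weak duality then bounds their cost from
  below.\<close>

lemma wsize_lower_bound:
  assumes lit: "\<And>j. j < sp_N P \<Longrightarrow> sp_X P j = {lit j} \<and> fst (lit j) < n"
    and eval: "\<And>x. x \<in> cube n \<Longrightarrow> sp_eval P x = f x"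
    and neg: "\<And>x. x \<in> cube n \<Longrightarrow> \<not> f x \<Longrightarrow> \<exists>w'. neg_wit P x w'"
    and p: "has_primal {..<n} (\<lambda>x. f (\<lambda>i. i \<in> x)) c"
  shows "c \<le> wsize n P"
proof (rule field_le_epsilon)
  fix \<epsilon> :: real assume \<epsilon>: "\<epsilon> > 0"
  \<comment> \<open>The witness size is an infimum; the slack makes it strictly smaller than
    \<open>W\<close>, so witnesses below \<open>W\<close> exist without a proof of
    attainment.\<close>
  define W where "W = wsize n P + \<epsilon>"
  let ?T = "\<lambda>x i. (i::nat) \<in> x"
  let ?neg = "\<lambda>w' j. \<Sum>k<sp_m P. cnj (sp_v P j k) * w' k"
  have T: "?T x \<in> cube n" if "x \<in> Pow {..<n}" for x
    using that bij_betw_apply[OF bij_betw_cube] by blast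
  have U1: "(\<Sum>j<sp_N P. sp_U P x j * g j) = (\<Sum>j<sp_N P. g j)" for x g
    by (intro sum.cong refl) (use lit sp_U_singleton in auto)
  have less: "wsize_at P x < W" if "x \<in> cube n" for x
  proof -
    have "wsize_at P x \<le> wsize n P"
      unfolding wsize_def using that finite_cube by (intro Max_ge) auto
    then show ?thesis using \<epsilon> by (simp add: W_def)
  qed
  have ex: "\<exists>w. (if f x then pos_wit P x w \<and> (\<Sum>j<sp_N P. (cmod (w j))\<^sup>2) < W
      else neg_wit P x w \<and> (\<Sum>j<sp_N P. (cmod (?neg w j))\<^sup>2) < W)" if x: "x \<in> cube n" for x
  proof (cases "f x")
    case True
    then have ev: "sp_eval P x" using eval x by simp
    let ?S = "{(\<Sum>j<sp_N P. sp_U P x j * (cmod (w j))\<^sup>2) | w. pos_wit P x w}"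
    have "Inf ?S < W"
      using less[OF x] ev unfolding wsize_at_eq by simp
    moreover have "?S \<noteq> {}"
      using ev unfolding sp_eval_iff_pos_wit by blast
    ultimately have "\<exists>r\<in>?S. r < W"
      by (intro cInf_lessD)
    then obtain w where "pos_wit P x w" "(\<Sum>j<sp_N P. sp_U P x j * (cmod (w j))\<^sup>2) < W"
      by blast
    then show ?thesis using True U1 by auto
  next
    case False
    then have ev: "\<not> sp_eval P x" using eval x by simp
    let ?S = "{(\<Sum>j<sp_N P. sp_U P x j * (cmod (?neg w' j))\<^sup>2) | w'. neg_wit P x w'}"
    have "Inf ?S < W"
      using less[OF x] ev unfolding wsize_at_eq by simp
    \<comment> \<open>Extracting an element below an infimum needs a nonempty set; negative
      witnesses are supplied by the assumption \<open>neg\<close>.\<close>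
    moreover have "?S \<noteq> {}"
      using neg[OF x False] by blast
    ultimately have "\<exists>r\<in>?S. r < W"
      by (intro cInf_lessD)
    then obtain w' where "neg_wit P x w'" "(\<Sum>j<sp_N P. sp_U P x j * (cmod (?neg w' j))\<^sup>2) < W"
      by blast
    then show ?thesis using False U1 by auto
  qed
  have "\<forall>x\<in>cube n. \<exists>w. (if f x then pos_wit P x w \<and> (\<Sum>j<sp_N P. (cmod (w j))\<^sup>2) < W
      else neg_wit P x w \<and> (\<Sum>j<sp_N P. (cmod (?neg w j))\<^sup>2) < W)"
    using ex by (intro ballI)
  from bchoice[OF this] obtain w where w: "\<And>x. x \<in> cube n \<Longrightarrow> (if f x then pos_wit P x (w x) \<and> (\<Sum>j<sp_N P. (cmod (w x j))\<^sup>2) < W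
      else neg_wit P x (w x) \<and> (\<Sum>j<sp_N P. (cmod (?neg (w x) j))\<^sup>2) < W)"
    by (elim exE) (rule that, drule bspec, assumption+)
  define val where "val x j = (if f x then if sp_true P x j then w x j else 0 else ?neg (w x) j)" for x j
  \<comment> \<open>Complex entries become pairs of real coordinates, the real part at even and the
    imaginary part at odd positions; products of such pairs sum to the real part of the Hermitian
    product.\<close>
  define u :: "nat set \<Rightarrow> nat \<Rightarrow> nat \<Rightarrow> real" where
    "u x i l = (if fst (lit (l div 2)) = i then (if even l then Re (val (?T x) (l div 2)) else Im (val (?T x) (l div 2))) else 0)" for x i l
  have prod: "(\<Sum>l<2 * sp_N P. u x i l * u y i l) = (\<Sum>j<sp_N P. if fst (lit j) = i then Re (val (?T x) j * cnj (val (?T y) j)) else 0)" for x y i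
    unfolding sum_lessThan_double by (intro sum.cong refl) (simp add: u_def)
  have total: "(\<Sum>i<n. \<Sum>j<sp_N P. if fst (lit j) = i then g i j else 0) = (\<Sum>j<sp_N P. g (fst (lit j)) j)" for g :: "nat \<Rightarrow> nat \<Rightarrow> real"
    using lit by (subst sum.swap) (intro sum.cong refl, simp add: sum.delta)
  have pair: "pairing {..<n} (2 * sp_N P) u x y = 1"
    if x: "x \<in> Pow {..<n}" "\<not> f (?T x)" and y: "y \<in> Pow {..<n}" "f (?T y)" for x y
  proof -
    have wx: "neg_wit P (?T x) (w (?T x))" and wy: "pos_wit P (?T y) (w (?T y))"
      using w[OF T[OF x(1)]] w[OF T[OF y(1)]] x y by simp_all
    have "pairing {..<n} (2 * sp_N P) u x y = (\<Sum>i<n. \<Sum>j<sp_N P. if fst (lit j) = i then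
        (if differs i x y then Re (val (?T x) j * cnj (val (?T y) j)) else 0) else 0)"
      unfolding pairing_def prod
    proof (intro sum.cong refl, goal_cases)
      case (1 i)
      show ?case by (cases "differs i x y") (simp_all cong: if_cong)
    qed
    also have "\<dots> = (\<Sum>j<sp_N P. if differs (fst (lit j)) x y then Re (val (?T x) j * cnj (val (?T y) j)) else 0)"
      by (rule total)
    \<comment> \<open>Restricting to differing variables loses nothing. If x and y agree on the
      variable of the label, the vector is available on both or on neither: in the first case the
      negative witness of x vanishes there, in the second the masked positive witness of y
      does.\<close>
    also have "\<dots> = (\<Sum>j<sp_N P. Re (val (?T x) j * cnj (val (?T y) j)))"
    proof (intro sum.cong refl)
      fix j assume j: "j \<in> {..<sp_N P}"
      have X: "sp_X P j = {lit j}" using lit j by simp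
      show "(if differs (fst (lit j)) x y then Re (val (?T x) j * cnj (val (?T y) j)) else 0) = Re (val (?T x) j * cnj (val (?T y) j))"
      proof (cases "differs (fst (lit j)) x y")
        case False
        then have "sp_true P (?T x) j = sp_true P (?T y) j"
          by (cases "lit j") (simp add: sp_true_def X differs_def)
        then have "val (?T x) j = 0 \<or> val (?T y) j = 0"
          using wx j x(2) y(2) by (auto simp: val_def neg_wit_def)
        then show ?thesis by auto
      qed simp
    qed
    also have "\<dots> = Re (cnj (\<Sum>j<sp_N P. (if sp_true P (?T y) j then w (?T y) j else 0) * cnj (?neg (w (?T x)) j)))"
      unfolding Re_sum[symmetric] using x(2) y(2) by (simp add: val_def mult.commute)
    also have "\<dots> = 1"
      using wx by (subst wit_pairing[OF wy]) (simp_all add: neg_wit_def)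
    finally show ?thesis .
  qed
  have "dual_sol {..<n} (\<lambda>x. f (?T x)) (2 * sp_N P) u"
    unfolding dual_sol_pairing using pair pairing_commute[of "{..<n}" "2 * sp_N P" u] by metis
  moreover have "dual_cost {..<n} (2 * sp_N P) u x \<le> W" if x: "x \<in> Pow {..<n}" for x
  proof -
    have "dual_cost {..<n} (2 * sp_N P) u x = (\<Sum>j<sp_N P. (cmod (val (?T x) j))\<^sup>2)"
      unfolding dual_cost_def power2_eq_square[of "u _ _ _"] prod total
      by (simp add: complex_mult_cnj cmod_power2)
    also have "\<dots> \<le> (if f (?T x) then \<Sum>j<sp_N P. (cmod (w (?T x) j))\<^sup>2 else \<Sum>j<sp_N P. (cmod (?neg (w (?T x)) j))\<^sup>2)"
      by (auto simp: val_def intro!: sum_mono)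
    also have "\<dots> \<le> W" using w[OF T[OF x]] by (auto split: if_splits)
    finally show ?thesis .
  qed
  ultimately show "c \<le> wsize n P + \<epsilon>"
    unfolding W_def[symmetric] using has_primal_le_dual[OF _ p] by blast
qed

text \<open>
  Row x of the natural program holds the vectors u(x,i), and its target is the all-ones vector.
  Subtracting the row of the first zero from all other rows turns the target into (1,0,...,0).
\<close>

lemma span_program_of_dual:
  fixes f :: "(nat \<Rightarrow> bool) \<Rightarrow> bool"
  assumes u: "dual_sol {..<n} (\<lambda>x. f (\<lambda>i. i \<in> x)) k u"
    and cost: "\<And>x. x \<in> Pow {..<n} \<Longrightarrow> dual_cost {..<n} k u x \<le> c"
    and zero: "\<exists>x\<in>cube n. \<not> f x"
  obtains P lit where "sp_valid n P" "\<And>j. j < sp_N P \<Longrightarrow> sp_X P j = {lit j} \<and> fst (lit j) < n"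
    "\<And>x. x \<in> cube n \<Longrightarrow> sp_eval P x = f x" "\<And>x. x \<in> cube n \<Longrightarrow> \<not> f x \<Longrightarrow> \<exists>w'. neg_wit P x w'"
    "\<And>x. x \<in> cube n \<Longrightarrow> wsize_at P x \<le> c"
proof -
  let ?s = "\<lambda>x. {i. (x :: nat \<Rightarrow> bool) i}"
  have s: "?s x \<in> Pow {..<n}" if "x \<in> cube n" for x
    using that by (auto simp: cube_def not_le[symmetric])
  define Z where "Z = {x \<in> cube n. \<not> f x}"
  have "finite Z" unfolding Z_def using finite_cube by simp
  then obtain z where z: "bij_betw z {0..<card Z} Z"
    using ex_bij_betw_nat_finite by blast
  have m: "card Z \<ge> 1"
    using zero \<open>finite Z\<close> by (auto simp: Z_def Suc_le_eq card_gt_0_iff)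
  have zmem: "z \<kappa> \<in> cube n" "\<not> f (z \<kappa>)" if "\<kappa> < card Z" for \<kappa>
    using bij_betwE[OF z] that by (auto simp: Z_def)
  \<comment> \<open>One vector for each literal and each coordinate of the dual solution.\<close>
  define I where "I = {..<n} \<times> (UNIV :: bool set) \<times> {..<k}"
  have "finite I" by (simp add: I_def)
  then obtain e where e: "bij_betw e {0..<card I} I"
    using ex_bij_betw_nat_finite by blast
  have sumI: "(\<Sum>j<card I. H (e j)) = (\<Sum>i<n. \<Sum>b\<in>UNIV. \<Sum>l<k. H (i, b, l))" for H :: "_ \<Rightarrow> 'a::comm_monoid_add"
    unfolding lessThan_atLeast0 sum.reindex_bij_betw[OF e] unfolding I_def
    by (simp add: sum.cartesian_product split_def atLeast0LessThan)
  \<comment> \<open>Row x is nonzero only at literals false on x, so all vectors available on x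
    vanish in that row; before the change of basis this makes the unit vector of the row a negative
    witness.\<close>
  define V where "V x = (\<lambda>(i, b, l). if x i \<noteq> b then u (?s x) i l else 0)" for x
  define lit where "lit j = (fst (e j), fst (snd (e j)))" for j
  define P where "P = \<lparr>sp_m = card Z, sp_N = card I,
     sp_v = (\<lambda>j \<kappa>. complex_of_real (if \<kappa> = 0 then V (z 0) (e j) else V (z \<kappa>) (e j) - V (z 0) (e j))),
     sp_X = (\<lambda>j. {lit j})\<rparr>"
  have P: "sp_m P = card Z" "sp_N P = card I" "sp_X P j = {lit j}"
     "sp_v P j \<kappa> = complex_of_real (if \<kappa> = 0 then V (z 0) (e j) else V (z \<kappa>) (e j) - V (z 0) (e j))" for j \<kappa>
    by (simp_all add: P_def)
  have lit: "fst (lit j) < n" if "j < card I" for j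
    using bij_betwE[OF e] that by (force simp: lit_def I_def)
  have true: "sp_true P x j \<longleftrightarrow> x (fst (e j)) = fst (snd (e j))" for x j
    by (simp add: sp_true_def P lit_def)
  have U: "sp_U P x j = 1" for x j
    by (rule sp_U_singleton[OF P(3)])
  have valid: "sp_valid n P"
    using m lit unfolding sp_valid_def P by (auto simp: mem_Times_iff)
  have pos: "\<exists>w. pos_wit P y w \<and> (\<Sum>j<sp_N P. sp_U P y j * (cmod (w j))\<^sup>2) \<le> c"
    if y: "y \<in> cube n" "f y" for y
  proof -
    \<comment> \<open>The vectors of the one y, placed at the literals true on y. Against row x a
      product survives only where x and y differ, so the sum is the dual pairing, equal to
      1.\<close>
    define w where "w = (\<lambda>(i, b, l). if y i = b then u (?s y) i l else 0)"
    have wV: "(\<Sum>j<card I. w (e j) * V x (e j)) = 1" if x: "x \<in> cube n" "\<not> f x" for x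
    proof -
      have "(\<Sum>j<card I. w (e j) * V x (e j)) = (\<Sum>i<n. \<Sum>b\<in>UNIV. \<Sum>l<k. w (i, b, l) * V x (i, b, l))"
        by (rule sumI[of "\<lambda>t. w t * V x t"])
      also have "\<dots> = (\<Sum>i<n. if differs i (?s x) (?s y) then \<Sum>l<k. u (?s x) i l * u (?s y) i l else 0)"
        by (intro sum.cong refl) (auto simp: UNIV_bool w_def V_def differs_def mult.commute)
      also have "\<dots> = 1"
        using u s[OF x(1)] s[OF y(1)] x(2) y(2) unfolding dual_sol_def by simp
      finally show ?thesis .
    qed
    have "pos_wit P y (\<lambda>j. complex_of_real (w (e j)))"
      unfolding pos_wit_def
    proof (intro allI impI)
      fix \<kappa> assume \<kappa>: "\<kappa> < sp_m P"
      have wt: "(if sp_true P y j then complex_of_real (w (e j)) else 0) = complex_of_real (w (e j))" for j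
        by (simp add: true w_def split_def)
      have "(\<Sum>j<sp_N P. (if sp_true P y j then complex_of_real (w (e j)) else 0) * sp_v P j \<kappa>)
        = complex_of_real (\<Sum>j<card I. w (e j) * (if \<kappa> = 0 then V (z 0) (e j) else V (z \<kappa>) (e j) - V (z 0) (e j)))"
        unfolding wt P by simp
      also have "\<dots> = complex_of_real (if \<kappa> = 0 then 1 else 0)"
      proof -
        have "(\<Sum>j<card I. w (e j) * V (z 0) (e j)) = 1" "(\<Sum>j<card I. w (e j) * V (z \<kappa>) (e j)) = 1"
          using m \<kappa> by (auto intro!: wV zmem simp: P)
        then show ?thesis
          by (intro arg_cong[where f = complex_of_real]) (simp add: right_diff_distrib sum_subtractf)
      qed
      finally show "(\<Sum>j<sp_N P. (if sp_true P y j then complex_of_real (w (e j)) else 0) * sp_v P j \<kappa>) = sp_target \<kappa>"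
        by (simp add: sp_target_def)
    qed
    moreover have "(\<Sum>j<sp_N P. sp_U P y j * (cmod (complex_of_real (w (e j))))\<^sup>2) = dual_cost {..<n} k u (?s y)"
    proof -
      have "(\<Sum>j<card I. (w (e j))\<^sup>2) = (\<Sum>i<n. \<Sum>b\<in>UNIV. \<Sum>l<k. (w (i, b, l))\<^sup>2)"
        by (rule sumI[of "\<lambda>t. (w t)\<^sup>2"])
      also have "\<dots> = dual_cost {..<n} k u (?s y)"
        unfolding dual_cost_def
      proof (intro sum.cong refl, goal_cases)
        case (1 i)
        show ?case by (cases "y i") (simp_all add: UNIV_bool w_def)
      qed
      finally show ?thesis by (simp add: U P)
    qed
    ultimately show ?thesis using cost[OF s[OF y(1)]] by metis
  qed
  have neg: "\<exists>w'. neg_wit P x w' \<and> (\<Sum>j<sp_N P. sp_U P x j * (cmod (\<Sum>\<kappa><sp_m P. cnj (sp_v P j \<kappa>) * w' \<kappa>))\<^sup>2) \<le> c"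
    if x: "x \<in> cube n" "\<not> f x" for x
  proof -
    have "x \<in> Z" using x by (simp add: Z_def)
    then obtain \<kappa>0 where \<kappa>0: "\<kappa>0 < card Z" "z \<kappa>0 = x"
      using bij_betw_imp_surj_on[OF z] by (metis atLeastLessThan_iff imageE)
    \<comment> \<open>Every row but the first has had the first row subtracted. Adding the first row
      to row \<kappa>0 recovers the original row of x; for \<kappa>0 = 0 nothing is added. The entry
      0 is 1 in both cases, as the target demands.\<close>
    define w' :: "nat \<Rightarrow> complex" where "w' \<kappa> = (if \<kappa> = 0 then 1 else 0) + (if \<kappa> = \<kappa>0 then if \<kappa>0 = 0 then 0 else 1 else 0)" for \<kappa>
    have sum_w': "(\<Sum>\<kappa><card Z. g \<kappa> * w' \<kappa>) = g 0 + (if \<kappa>0 = 0 then 0 else g \<kappa>0)" for g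
      using m \<kappa>0 unfolding w'_def distrib_left sum.distrib
      by (simp add: if_distrib[where f = "\<lambda>t. _ * t"] cong: if_cong)
    have vw: "(\<Sum>\<kappa><sp_m P. cnj (sp_v P j \<kappa>) * w' \<kappa>) = complex_of_real (V x (e j))" for j
      unfolding P sum_w' using \<kappa>0 by auto
    have "neg_wit P x w'"
      unfolding neg_wit_def vw
      by (auto simp: P sum_w' sp_target_def true V_def split_def)
    moreover have "(\<Sum>j<sp_N P. sp_U P x j * (cmod (\<Sum>\<kappa><sp_m P. cnj (sp_v P j \<kappa>) * w' \<kappa>))\<^sup>2) = dual_cost {..<n} k u (?s x)"
    proof -
      have "(\<Sum>j<card I. (V x (e j))\<^sup>2) = (\<Sum>i<n. \<Sum>b\<in>UNIV. \<Sum>l<k. (V x (i, b, l))\<^sup>2)"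
        by (rule sumI[of "\<lambda>t. (V x t)\<^sup>2"])
      also have "\<dots> = dual_cost {..<n} k u (?s x)"
        unfolding dual_cost_def
      proof (intro sum.cong refl, goal_cases)
        case (1 i)
        show ?case by (cases "x i") (simp_all add: UNIV_bool V_def)
      qed
      finally show ?thesis unfolding vw by (simp add: U P)
    qed
    ultimately show ?thesis
      using cost[OF s[OF x(1)]] by (intro exI[of _ w'] conjI) (assumption, simp only:)
  qed
  show thesis
  proof (rule that[of P lit])
    show "sp_eval P x = f x" if "x \<in> cube n" for x
      using pos[OF that] neg[OF that] not_sp_eval_if_neg_wit sp_eval_iff_pos_wit by blast
    show "wsize_at P x \<le> c" if "x \<in> cube n" for x
    proof (cases "f x")
      case True
      then show ?thesis using pos[OF that] wsize_at_le(1)[of P x] order_trans by blast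
    next
      case False
      then show ?thesis using neg[OF that] wsize_at_le(2)[of P x] order_trans by blast
    qed
    show "\<exists>w'. neg_wit P x w'" if "x \<in> cube n" "\<not> f x" for x
      using neg[OF that] by blast
  qed (use valid lit P(2,3) in auto)
qed

lemma opt_of_in_SK:
  assumes "in_SK K n f"
  shows "opt {..<n} (\<lambda>x. f (\<lambda>i. i \<in> x))"
proof -
  obtain g l phi vs where g: "distinct (rof_leaves g)" "set (rof_leaves g) = {..<l}"
    and gate: "\<And>r. r < l \<Longrightarrow> SK'_gate K (phi r) (vs r) \<and> set (vs r) \<subseteq> {..<n}"
    and disj: "\<And>r r'. r < l \<Longrightarrow> r' < l \<Longrightarrow> r \<noteq> r' \<Longrightarrow> set (vs r) \<inter> set (vs r') = {}"
    and f: "\<And>x. x \<in> cube n \<Longrightarrow> f x = rof_eval g (\<lambda>r. phi r (map x (vs r)))"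
    using assms unfolding in_SK_def by (elim exE conjE) (rule that, assumption+, blast+)
  define A where "A = (\<Union>r\<in>{..<l}. set (vs r))"
  define F where "F x = rof_eval g (\<lambda>r. phi r (map (\<lambda>i. i \<in> x) (vs r)))" for x
  have "opt A F"
    unfolding A_def F_def g(2)[symmetric]
    using gate disj g by (intro opt_formula[where R = "{..<l}"]) auto
  moreover have A: "A \<subseteq> {..<n}" using gate by (auto simp: A_def)
  ultimately have "opt (A \<union> ({..<n} - A)) (\<lambda>x. F (x \<inter> A))"
    by (intro opt_extend) (auto simp: A_def)
  also have "A \<union> ({..<n} - A) = {..<n}" using A by auto
  also have "opt {..<n} (\<lambda>x. F (x \<inter> A)) = opt {..<n} (\<lambda>x. f (\<lambda>i. i \<in> x))"
  proof (rule opt_cong)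
    fix x assume "x \<in> Pow {..<n}"
    then have "(\<lambda>i. i \<in> x) \<in> cube n" using bij_betw_apply[OF bij_betw_cube] by blast
    then have "f (\<lambda>i. i \<in> x) = F x" using f by (simp add: F_def)
    also have "F x = F (x \<inter> A)"
      unfolding F_def using g(2)
      by (intro rof_eval_cong arg_cong[where f = "phi _"] map_cong refl) (auto simp: A_def)
    finally show "F (x \<inter> A) = f (\<lambda>i. i \<in> x)" ..
  qed
  finally show ?thesis .
qed

theorem theorem4p8:
  fixes K n :: nat and f :: "(nat \<Rightarrow> bool) \<Rightarrow> bool"
  assumes "in_SK K n f"
    and "\<exists>x\<in>cube n. \<exists>y\<in>cube n. f x \<noteq> f y"
  shows "\<exists>P. sp_valid n P \<and> (\<forall>x\<in>cube n. sp_eval P x = f x) \<and> wsize n P = ADV n f"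
proof -
  let ?F = "\<lambda>x. f (\<lambda>i. i \<in> x)"
  obtain x y where xy: "x \<in> cube n" "y \<in> cube n" "\<not> f x" "f y"
    using assms(2) by blast
  have "n > 0"
  proof (rule ccontr)
    assume "\<not> n > 0"
    then have "x = y" using xy(1,2) by (auto simp: cube_def)
    then show False using xy(3,4) by simp
  qed
  have "{i. x i} \<in> Pow {..<n}" "{i. y i} \<in> Pow {..<n}"
    using xy(1,2) by (auto simp: cube_def not_le[symmetric])
  moreover have "\<not> ?F {i. x i}" "?F {i. y i}"
    using xy(3,4) by simp_all
  ultimately have "tight {..<n} ?F"
    using opt_of_in_SK[OF assms(1)] unfolding opt_def by blast
  then obtain c where c: "c > 0" "has_dual {..<n} ?F c" "has_primal {..<n} ?F c"
    unfolding tight_def by blast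
  obtain k u where u: "dual_sol {..<n} ?F k u" "\<And>x. x \<in> Pow {..<n} \<Longrightarrow> dual_cost {..<n} k u x \<le> c"
    using c(2) unfolding has_dual_def by blast
  obtain P lit where P: "sp_valid n P" "\<And>j. j < sp_N P \<Longrightarrow> sp_X P j = {lit j} \<and> fst (lit j) < n"
    "\<And>x. x \<in> cube n \<Longrightarrow> sp_eval P x = f x" "\<And>x. x \<in> cube n \<Longrightarrow> \<not> f x \<Longrightarrow> \<exists>w'. neg_wit P x w'"
    "\<And>x. x \<in> cube n \<Longrightarrow> wsize_at P x \<le> c"
    using span_program_of_dual[OF u] xy by blast
  have "wsize n P \<le> c"
    unfolding wsize_def using P(5) xy(1) finite_cube by (subst Max_le_iff) auto
  moreover have "c \<le> wsize n P"
    by (rule wsize_lower_bound[OF P(2-4) c(3)])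
  ultimately have "wsize n P = ADV n f"
    using ADV_eq[OF \<open>n > 0\<close> c] by simp
  then show ?thesis using P(1,3) by blast
qed

end
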